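(* For every integer $n \geq 0$ and every graph $\tilde G \in \{\tilde\Gamma_{n,5}, \tilde\Lambda_{n,5}, \tilde A_{n,5}, \tilde B_{n,5}, \tilde C_{n,5}, \tilde D_{n,5}, \tilde E_{n,5}, \tilde F_{n,5}\}$ (defined below), the independence complex $\mathrm{Ind}(\tilde G)$ is homotopy equivalent to a wedge of spheres.
   Context: The independence complex $\mathrm{Ind}(G)$ of a graph $G$ is the simplicial complex on $V(G)$ whose simplices are the independent sets of $G$. A contractible space is regarded as a (trivial, empty) wedge of spheres. All graphs are simple. For $n \geq 0$, $\Gamma_{n,5}$ has vertices $g_{ij}$, $1 \leq i \leq 4$, $1 \leq j \leq 2n+1$, and edges: $g_{ij}g_{i+1,j}$ for $i=1,2,3$ and all $j$; $g_{ij}g_{i,j+1}$ for $i=1,\dots,4$, $j=1,\dots,2n$; and $g_{ij}g_{i+1,j+1}$, $g_{i,j+1}g_{i+1,j}$ for $i=1,2,3$, $j=1,\dots,2n$ with $i+j \equiv 1 \pmod 2$. Define graphs containing $\Gamma_{n,5}$ by adding vertices and edges: - $\Lambda_{n,5}$: vertices $l_1,\dots,l_4$; edges $l_1l_2, l_2l_3, l_3l_4, g_{11}l_1, g_{11}l_2, g_{21}l_1, g_{21}l_2, g_{31}l_3, g_{31}l_4, g_{41}l_3, g_{41}l_4$. - $A_{n,5}$: vertices $a_1,a_2$; edges $a_1g_{11}, a_1g_{21}, a_2g_{31}, a_2g_{41}$. - $B_{n,5}$: vertices $b_1,\dots,b_6$; edges $b_1b_2, b_1b_4, b_1b_5, b_2b_6,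 b_3b_4, b_4b_5, b_5b_6, b_3g_{11}, b_3g_{21}, b_4g_{11}, b_4g_{21}, b_5g_{31}, b_5g_{41}, b_6g_{31}, b_6g_{41}$. - $C_{n,5}$: vertex $c_1$; edges $c_1g_{31}, c_1g_{41}$. - $D_{n,5}$: vertices $d_1,d_2$; edges $d_1d_2, d_1g_{11}, d_1g_{21}, d_2g_{31}, d_2g_{41}$. - $E_{n,5}$: vertex $e_1$; edges $e_1g_{11}, e_1g_{21}, e_1g_{31}, e_1g_{41}$. - $F_{n,5}$: vertices $f_1,f_2,f_3$; edges $f_1f_2, f_2f_3, f_1g_{11}, f_1g_{21}, f_2g_{31}, f_2g_{41}, f_3g_{31}, f_3g_{41}$. For each $H_{n,5} \in \{\Gamma_{n,5},\Lambda_{n,5},A_{n,5},B_{n,5},C_{n,5},D_{n,5},E_{n,5},F_{n,5}\}$, the graph $\tilde H_{n,5}$ is obtained from $H_{n,5}$ by adding the four vertices $g_{1,2n+2},g_{2,2n+2},g_{3,2n+2},g_{4,2n+2}$ and the edges $g_{i,2n+1}g_{i,2n+2}$ ($i=1,2,3,4$), $g_{i,2n+2}g_{i+1,2n+2}$ ($i=1,2,3$), $g_{2,2n+1}g_{3,2n+2}$ and $g_{3,2n+1}g_{2,2n+2}$. *)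

theory Defs
  imports "HOL-Analysis.Analysis"
begin

section \<open>Wedge sums of pointed spaces\<close>

text \<open>
  The wedge of the pointed spaces \<open>(X i, p i)\<close>, \<open>i \<in> I\<close>, is the quotient of their disjoint union
  that identifies all base points.  Its points are represented by \<^term>\<open>None\<close> (the common base
  point) and \<^term>\<open>Some (i, x)\<close> with \<open>x\<close> different from the base point \<open>p i\<close>; the topology is the
  quotient topology along \<open>wedge_proj p\<close>.  The base point \<^term>\<open>None\<close> is present also if \<open>I\<close> is
  empty, so that the empty wedge is a one-point space.
\<close>

definition wedge_proj :: "('i \<Rightarrow> 'a) \<Rightarrow> 'i \<times> 'a \<Rightarrow> ('i \<times> 'a) option" where
  "wedge_proj p z = (if snd z = p (fst z) then None else Some z)"

definition wedge_carrier :: "('i \<Rightarrow> 'a topology) \<Rightarrow> ('i \<Rightarrow> 'a) \<Rightarrow> 'i set \<Rightarrow> ('i \<times> 'a) option set" where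
  "wedge_carrier X p I = insert None (wedge_proj p ` topspace (sum_topology X I))"

definition wedge_topology :: "('i \<Rightarrow> 'a topology) \<Rightarrow> ('i \<Rightarrow> 'a) \<Rightarrow> 'i set \<Rightarrow> ('i \<times> 'a) option topology" where
  "wedge_topology X p I =
     topology (\<lambda>U. U \<subseteq> wedge_carrier X p I \<and>
       openin (sum_topology X I) {z \<in> topspace (sum_topology X I). wedge_proj p z \<in> U})"

lemma openin_wedge_topology:
  "openin (wedge_topology X p I) U \<longleftrightarrow>
     U \<subseteq> wedge_carrier X p I \<and>
     openin (sum_topology X I) {z \<in> topspace (sum_topology X I). wedge_proj p z \<in> U}"
proof -
  let ?S = "sum_topology X I"
  let ?P = "\<lambda>U. {z \<in> topspace ?S. wedge_proj p z \<in> U}"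
  have inter: "?P (U \<inter> V) = ?P U \<inter> ?P V" for U V
    by auto
  have union: "?P (\<Union>\<K>) = \<Union>(?P ` \<K>)" for \<K>
    by auto
  have "istopology (\<lambda>U. U \<subseteq> wedge_carrier X p I \<and> openin ?S (?P U))"
  proof (unfold istopology_def, intro conjI allI impI)
    fix U V
    assume U: "U \<subseteq> wedge_carrier X p I \<and> openin ?S (?P U)"
      and V: "V \<subseteq> wedge_carrier X p I \<and> openin ?S (?P V)"
    show "U \<inter> V \<subseteq> wedge_carrier X p I" using U by blast
    show "openin ?S (?P (U \<inter> V))"
      by (subst inter) (use U V in \<open>blast intro: openin_Int\<close>)
  next
    fix \<K>
    assume K: "\<forall>U\<in>\<K>. U \<subseteq> wedge_carrier X p I \<and> openin ?S (?P U)"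
    show "\<Union>\<K> \<subseteq> wedge_carrier X p I" using K by blast
    show "openin ?S (?P (\<Union>\<K>))"
      by (subst union) (use K in \<open>blast intro: openin_Union\<close>)
  qed
  then show ?thesis
    by (simp add: wedge_topology_def topology_inverse')
qed

lemma topspace_wedge_topology: "topspace (wedge_topology X p I) = wedge_carrier X p I"
proof -
  have "{z \<in> topspace (sum_topology X I). wedge_proj p z \<in> wedge_carrier X p I}
        = topspace (sum_topology X I)"
    unfolding wedge_carrier_def by auto
  then have "openin (wedge_topology X p I) (wedge_carrier X p I)"
    by (simp only: openin_wedge_topology order_refl openin_topspace simp_thms)
  then have "wedge_carrier X p I \<subseteq> topspace (wedge_topology X p I)"
    by (rule openin_subset)
  moreover have "topspace (wedge_topology X p I) \<subseteq> wedge_carrier X p I"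
    using openin_topspace[of "wedge_topology X p I"] by (simp only: openin_wedge_topology)
  ultimately show ?thesis by (rule subset_antisym[rotated])
qed

lemma quotient_map_wedge_proj:
  assumes "I \<noteq> {}" and p: "\<And>i. i \<in> I \<Longrightarrow> p i \<in> topspace (X i)"
  shows "quotient_map (sum_topology X I) (wedge_topology X p I) (wedge_proj p)"
proof -
  obtain i where i: "i \<in> I" using assms(1) by blast
  then have "(i, p i) \<in> topspace (sum_topology X I)" using p by simp
  moreover have "wedge_proj p (i, p i) = None" by (simp add: wedge_proj_def)
  ultimately have "None \<in> wedge_proj p ` topspace (sum_topology X I)" by (metis imageI)
  then have "wedge_carrier X p I = wedge_proj p ` topspace (sum_topology X I)"
    unfolding wedge_carrier_def by (rule insert_absorb)
  then show ?thesis
    unfolding quotient_map_def topspace_wedge_topology openin_wedge_topology by blast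
qed

text \<open>
  The sphere of dimension \<open>d\<close> is the library's \<^term>\<open>nsphere d\<close>, whose points are real sequences
  vanishing beyond index \<open>d\<close>; the base point is the first unit vector.  A list of dimensions
  describes a finite wedge of spheres.
\<close>

definition sphere_basepoint :: "nat \<Rightarrow> real" where
  "sphere_basepoint = (\<lambda>k. if k = 0 then 1 else 0)"

lemma sphere_basepoint_in_nsphere: "sphere_basepoint \<in> topspace (nsphere d)"
proof -
  have "(\<Sum>k\<le>d. sphere_basepoint k ^ 2) = (\<Sum>k\<le>d. if k = 0 then 1 else 0)"
    by (rule sum.cong) (auto simp: sphere_basepoint_def)
  also have "\<dots> = 1" by simp
  finally show ?thesis by (simp add: nsphere sphere_basepoint_def)
qed

definition sphere_wedge :: "nat list \<Rightarrow> (nat \<times> (nat \<Rightarrow> real)) option topology" where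
  "sphere_wedge ds =
     wedge_topology (\<lambda>i. nsphere (ds ! i)) (\<lambda>i. sphere_basepoint) {..<length ds}"

definition homotopy_equivalent_to_wedge_of_spheres :: "'a topology \<Rightarrow> bool" where
  "homotopy_equivalent_to_wedge_of_spheres X \<longleftrightarrow>
     (\<exists>ds. X homotopy_equivalent_space sphere_wedge ds)"


section \<open>Geometric realization of finite simplicial complexes\<close>

text \<open>
  Points are given by their barycentric coordinates.  For a finite complex, the only case needed,
  the product topology used here coincides with the weak topology.  The empty simplex contributes
  no point.
\<close>

definition geometric_realization :: "'v set set \<Rightarrow> ('v \<Rightarrow> real) topology" where
  "geometric_realization K =
     subtopology (powertop_real UNIV)
       {x. (\<forall>v. 0 \<le> x v) \<and> {v. x v \<noteq> 0} \<in> K \<and> (\<Sum>v | x v \<noteq> 0. x v) = 1}"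


section \<open>Graphs and independence complexes\<close>

text \<open>A graph is a pair of a vertex set and a set of edges, the edges being two-element sets.\<close>

type_synonym 'v graph = "'v set \<times> 'v set set"

definition simple_graph :: "'v graph \<Rightarrow> bool" where
  "simple_graph G \<longleftrightarrow> (\<forall>e \<in> snd G. e \<subseteq> fst G \<and> card e = 2)"

definition Ind :: "'v graph \<Rightarrow> 'v set set" where
  "Ind G = {S. finite S \<and> S \<subseteq> fst G \<and> (\<forall>u\<in>S. \<forall>v\<in>S. {u, v} \<notin> snd G)}"

definition graph_extend :: "'v graph \<Rightarrow> 'v set \<Rightarrow> 'v set set \<Rightarrow> 'v graph" where
  "graph_extend G V E = (fst G \<union> V, snd G \<union> E)"


section \<open>The graphs\<close>

datatype vertex = g nat nat | l nat | a nat | b nat | c nat | d nat | e nat | f nat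

definition Gamma5 :: "nat \<Rightarrow> vertex graph" where
  "Gamma5 n =
    ({g i j | i j. i \<in> {1..4} \<and> j \<in> {1..2*n+1}},
     {{g i j, g (i+1) j} | i j. i \<in> {1..3} \<and> j \<in> {1..2*n+1}} \<union>
     {{g i j, g i (j+1)} | i j. i \<in> {1..4} \<and> j \<in> {1..2*n}} \<union>
     {{g i j, g (i+1) (j+1)} | i j. i \<in> {1..3} \<and> j \<in> {1..2*n} \<and> (i + j) mod 2 = 1} \<union>
     {{g i (j+1), g (i+1) j} | i j. i \<in> {1..3} \<and> j \<in> {1..2*n} \<and> (i + j) mod 2 = 1})"

definition Lambda5 :: "nat \<Rightarrow> vertex graph" where
  "Lambda5 n = graph_extend (Gamma5 n) {l 1, l 2, l 3, l 4}
    {{l 1, l 2}, {l 2, l 3}, {l 3, l 4},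
     {g 1 1, l 1}, {g 1 1, l 2}, {g 2 1, l 1}, {g 2 1, l 2},
     {g 3 1, l 3}, {g 3 1, l 4}, {g 4 1, l 3}, {g 4 1, l 4}}"

definition A5 :: "nat \<Rightarrow> vertex graph" where
  "A5 n = graph_extend (Gamma5 n) {a 1, a 2}
    {{a 1, g 1 1}, {a 1, g 2 1}, {a 2, g 3 1}, {a 2, g 4 1}}"

definition B5 :: "nat \<Rightarrow> vertex graph" where
  "B5 n = graph_extend (Gamma5 n) {b 1, b 2, b 3, b 4, b 5, b 6}
    {{b 1, b 2}, {b 1, b 4}, {b 1, b 5}, {b 2, b 6}, {b 3, b 4}, {b 4, b 5}, {b 5, b 6},
     {b 3, g 1 1}, {b 3, g 2 1}, {b 4, g 1 1}, {b 4, g 2 1},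
     {b 5, g 3 1}, {b 5, g 4 1}, {b 6, g 3 1}, {b 6, g 4 1}}"

definition C5 :: "nat \<Rightarrow> vertex graph" where
  "C5 n = graph_extend (Gamma5 n) {c 1} {{c 1, g 3 1}, {c 1, g 4 1}}"

definition D5 :: "nat \<Rightarrow> vertex graph" where
  "D5 n = graph_extend (Gamma5 n) {d 1, d 2}
    {{d 1, d 2}, {d 1, g 1 1}, {d 1, g 2 1}, {d 2, g 3 1}, {d 2, g 4 1}}"

definition E5 :: "nat \<Rightarrow> vertex graph" where
  "E5 n = graph_extend (Gamma5 n) {e 1}
    {{e 1, g 1 1}, {e 1, g 2 1}, {e 1, g 3 1}, {e 1, g 4 1}}"

definition F5 :: "nat \<Rightarrow> vertex graph" where
  "F5 n = graph_extend (Gamma5 n) {f 1, f 2, f 3}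
    {{f 1, f 2}, {f 2, f 3}, {f 1, g 1 1}, {f 1, g 2 1},
     {f 2, g 3 1}, {f 2, g 4 1}, {f 3, g 3 1}, {f 3, g 4 1}}"

text \<open>\<open>tilde n H\<close> is the graph written with a tilde over \<open>H\<close>, for \<open>H\<close> one of the above at index \<open>n\<close>.\<close>

definition tilde :: "nat \<Rightarrow> vertex graph \<Rightarrow> vertex graph" where
  "tilde n H = graph_extend H {g i (2*n+2) | i. i \<in> {1..4}}
    ({{g i (2*n+1), g i (2*n+2)} | i. i \<in> {1..4}} \<union>
     {{g i (2*n+2), g (i+1) (2*n+2)} | i. i \<in> {1..3}} \<union>
     {{g 2 (2*n+1), g 3 (2*n+2)}, {g 3 (2*n+1), g 2 (2*n+2)}})"

lemma simple_graph_extend: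
  assumes "simple_graph G" and "\<And>x. x \<in> E \<Longrightarrow> x \<subseteq> fst G \<union> V \<and> card x = 2"
  shows "simple_graph (graph_extend G V E)"
  using assms by (auto simp: simple_graph_def graph_extend_def)

lemma simple_graph_Gamma5: "simple_graph (Gamma5 n)"
  unfolding simple_graph_def Gamma5_def by (auto simp: card_insert_if)

lemma simple_graph_tilde:
  assumes "simple_graph H" "fst (Gamma5 n) \<subseteq> fst H"
  shows "simple_graph (tilde n H)"
  unfolding tilde_def
proof (rule simple_graph_extend[OF assms(1)])
  have g: "g i (2*n+1) \<in> fst H" if "i \<in> {1..4}" for i
    using assms(2) that unfolding Gamma5_def by force
  show "x \<subseteq> fst H \<union> {g i (2*n+2) | i. i \<in> {1..4}} \<and> card x = 2"
    if "x \<in> {{g i (2*n+1), g i (2*n+2)} | i. i \<in> {1..4}} \<union>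
     {{g i (2*n+2), g (i+1) (2*n+2)} | i. i \<in> {1..3}} \<union>
     {{g 2 (2*n+1), g 3 (2*n+2)}, {g 3 (2*n+1), g 2 (2*n+2)}}" for x
    using that g g[of 2] g[of 3] by (auto simp: card_insert_if)
qed

lemma simple_graphs:
  assumes "H \<in> {Gamma5 n, Lambda5 n, A5 n, B5 n, C5 n, D5 n, E5 n, F5 n}"
  shows "simple_graph H" and "simple_graph (tilde n H)"
proof -
  have g: "g i (Suc 0) \<in> fst (Gamma5 n)" if "i \<in> {1..4}" for i
    using that unfolding Gamma5_def by auto
  have g': "g (Suc 0) (Suc 0) \<in> fst (Gamma5 n)" "g 2 (Suc 0) \<in> fst (Gamma5 n)"
    "g 3 (Suc 0) \<in> fst (Gamma5 n)" "g 4 (Suc 0) \<in> fst (Gamma5 n)"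
    using g by auto
  have L: "simple_graph (graph_extend (Gamma5 n) V E)"
    if "\<forall>x\<in>E. x \<subseteq> fst (Gamma5 n) \<union> V \<and> card x = 2" for V E
    using simple_graph_extend[OF simple_graph_Gamma5] that by blast
  have "simple_graph (Lambda5 n)" unfolding Lambda5_def by (rule L) (simp add: g')
  moreover have "simple_graph (A5 n)" unfolding A5_def by (rule L) (simp add: g')
  moreover have "simple_graph (B5 n)" unfolding B5_def by (rule L) (simp add: g')
  moreover have "simple_graph (C5 n)" unfolding C5_def by (rule L) (simp add: g')
  moreover have "simple_graph (D5 n)" unfolding D5_def by (rule L) (simp add: g')
  moreover have "simple_graph (E5 n)" unfolding E5_def by (rule L) (simp add: g')
  moreover have "simple_graph (F5 n)" unfolding F5_def by (rule L) (simp add: g')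
  ultimately show H: "simple_graph H"
    using assms simple_graph_Gamma5[of n] by blast
  have "fst (Gamma5 n) \<subseteq> fst (graph_extend (Gamma5 n) V E)" for V E
    by (simp add: graph_extend_def)
  then have "fst (Gamma5 n) \<subseteq> fst H"
    using assms
    unfolding Lambda5_def A5_def B5_def C5_def D5_def E5_def F5_def by blast
  with H show "simple_graph (tilde n H)"
    by (rule simple_graph_tilde)
qed

hide_const (open) g l a b c d e f

end

theory Submission
  imports Defs
begin

text \<open>Every graph of the theorem consists of a small gadget glued to the left end of a strip with an
  even number of columns. Moving the first two columns of the strip into the gadget gives a
  larger gadget on a shorter strip. Elementary moves on the gadget then reduce it to one of
  twelve gadgets, up to wedge sums and suspensions, so that induction on the length of the strip
  proves the theorem for all twelve gadgets at once; eight of them are those of the theorem. The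
  moves are: if the neighbours of \<open>u\<close> are neighbours of \<open>v\<close>, delete
  \<open>v\<close>; a vertex without neighbours makes the complex contractible; an isolated edge
  is a suspension; if the inclusion of the link of \<open>v\<close> into the complex without
  \<open>v\<close> is null-homotopic, the complex is the wedge of the latter and the suspended
  link; and an edge \<open>uv\<close> may be added or removed if the common non-neighbours of
  \<open>u\<close> and \<open>v\<close> span a contractible complex.\<close>

section \<open>Pointed homotopy equivalences and wedges of spheres\<close>

text \<open>Column 2n+2 of the tilde graphs continues the diagonal pattern: for j = 2n+1 the parity
  condition leaves only the crossing of rows 2 and 3. So the strips have 2(n+1) columns, and since
  the pattern has period two, removing two columns leaves a strip of the same kind. A gadget vertex
  meets at most the first remaining column; hence one finite reduction serves every length, and the
  reductions can be stored as data and verified by evaluation. The obstacle is the bookkeeping of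
  wedges and suspensions through long reductions. Suspension is expressed within graphs, by adding
  disjoint edges, so that every space met is again an independence complex, and each rule is proved
  for all numbers of added edges at once. Equivalences and their homotopies fix base points, because
  wedges are formed there; path connectedness lets a null-homotopy end at the chosen base point.
  Links enter only suspended, so they may be empty or disconnected. The complexes themselves can be
  so only for an empty strip, whereas the graphs of the theorem have at least two columns.\<close>

definition pointed_equiv :: "'a topology \<Rightarrow> 'a \<Rightarrow> 'b topology \<Rightarrow> 'b \<Rightarrow> bool" where
  "pointed_equiv X x Y y \<longleftrightarrow> x \<in> topspace X \<and> y \<in> topspace Y \<and>
     (\<exists>f g. continuous_map X Y f \<and> continuous_map Y X g \<and> f x = y \<and> g y = x \<and>
        homotopic_with (\<lambda>h. h x = x) X X (g \<circ> f) id \<and>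
        homotopic_with (\<lambda>h. h y = y) Y Y (f \<circ> g) id)"

lemma pointed_equiv_sym: "pointed_equiv X x Y y \<Longrightarrow> pointed_equiv Y y X x"
  unfolding pointed_equiv_def by blast

lemma pointed_equiv_refl: "x \<in> topspace X \<Longrightarrow> pointed_equiv X x X x"
  unfolding pointed_equiv_def by (intro conjI exI[of _ id]) auto

lemma pointed_equiv_trans:
  assumes "pointed_equiv X x Y y" "pointed_equiv Y y Z z"
  shows "pointed_equiv X x Z z"
proof -
  obtain f g where f: "continuous_map X Y f" "continuous_map Y X g" "f x = y" "g y = x"
      "homotopic_with (\<lambda>h. h x = x) X X (g \<circ> f) id"
      "homotopic_with (\<lambda>h. h y = y) Y Y (f \<circ> g) id"
    using assms(1) unfolding pointed_equiv_def by blast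
  obtain f' g' where f': "continuous_map Y Z f'" "continuous_map Z Y g'" "f' y = z" "g' z = y"
      "homotopic_with (\<lambda>h. h y = y) Y Y (g' \<circ> f') id"
      "homotopic_with (\<lambda>h. h z = z) Z Z (f' \<circ> g') id"
    using assms(2) unfolding pointed_equiv_def by blast
  have "homotopic_with (\<lambda>h. h x = y) X Y ((g' \<circ> f') \<circ> f) (id \<circ> f)"
    by (rule homotopic_with_compose_continuous_map_right[OF f'(5) f(1)]) (simp add: f(3))
  then have "homotopic_with (\<lambda>h. h x = x) X X (g \<circ> ((g' \<circ> f') \<circ> f)) (g \<circ> (id \<circ> f))"
    by (rule homotopic_with_compose_continuous_map_left[OF _ f(2)]) (simp add: f(4))
  then have 1: "homotopic_with (\<lambda>h. h x = x) X X ((g \<circ> g') \<circ> (f' \<circ> f)) id"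
    using homotopic_with_trans[OF _ f(5)] by (simp add: comp_assoc)
  have "homotopic_with (\<lambda>h. h z = y) Z Y ((f \<circ> g) \<circ> g') (id \<circ> g')"
    by (rule homotopic_with_compose_continuous_map_right[OF f(6) f'(2)]) (simp add: f'(4))
  then have "homotopic_with (\<lambda>h. h z = z) Z Z (f' \<circ> ((f \<circ> g) \<circ> g')) (f' \<circ> (id \<circ> g'))"
    by (rule homotopic_with_compose_continuous_map_left[OF _ f'(1)]) (simp add: f'(3))
  then have 2: "homotopic_with (\<lambda>h. h z = z) Z Z ((f' \<circ> f) \<circ> (g \<circ> g')) id"
    using homotopic_with_trans[OF _ f'(6)] by (simp add: comp_assoc)
  show ?thesis
    unfolding pointed_equiv_def
    using assms 1 2 f f' continuous_map_compose[OF f(1) f'(1)] continuous_map_compose[OF f'(2) f(2)]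
    by (auto simp: pointed_equiv_def intro!: exI[of _ "f' \<circ> f"] exI[of _ "g \<circ> g'"])
qed

lemma pointed_equiv_homeomorphic:
  assumes "homeomorphic_maps X Y f g" "x \<in> topspace X" "f x = y"
  shows "pointed_equiv X x Y y"
proof -
  have c: "continuous_map X Y f" "continuous_map Y X g"
    and i: "\<And>u. u \<in> topspace X \<Longrightarrow> g (f u) = u" "\<And>v. v \<in> topspace Y \<Longrightarrow> f (g v) = v"
    using assms(1) by (auto simp: homeomorphic_maps_def)
  have y: "y \<in> topspace Y" using c(1) assms(2,3) by (auto simp: continuous_map_def)
  have "homotopic_with (\<lambda>h. h x = x) X X (g \<circ> f) id"
    by (rule homotopic_with_equal) (use c i assms in \<open>auto intro: continuous_map_compose\<close>)
  moreover have "homotopic_with (\<lambda>h. h y = y) Y Y (f \<circ> g) id"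
    by (rule homotopic_with_equal) (use c i assms y in \<open>auto intro: continuous_map_compose\<close>)
  ultimately show ?thesis
    unfolding pointed_equiv_def using c i assms y by metis
qed

lemma pointed_equiv_imp_homotopy_equivalent:
  assumes "pointed_equiv X x Y y"
  shows "X homotopy_equivalent_space Y"
proof -
  obtain f g where f: "continuous_map X Y f" "continuous_map Y X g"
      "homotopic_with (\<lambda>h. h x = x) X X (g \<circ> f) id"
      "homotopic_with (\<lambda>h. h y = y) Y Y (f \<circ> g) id"
    using assms unfolding pointed_equiv_def by blast
  show ?thesis
    unfolding homotopy_equivalent_space_def
    using f homotopic_with_mono[OF f(3), of "\<lambda>_. True"] homotopic_with_mono[OF f(4), of "\<lambda>_. True"]
    by blast
qed

text \<open>Taken inside the product, the binary wedge lets maps and homotopies be built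
  coordinatewise. It is identified with the quotient form in
  \<open>pointed_equiv_sphere_wedge_append\<close>.\<close>

definition pointed_wedge :: "'a topology \<Rightarrow> 'a \<Rightarrow> 'b topology \<Rightarrow> 'b \<Rightarrow> ('a \<times> 'b) topology" where
  "pointed_wedge X x Y y = subtopology (prod_topology X Y) {(u, v). u = x \<or> v = y}"

lemma topspace_pointed_wedge:
  "topspace (pointed_wedge X x Y y) = {(u, v). u \<in> topspace X \<and> v \<in> topspace Y \<and> (u = x \<or> v = y)}"
  by (auto simp: pointed_wedge_def)

text \<open>Both homotopies run at once, one in each coordinate. They stay in the wedge because each
  fixes its own base point at every time.\<close>

lemma pointed_wedge_homotopy:
  assumes f: "homotopic_with (\<lambda>h. h x = x) X X f id" and g: "homotopic_with (\<lambda>h. h y = y) Y Y g id"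
  shows "homotopic_with (\<lambda>h. h (x, y) = (x, y)) (pointed_wedge X x Y y) (pointed_wedge X x Y y)
           (\<lambda>(u, v). (f u, g v)) id"
proof -
  let ?I = "top_of_set {0..1::real}"
  obtain h where h: "continuous_map (prod_topology ?I X) X h" "\<And>u. h (0, u) = f u" "\<And>u. h (1, u) = u"
      "\<And>t. t \<in> {0..1} \<Longrightarrow> h (t, x) = x"
    using f by (auto simp: homotopic_with_def)
  obtain k where k: "continuous_map (prod_topology ?I Y) Y k" "\<And>u. k (0, u) = g u" "\<And>u. k (1, u) = u"
      "\<And>t. t \<in> {0..1} \<Longrightarrow> k (t, y) = y"
    using g by (auto simp: homotopic_with_def)
  let ?W = "pointed_wedge X x Y y"
  define H where "H = (\<lambda>(t, u, v). (h (t, u), k (t, v)))"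
  have pr: "continuous_map ?W X fst" "continuous_map ?W Y snd"
    by (simp_all add: pointed_wedge_def continuous_map_from_subtopology continuous_map_fst continuous_map_snd)
  have fst: "continuous_map (prod_topology ?I ?W) (prod_topology ?I X) (\<lambda>z. (fst z, fst (snd z)))"
    by (intro continuous_map_pairedI continuous_map_fst
        continuous_map_compose[OF continuous_map_snd pr(1), unfolded o_def])
  have snd: "continuous_map (prod_topology ?I ?W) (prod_topology ?I Y) (\<lambda>z. (fst z, snd (snd z)))"
    by (intro continuous_map_pairedI continuous_map_fst
        continuous_map_compose[OF continuous_map_snd pr(2), unfolded o_def])
  have "continuous_map (prod_topology ?I ?W) (prod_topology X Y) H"
    unfolding H_def case_prod_unfold
    using continuous_map_compose[OF fst h(1)] continuous_map_compose[OF snd k(1)]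
    by (auto intro: continuous_map_pairedI simp: o_def)
  then have c: "continuous_map (prod_topology ?I ?W) ?W H"
    unfolding pointed_wedge_def[of X x Y y]
    apply (subst continuous_map_in_subtopology)
    using h(4) k(4) by (auto simp: H_def pointed_wedge_def Pi_iff)
  show ?thesis
    unfolding homotopic_with_def
    using c h k by (intro exI[of _ H]) (auto simp: H_def)
qed

lemma pointed_equiv_wedge:
  assumes "pointed_equiv X x X' x'" "pointed_equiv Y y Y' y'"
  shows "pointed_equiv (pointed_wedge X x Y y) (x, y) (pointed_wedge X' x' Y' y') (x', y')"
proof -
  obtain f g where f: "continuous_map X X' f" "continuous_map X' X g" "f x = x'" "g x' = x"
      "homotopic_with (\<lambda>h. h x = x) X X (g \<circ> f) id"
      "homotopic_with (\<lambda>h. h x' = x') X' X' (f \<circ> g) id"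
    using assms(1) unfolding pointed_equiv_def by blast
  obtain p q where p: "continuous_map Y Y' p" "continuous_map Y' Y q" "p y = y'" "q y' = y"
      "homotopic_with (\<lambda>h. h y = y) Y Y (q \<circ> p) id"
      "homotopic_with (\<lambda>h. h y' = y') Y' Y' (p \<circ> q) id"
    using assms(2) unfolding pointed_equiv_def by blast
  have cont: "continuous_map (pointed_wedge U u V v) (pointed_wedge U' u' V' v') (\<lambda>(a, b). (m a, n b))"
    if "continuous_map U U' m" "continuous_map V V' n" "m u = u'" "n v = v'"
    for U :: "'e topology" and U' :: "'f topology" and V :: "'g topology" and V' :: "'h topology"
      and u u' v v' m n
  proof -
    have "continuous_map (prod_topology U V) (prod_topology U' V') (\<lambda>(a, b). (m a, n b))"
      using that by (auto simp: case_prod_unfold continuous_map_pairwise o_def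
          intro: continuous_map_compose[OF continuous_map_fst, unfolded o_def] continuous_map_compose[OF continuous_map_snd, unfolded o_def])
    then show ?thesis
      using that unfolding pointed_wedge_def
      by (auto simp: continuous_map_in_subtopology intro: continuous_map_from_subtopology)
  qed
  show ?thesis
    unfolding pointed_equiv_def
  proof (intro conjI exI)
    show "continuous_map (pointed_wedge X x Y y) (pointed_wedge X' x' Y' y') (\<lambda>(a, b). (f a, p b))"
      by (rule cont) (use f p in auto)
    show "continuous_map (pointed_wedge X' x' Y' y') (pointed_wedge X x Y y) (\<lambda>(a, b). (g a, q b))"
      by (rule cont) (use f p in auto)
    show "homotopic_with (\<lambda>h. h (x, y) = (x, y)) (pointed_wedge X x Y y) (pointed_wedge X x Y y)
            ((\<lambda>(a, b). (g a, q b)) \<circ> (\<lambda>(a, b). (f a, p b))) id"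
      using pointed_wedge_homotopy[OF f(5) p(5)] by (simp add: o_def case_prod_unfold)
    show "homotopic_with (\<lambda>h. h (x', y') = (x', y')) (pointed_wedge X' x' Y' y') (pointed_wedge X' x' Y' y')
            ((\<lambda>(a, b). (f a, p b)) \<circ> (\<lambda>(a, b). (g a, q b))) id"
      using pointed_wedge_homotopy[OF f(6) p(6)] by (simp add: o_def case_prod_unfold)
  qed (use assms f p in \<open>auto simp: topspace_pointed_wedge pointed_equiv_def\<close>)
qed

section \<open>Attaching a cone\<close>

abbreviation unit_interval :: "real topology" where
  "unit_interval \<equiv> top_of_set {0..1}"

text \<open>\<open>X\<close> is \<open>A\<close> with a cone over \<open>L\<close> glued on along
  \<open>f\<close>: \<open>j\<close> embeds \<open>A\<close>, and \<open>q\<close> parametrises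
  the cone, with base at \<open>0\<close> and apex at \<open>1\<close>.\<close>

definition cone_attachment ::
    "'x topology \<Rightarrow> 'a topology \<Rightarrow> 'l topology \<Rightarrow> ('l \<Rightarrow> 'a) \<Rightarrow> ('a \<Rightarrow> 'x) \<Rightarrow> (real \<times> 'l \<Rightarrow> 'x) \<Rightarrow> bool" where
  "cone_attachment X A L f j q \<longleftrightarrow>
     compact_space A \<and> compact_space L \<and> Hausdorff_space X \<and>
     continuous_map L A f \<and> continuous_map A X j \<and> continuous_map (prod_topology unit_interval L) X q \<and>
     topspace X = j ` topspace A \<union> q ` ({0..1} \<times> topspace L) \<and> inj_on j (topspace A) \<and>
     (\<forall>y\<in>topspace L. q (0, y) = j (f y)) \<and>
     (\<forall>y\<in>topspace L. \<forall>y'\<in>topspace L. q (1, y) = q (1, y')) \<and>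
     (\<forall>t\<in>{0<..1}. \<forall>y\<in>topspace L. q (t, y) \<notin> j ` topspace A) \<and>
     (\<forall>t\<in>{0<..<1}. \<forall>t'\<in>{0<..1}. \<forall>y\<in>topspace L. \<forall>y'\<in>topspace L.
        q (t, y) = q (t', y') \<longrightarrow> t = t' \<and> y = y')"

lemma cone_attachmentD:
  assumes "cone_attachment X A L f j q" "y \<in> topspace L"
  shows "q (0, y) = j (f y)" and "y' \<in> topspace L \<Longrightarrow> q (1, y) = q (1, y')"
  using assms unfolding cone_attachment_def by blast+

text \<open>The universal property of the attachment, with a compact Hausdorff parameter
  \<open>T\<close> so that homotopies can be defined by it. The maps from the two pieces go from
  compact to Hausdorff spaces and are closed; hence preimages of closed sets are unions of two
  closed images.\<close>

lemma cone_attachment_lift_param: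
  fixes T :: "'t topology"
  assumes X: "cone_attachment X A L f j q" and T: "compact_space T" "Hausdorff_space T"
    and \<alpha>: "continuous_map (prod_topology T A) Z \<alpha>"
    and \<beta>: "continuous_map (prod_topology T (prod_topology unit_interval L)) Z \<beta>"
    and b0: "\<And>s y. s \<in> topspace T \<Longrightarrow> y \<in> topspace L \<Longrightarrow> \<beta> (s, 0, y) = \<alpha> (s, f y)"
    and b1: "\<And>s y y'. s \<in> topspace T \<Longrightarrow> y \<in> topspace L \<Longrightarrow> y' \<in> topspace L \<Longrightarrow> \<beta> (s, 1, y) = \<beta> (s, 1, y')"
  obtains h where "continuous_map (prod_topology T X) Z h"
    "\<And>s a. s \<in> topspace T \<Longrightarrow> a \<in> topspace A \<Longrightarrow> h (s, j a) = \<alpha> (s, a)"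
    "\<And>s t y. s \<in> topspace T \<Longrightarrow> t \<in> {0..1} \<Longrightarrow> y \<in> topspace L \<Longrightarrow> h (s, q (t, y)) = \<beta> (s, t, y)"
proof -
  note X' = X[unfolded cone_attachment_def]
  have jL: "continuous_map A X j" and qL: "continuous_map (prod_topology unit_interval L) X q"
    and fL: "continuous_map L A f" and injj: "inj_on j (topspace A)"
    and top: "topspace X = j ` topspace A \<union> q ` ({0..1} \<times> topspace L)"
    and cA: "compact_space A" and cL: "compact_space L" and hX: "Hausdorff_space X"
    using X' by auto
  have q0: "q (0, y) = j (f y)" if "y \<in> topspace L" for y using X' that by blast
  have q1: "q (1, y) = q (1, y')" if "y \<in> topspace L" "y' \<in> topspace L" for y y' using X' that by blast
  have qj: "q (t, y) \<notin> j ` topspace A" if "0 < t" "t \<le> 1" "y \<in> topspace L" for t y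
    using X' that by (meson greaterThanAtMost_iff)
  have qq: "t = t' \<and> y = y'" if "q (t, y) = q (t', y')" "0 < t" "t < 1" "0 < t'" "t' \<le> 1"
      "y \<in> topspace L" "y' \<in> topspace L" for t t' y y'
    using X' that by (meson greaterThanAtMost_iff greaterThanLessThan_iff)
  define h where "h = (\<lambda>(s, x). if x \<in> j ` topspace A then \<alpha> (s, inv_into (topspace A) j x)
                       else \<beta> (s, inv_into ({0..1} \<times> topspace L) q x))"
  have hj: "h (s, j a) = \<alpha> (s, a)" if "a \<in> topspace A" for s a
    using that injj by (auto simp: h_def)
  \<comment> \<open>The preimage chosen by \<open>inv_into\<close> can differ from
    \<open>(t, y)\<close> only at the apex, where \<open>\<beta>\<close> does not depend on
    \<open>y\<close>; for \<open>t = 0\<close> the point lies in the image of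
    \<open>j\<close>.\<close>
  have hq: "h (s, q (t, y)) = \<beta> (s, t, y)"
    if s: "s \<in> topspace T" and t: "t \<in> {0..1}" and y: "y \<in> topspace L" for s t y
  proof (cases "t = 0")
    case True
    have "f y \<in> topspace A" using fL y by (auto simp: continuous_map_def)
    then show ?thesis using hj q0 b0 s y True by simp
  next
    case False
    then have t: "0 < t" "t \<le> 1" using t by auto
    define w where "w = inv_into ({0..1} \<times> topspace L) q (q (t, y))"
    have w: "w \<in> {0..1} \<times> topspace L" "q w = q (t, y)"
      unfolding w_def by (rule inv_into_into f_inv_into_f; use t y in force)+
    obtain t' y' where w': "w = (t', y')" "t' \<in> {0..1}" "y' \<in> topspace L" using w by auto
    have "t' \<noteq> 0"
    proof
      assume "t' = 0"
      then have "q (t, y) = j (f y')" using w w' q0 by simp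
      moreover have "f y' \<in> topspace A" using fL w' by (auto simp: continuous_map_def)
      ultimately show False using qj[OF t y] by blast
    qed
    then have t': "0 < t'" "t' \<le> 1" using w' by auto
    have "\<beta> (s, w) = \<beta> (s, t, y)"
    proof (cases "t = 1")
      case True
      have "t' = 1"
      proof (rule ccontr)
        assume "t' \<noteq> 1"
        then have "t' < 1" using t' by simp
        moreover have "q (t', y') = q (t, y)" using w w' by simp
        ultimately show False using qq[of t' y' t y] t' t y w'(3) True by simp
      qed
      then show ?thesis using b1[OF s w'(3) y] w' True by simp
    next
      case False
      then have "t < 1" using t by simp
      moreover have "q (t, y) = q (t', y')" using w w' by simp
      ultimately show ?thesis using qq[of t y t' y'] t' t y w' by simp
    qed
    then show ?thesis using qj[OF t y] by (simp add: h_def w_def)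
  qed
  have cov: "(\<exists>a\<in>topspace A. x = j a) \<or> (\<exists>t\<in>{0..1}. \<exists>y\<in>topspace L. x = q (t, y))" if "x \<in> topspace X" for x
    using that top by auto
  have memZ: "h (s, x) \<in> topspace Z" if s: "s \<in> topspace T" and x: "x \<in> topspace X" for s x
  proof -
    consider a where "a \<in> topspace A" "x = j a" | t y where "t \<in> {0..1}" "y \<in> topspace L" "x = q (t, y)"
      using cov[OF x] by blast
    then show ?thesis
    proof cases
      case 1 then show ?thesis using hj s \<alpha> by (auto simp: continuous_map_def Pi_iff)
    next
      case 2 then show ?thesis using hq s \<beta> by (auto simp: continuous_map_def Pi_iff)
    qed
  qed
  have cont: "continuous_map (prod_topology T X) Z h"
    unfolding continuous_map_closedin
  proof (intro conjI allI impI ballI)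
    show "h \<in> topspace (prod_topology T X) \<rightarrow> topspace Z" using memZ by auto
    fix C assume C: "closedin Z C"
    let ?J = "\<lambda>z. (fst z, j (snd z))" and ?Q = "\<lambda>z. (fst z, q (snd z))"
    have cm: "closed_map (prod_topology T A) (prod_topology T X) ?J"
      by (rule continuous_imp_closed_map)
        (auto simp: compact_space_prod_topology Hausdorff_space_prod_topology T cA hX
          intro!: continuous_map_pairedI continuous_map_fst continuous_map_compose[OF continuous_map_snd jL, unfolded o_def])
    have cI: "compact_space unit_interval" by (simp add: compact_space_subtopology)
    have cq: "closed_map (prod_topology T (prod_topology unit_interval L)) (prod_topology T X) ?Q"
      by (rule continuous_imp_closed_map)
        (auto simp: compact_space_prod_topology Hausdorff_space_prod_topology T cL hX cI
          intro!: continuous_map_pairedI continuous_map_fst continuous_map_compose[OF continuous_map_snd qL, unfolded o_def])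
    have eq: "{p \<in> topspace (prod_topology T X). h p \<in> C} =
        ?J ` {z \<in> topspace (prod_topology T A). \<alpha> z \<in> C} \<union>
        ?Q ` {z \<in> topspace (prod_topology T (prod_topology unit_interval L)). \<beta> z \<in> C}" (is "?l = ?r")
    proof
      show "?r \<subseteq> ?l"
        using hj hq top by (auto simp: image_iff)
      show "?l \<subseteq> ?r"
      proof
        fix p assume p: "p \<in> ?l"
        obtain s x where p': "p = (s, x)" "s \<in> topspace T" "x \<in> topspace X" "h (s, x) \<in> C"
          using p by auto
        consider a where "a \<in> topspace A" "x = j a" | t y where "t \<in> {0..1}" "y \<in> topspace L" "x = q (t, y)"
          using cov[OF p'(3)] by blast
        then show "p \<in> ?r"
        proof cases
          case 1
          then have "p = ?J (s, a)" "(s, a) \<in> {z \<in> topspace (prod_topology T A). \<alpha> z \<in> C}"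
            using p' hj by auto
          then show ?thesis by blast
        next
          case 2
          then have "p = ?Q (s, t, y)"
            "(s, t, y) \<in> {z \<in> topspace (prod_topology T (prod_topology unit_interval L)). \<beta> z \<in> C}"
            using p' hq by auto
          then show ?thesis by blast
        qed
      qed
    qed
    show "closedin (prod_topology T X) {p \<in> topspace (prod_topology T X). h p \<in> C}"
      unfolding eq
      using cm cq \<alpha> \<beta> C unfolding closed_map_def continuous_map_closedin by (meson closedin_Un)
  qed
  show thesis using that cont hj hq by blast
qed

text \<open>The data are spread as constant families over the interval, and the resulting map is
  restricted to time 0.\<close>

lemma cone_attachment_lift:
  assumes X: "cone_attachment X A L f j q"
    and \<alpha>: "continuous_map A Z \<alpha>"
    and \<beta>: "continuous_map (prod_topology unit_interval L) Z \<beta>"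
    and b0: "\<And>y. y \<in> topspace L \<Longrightarrow> \<beta> (0, y) = \<alpha> (f y)"
    and b1: "\<And>y y'. y \<in> topspace L \<Longrightarrow> y' \<in> topspace L \<Longrightarrow> \<beta> (1, y) = \<beta> (1, y')"
  obtains h where "continuous_map X Z h"
    "\<And>a. a \<in> topspace A \<Longrightarrow> h (j a) = \<alpha> a"
    "\<And>t y. t \<in> {0..1} \<Longrightarrow> y \<in> topspace L \<Longrightarrow> h (q (t, y)) = \<beta> (t, y)"
proof -
  have T: "compact_space unit_interval" "Hausdorff_space unit_interval"
    by (simp_all add: compact_space_subtopology Hausdorff_space_subtopology)
  have 0: "0 \<in> topspace unit_interval" by simp
  obtain h where h: "continuous_map (prod_topology unit_interval X) Z h"
    "\<And>s a. s \<in> topspace unit_interval \<Longrightarrow> a \<in> topspace A \<Longrightarrow> h (s, j a) = (\<alpha> \<circ> snd) (s, a)"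
    "\<And>s t y. s \<in> topspace unit_interval \<Longrightarrow> t \<in> {0..1} \<Longrightarrow> y \<in> topspace L \<Longrightarrow> h (s, q (t, y)) = (\<beta> \<circ> snd) (s, t, y)"
  proof (rule cone_attachment_lift_param[OF X T, of Z "\<alpha> \<circ> snd" "\<beta> \<circ> snd"])
    show "(\<beta> \<circ> snd) (s, 1, y) = (\<beta> \<circ> snd) (s, 1, y')"
      if "y \<in> topspace L" "y' \<in> topspace L" for s :: real and y y'
      using b1[OF that] by simp
  qed (auto intro: continuous_map_compose[OF continuous_map_snd] \<alpha> \<beta> b0)
  show thesis
    by (rule that[of "h \<circ> Pair 0"]) (use continuous_map_o_Pair[OF h(1) 0] h(2,3)[OF 0] in auto)
qed

text \<open>The cone coordinate is extended by a collar parametrised by \<open>[-1, 0]\<close>, along which the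
  homotopy runs.\<close>

lemma continuous_map_collar:
  assumes X: "cone_attachment X A L f j q"
    and N: "continuous_map (prod_topology unit_interval L) A N" "\<And>y. y \<in> topspace L \<Longrightarrow> N (0, y) = f y"
  shows "continuous_map (prod_topology (top_of_set {-1..1}) L) X
           (\<lambda>z. if fst z \<le> 0 then j (N (- fst z, snd z)) else q z)"
proof -
  let ?P = "prod_topology (top_of_set {-1..1::real}) L"
  note X' = X[unfolded cone_attachment_def]
  have jL: "continuous_map A X j" and qL: "continuous_map (prod_topology unit_interval L) X q"
    using X' by auto
  have fst: "continuous_map (subtopology ?P S) euclideanreal fst" for S
    by (metis continuous_map_fst continuous_map_from_subtopology continuous_map_in_subtopology)
  have snd: "continuous_map (subtopology ?P S) L snd" for S
    by (simp add: continuous_map_snd continuous_map_from_subtopology)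
  show ?thesis
  proof (rule continuous_map_cases_le)
    show "continuous_map ?P euclideanreal fst" using fst[of UNIV] by simp
    show "continuous_map ?P euclideanreal (\<lambda>_. 0)" by simp
    have "continuous_map (subtopology ?P {z \<in> topspace ?P. fst z \<le> 0}) (prod_topology unit_interval L) (\<lambda>z. (- fst z, snd z))"
      by (intro continuous_map_pairedI snd)
        (auto simp: continuous_map_in_subtopology intro!: continuous_map_minus fst)
    from continuous_map_compose[OF continuous_map_compose[OF this N(1)] jL]
    show "continuous_map (subtopology ?P {z \<in> topspace ?P. fst z \<le> 0}) X (\<lambda>z. j (N (- fst z, snd z)))"
      by (simp add: o_def)
    have "continuous_map (subtopology ?P {z \<in> topspace ?P. 0 \<le> fst z}) (prod_topology unit_interval L) (\<lambda>z. (fst z, snd z))"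
      by (intro continuous_map_pairedI snd)
        (auto simp: continuous_map_in_subtopology intro!: fst)
    from continuous_map_compose[OF this qL]
    show "continuous_map (subtopology ?P {z \<in> topspace ?P. 0 \<le> fst z}) X q"
      by (simp add: o_def)
    show "j (N (- fst x, snd x)) = q x" if "x \<in> topspace ?P" "fst x = 0" for x
      using that N(2) cone_attachmentD(1)[OF X] by (cases x) auto
  qed
qed

text \<open>The lower half of the cone runs along the homotopy from \<open>f\<close> to
  \<open>f'\<close>, the upper half covers the cone of \<open>X'\<close> at double speed.\<close>

lemma cone_attachment_shift:
  assumes X: "cone_attachment X A L f j q" and X': "cone_attachment X' A L f' j' q'"
    and N: "continuous_map (prod_topology unit_interval L) A N"
    and N0: "\<And>y. y \<in> topspace L \<Longrightarrow> N (0, y) = f y" and N1: "\<And>y. y \<in> topspace L \<Longrightarrow> N (1, y) = f' y"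
  obtains \<Phi> where "continuous_map X X' \<Phi>" "\<And>a. a \<in> topspace A \<Longrightarrow> \<Phi> (j a) = j' a"
    "\<And>t y. t \<in> {0..1} \<Longrightarrow> y \<in> topspace L \<Longrightarrow>
       \<Phi> (q (t, y)) = (if 2 * t \<le> 1 then j' (N (2 * t, y)) else q' (2 * t - 1, y))"
proof -
  let ?P = "prod_topology unit_interval L"
  \<comment> \<open>Reversed, because the collar starts at the base of the cone of
    \<open>X'\<close>, where the attaching map is \<open>f'\<close>, and leads away from it to
    \<open>f\<close>.\<close>
  define M where "M = (\<lambda>z. N (1 - fst z, snd z))"
  have "continuous_map ?P ?P (\<lambda>z. (1 - fst z, snd z))"
    by (intro continuous_map_pairedI continuous_map_snd)
      (auto simp: continuous_map_in_subtopology
        intro!: continuous_map_diff continuous_map_into_fulltopology[OF continuous_map_fst])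
  then have M: "continuous_map ?P A M"
    using continuous_map_compose[OF _ N] by (auto simp: M_def o_def)
  let ?E = "\<lambda>z. if fst z \<le> 0 then j' (M (- fst z, snd z)) else q' z"
  have E: "continuous_map (prod_topology (top_of_set {-1..1}) L) X' ?E"
    by (rule continuous_map_collar[OF X' M]) (simp add: M_def N1)
  have "continuous_map ?P (prod_topology (top_of_set {-1..1}) L) (\<lambda>z. (2 * fst z - 1, snd z))"
    by (intro continuous_map_pairedI continuous_map_snd)
      (auto simp: continuous_map_in_subtopology
        intro!: continuous_map_diff continuous_map_real_mult continuous_map_into_fulltopology[OF continuous_map_fst])
  from continuous_map_compose[OF this E]
  have \<beta>: "continuous_map ?P X' (\<lambda>z. ?E (2 * fst z - 1, snd z))" by (simp add: o_def)
  have j': "continuous_map A X' j'" using X' by (simp add: cone_attachment_def)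
  obtain \<Phi> where \<Phi>: "continuous_map X X' \<Phi>" "\<And>a. a \<in> topspace A \<Longrightarrow> \<Phi> (j a) = j' a"
    "\<And>t y. t \<in> {0..1} \<Longrightarrow> y \<in> topspace L \<Longrightarrow> \<Phi> (q (t, y)) = ?E (2 * t - 1, y)"
  proof (rule cone_attachment_lift[OF X j' \<beta>])
    show "?E (2 * fst (0, y) - 1, snd (0, y)) = j' (f y)" if "y \<in> topspace L" for y
      using that by (simp add: M_def N0)
    show "?E (2 * fst (1, y) - 1, snd (1, y)) = ?E (2 * fst (1, y') - 1, snd (1, y'))"
      if "y \<in> topspace L" "y' \<in> topspace L" for y y'
      using cone_attachmentD(2)[OF X' that] by simp
  qed auto
  show thesis
    by (rule that[OF \<Phi>(1,2)]) (auto simp: \<Phi>(3) M_def)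
qed

text \<open>The composite only reparametrises the extended cone coordinate: it runs out along the
  collar, back again, and then up the cone. A straight-line homotopy of the parameter undoes this
  while \<open>A\<close> stays fixed.\<close>

lemma cone_attachment_shift_back:
  assumes X: "cone_attachment X A L f j q" and X': "cone_attachment X' A L f' j' q'"
    and N: "continuous_map (prod_topology unit_interval L) A N"
    and N0: "\<And>y. y \<in> topspace L \<Longrightarrow> N (0, y) = f y" and N1: "\<And>y. y \<in> topspace L \<Longrightarrow> N (1, y) = f' y"
    and \<Phi>: "continuous_map X X' \<Phi>" "\<And>a. a \<in> topspace A \<Longrightarrow> \<Phi> (j a) = j' a"
      "\<And>t y. t \<in> {0..1} \<Longrightarrow> y \<in> topspace L \<Longrightarrow>
         \<Phi> (q (t, y)) = (if 2 * t \<le> 1 then j' (N (2 * t, y)) else q' (2 * t - 1, y))"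
    and \<Psi>: "continuous_map X' X \<Psi>" "\<And>a. a \<in> topspace A \<Longrightarrow> \<Psi> (j' a) = j a"
      "\<And>t y. t \<in> {0..1} \<Longrightarrow> y \<in> topspace L \<Longrightarrow>
         \<Psi> (q' (t, y)) = (if 2 * t \<le> 1 then j (N (1 - 2 * t, y)) else q (2 * t - 1, y))"
    and a: "a \<in> topspace A"
  shows "homotopic_with (\<lambda>h. h (j a) = j a) X X (\<Psi> \<circ> \<Phi>) id"
proof -
  let ?I = unit_interval
  let ?F = "\<lambda>z. if fst z \<le> 0 then j (N (- fst z, snd z)) else q z"
  \<comment> \<open>At \<open>s = 0\<close> the composite: \<open>-2t\<close> on the first half,
    \<open>4t - 3\<close> on the second, which meet at \<open>t = 1/2\<close> in the outer end -1 of
    the collar. At \<open>s = 1\<close> the identity. The ends \<open>t = 0\<close> and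
    \<open>t = 1\<close> stay at 0 and 1 throughout.\<close>
  let ?r = "\<lambda>s t::real. s * t + (1 - s) * max (- 2 * t) (4 * t - 3)"
  have F: "continuous_map (prod_topology (top_of_set {-1..1}) L) X ?F"
    by (rule continuous_map_collar[OF X N N0])
  have r: "?r s t \<in> {-1..1}" if "s \<in> {0..1}" "t \<in> {0..1}" for s t
  proof -
    have m: "max (- 2 * t) (4 * t - 3) \<in> {-1..1}" using that by auto
    have "s * t + (1 - s) * max (- 2 * t) (4 * t - 3) \<le> s * 1 + (1 - s) * 1"
      using that m by (intro add_mono mult_left_mono) auto
    moreover have "s * (-1) + (1 - s) * (-1) \<le> s * t + (1 - s) * max (- 2 * t) (4 * t - 3)"
      using that m by (intro add_mono mult_left_mono) auto
    ultimately show ?thesis by simp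
  qed
  let ?P = "prod_topology ?I (prod_topology ?I L)"
  have p1: "continuous_map ?P euclideanreal fst"
    by (rule continuous_map_into_fulltopology[OF continuous_map_fst])
  have p2: "continuous_map ?P euclideanreal (\<lambda>z. fst (snd z))"
    by (rule continuous_map_into_fulltopology[OF continuous_map_compose[OF continuous_map_snd continuous_map_fst, unfolded o_def]])
  have "continuous_map ?P (prod_topology (top_of_set {-1..1}) L) (\<lambda>z. (?r (fst z) (fst (snd z)), snd (snd z)))"
  proof (intro continuous_map_pairedI)
    show "continuous_map ?P (top_of_set {-1..1}) (\<lambda>z. ?r (fst z) (fst (snd z)))"
      unfolding continuous_map_in_subtopology
      by (intro conjI continuous_map_add continuous_map_real_mult continuous_map_diff
          continuous_map_real_max p1 p2 continuous_map_const[THEN iffD2]) (use r in auto)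
    show "continuous_map ?P L (\<lambda>z. snd (snd z))"
      by (rule continuous_map_compose[OF continuous_map_snd continuous_map_snd, unfolded o_def])
  qed
  from continuous_map_compose[OF this F]
  have \<beta>: "continuous_map ?P X (\<lambda>z. ?F (?r (fst z) (fst (snd z)), snd (snd z)))" by (simp only: o_def)
  have "continuous_map A X j" using X by (simp add: cone_attachment_def)
  then have \<alpha>: "continuous_map (prod_topology ?I A) X (j \<circ> snd)"
    by (rule continuous_map_compose[OF continuous_map_snd])
  have T: "compact_space ?I" "Hausdorff_space ?I"
    by (simp_all add: compact_space_subtopology Hausdorff_space_subtopology)
  obtain h where h: "continuous_map (prod_topology ?I X) X h"
    "\<And>s a. s \<in> topspace ?I \<Longrightarrow> a \<in> topspace A \<Longrightarrow> h (s, j a) = (j \<circ> snd) (s, a)"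
    "\<And>s t y. s \<in> topspace ?I \<Longrightarrow> t \<in> {0..1} \<Longrightarrow> y \<in> topspace L \<Longrightarrow> h (s, q (t, y)) = ?F (?r s t, y)"
  proof (rule cone_attachment_lift_param[OF X T \<alpha> \<beta>])
    show "?F (?r (fst (s, 0::real, y)) (fst (snd (s, 0::real, y))), snd (snd (s, 0::real, y))) = (j \<circ> snd) (s, f y)"
      if "s \<in> topspace ?I" "y \<in> topspace L" for s y
      using that by (simp add: N0)
    show "?F (?r (fst (s, 1::real, y)) (fst (snd (s, 1::real, y))), snd (snd (s, 1::real, y))) =
          ?F (?r (fst (s, 1::real, y')) (fst (snd (s, 1::real, y'))), snd (snd (s, 1::real, y')))"
      if "s \<in> topspace ?I" "y \<in> topspace L" "y' \<in> topspace L" for s y y'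
      using cone_attachmentD(2)[OF X that(2,3)] by simp
  qed auto
  have top: "topspace X = j ` topspace A \<union> q ` ({0..1} \<times> topspace L)"
    using X by (simp add: cone_attachment_def)
  have ja: "j a \<in> topspace X" using a top by auto
  show ?thesis
  proof (subst homotopic_with)
    show "(h (j a) = j a) = (k (j a) = j a)" if "\<And>x. x \<in> topspace X \<Longrightarrow> h x = k x" for h k
      using that ja by auto
    show "\<exists>h. continuous_map (prod_topology ?I X) X h \<and> (\<forall>x\<in>topspace X. h (0, x) = (\<Psi> \<circ> \<Phi>) x) \<and>
          (\<forall>x\<in>topspace X. h (1, x) = id x) \<and> (\<forall>t\<in>{0..1}. h (t, j a) = j a)"
    proof (intro exI[of _ h] conjI ballI h(1))
      fix x assume "x \<in> topspace X"
      then have "(\<exists>a\<in>topspace A. x = j a) \<or> (\<exists>t\<in>{0..1}. \<exists>y\<in>topspace L. x = q (t, y))"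
        using top by auto
      then consider a where "a \<in> topspace A" "x = j a" | t y where "t \<in> {0..1}" "y \<in> topspace L" "x = q (t, y)"
        by blast
      note cases = this
      show "h (0, x) = (\<Psi> \<circ> \<Phi>) x"
        using cases
      proof cases
        case 1 then show ?thesis by (simp add: h(2) \<Phi>(2) \<Psi>(2))
      next
        case 2
        show ?thesis
        proof (cases "2 * t \<le> 1")
          case True
          have "N (2 * t, y) \<in> topspace A" using N 2 True by (auto simp: continuous_map_def Pi_iff)
          moreover have "max (- 2 * t) (4 * t - 3) = - 2 * t" using True by auto
          ultimately show ?thesis using 2 True by (simp add: h(3) \<Phi>(3) \<Psi>(2))
        next
          case False
          have m: "max (- 2 * t) (4 * t - 3) = 4 * t - 3" using False 2 by auto
          show ?thesis using 2 False m by (auto simp: h(3) \<Phi>(3) \<Psi>(3) N0 algebra_simps)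
        qed
      qed
      show "h (1, x) = id x"
        using cases
      proof cases
        case 1 then show ?thesis by (simp add: h(2))
      next
        case 2
        then show ?thesis using cone_attachmentD(1)[OF X, of y] N0 by (auto simp: h(3))
      qed
    next
      show "h (t, j a) = j a" if "t \<in> {0..1}" for t using that a by (simp add: h(2))
    qed
  qed
qed

text \<open>The shifts along a homotopy and along its reverse are mutually inverse up to homotopies
  that fix \<open>A\<close>. The intended use has \<open>f'\<close> constant, where the attachment
  is the wedge of \<open>A\<close> with a suspension.\<close>

theorem pointed_equiv_cone_attachment:
  assumes X: "cone_attachment X A L f j q" and X': "cone_attachment X' A L f' j' q'"
    and hom: "homotopic_with (\<lambda>_. True) L A f f'" and a: "a \<in> topspace A"
  shows "pointed_equiv X (j a) X' (j' a)"
proof -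
  let ?P = "prod_topology unit_interval L"
  obtain N where N: "continuous_map ?P A N" "\<And>y. N (0, y) = f y" "\<And>y. N (1, y) = f' y"
    using hom by (auto simp: homotopic_with_def)
  define M where "M = (\<lambda>z. N (1 - fst z, snd z))"
  have "continuous_map ?P ?P (\<lambda>z. (1 - fst z, snd z))"
    by (intro continuous_map_pairedI continuous_map_snd)
      (auto simp: continuous_map_in_subtopology
        intro!: continuous_map_diff continuous_map_into_fulltopology[OF continuous_map_fst])
  then have M: "continuous_map ?P A M"
    using continuous_map_compose[OF _ N(1)] by (auto simp: M_def o_def)
  have M': "M (0, y) = f' y" "M (1, y) = f y" for y by (simp_all add: M_def N)
  obtain \<Phi> where \<Phi>: "continuous_map X X' \<Phi>" "\<And>a. a \<in> topspace A \<Longrightarrow> \<Phi> (j a) = j' a"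
    "\<And>t y. t \<in> {0..1} \<Longrightarrow> y \<in> topspace L \<Longrightarrow>
       \<Phi> (q (t, y)) = (if 2 * t \<le> 1 then j' (N (2 * t, y)) else q' (2 * t - 1, y))"
    by (rule cone_attachment_shift[OF X X' N(1)]) (use N in auto)
  obtain \<Psi> where \<Psi>: "continuous_map X' X \<Psi>" "\<And>a. a \<in> topspace A \<Longrightarrow> \<Psi> (j' a) = j a"
    "\<And>t y. t \<in> {0..1} \<Longrightarrow> y \<in> topspace L \<Longrightarrow>
       \<Psi> (q' (t, y)) = (if 2 * t \<le> 1 then j (M (2 * t, y)) else q (2 * t - 1, y))"
    by (rule cone_attachment_shift[OF X' X M]) (use M' in auto)
  have "homotopic_with (\<lambda>h. h (j a) = j a) X X (\<Psi> \<circ> \<Phi>) id"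
    by (rule cone_attachment_shift_back[OF X X' N \<Phi> \<Psi>(1,2) _ a]) (simp_all add: \<Psi>(3) M_def)
  moreover have "homotopic_with (\<lambda>h. h (j' a) = j' a) X' X' (\<Phi> \<circ> \<Psi>) id"
    by (rule cone_attachment_shift_back[OF X' X M M' \<Psi> \<Phi>(1,2) _ a]) (simp_all add: \<Phi>(3) M_def)
  moreover have "j a \<in> topspace X" "j' a \<in> topspace X'"
    using X X' a by (auto simp: cone_attachment_def)
  ultimately show ?thesis
    unfolding pointed_equiv_def using \<Phi>(1,2) \<Psi>(1,2) a
    by (intro conjI exI[of _ \<Phi>] exI[of _ \<Psi>]) auto
qed

section \<open>Wedges of spheres as pointed spaces\<close>

lemma continuous_map_wedge_proj:
  assumes "i \<in> I"
  shows "continuous_map (X i) (wedge_topology X p I) (\<lambda>x. wedge_proj p (i, x))"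
proof -
  have "continuous_map (sum_topology X I) (wedge_topology X p I) (wedge_proj p)"
    unfolding continuous_map_def openin_wedge_topology topspace_wedge_topology wedge_carrier_def by auto
  from continuous_map_compose[OF continuous_map_component_injection[OF assms] this]
  show ?thesis by (simp add: o_def)
qed

text \<open>The quotient topology is tested on the summands; the value at \<open>None\<close> is a
  separate hypothesis because with an empty \<open>I\<close> no summand reaches it.\<close>

lemma continuous_map_from_wedge:
  assumes "\<And>i. i \<in> I \<Longrightarrow> continuous_map (X i) Z (\<lambda>x. h (wedge_proj p (i, x)))" "h None \<in> topspace Z"
  shows "continuous_map (wedge_topology X p I) Z h"
  unfolding continuous_map_def
proof (intro conjI allI impI)
  show "h \<in> topspace (wedge_topology X p I) \<rightarrow> topspace Z"
  proof
    fix w assume "w \<in> topspace (wedge_topology X p I)"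
    then consider "w = None" | i x where "i \<in> I" "x \<in> topspace (X i)" "w = wedge_proj p (i, x)"
      by (auto simp: topspace_wedge_topology wedge_carrier_def)
    then show "h w \<in> topspace Z"
      using assms by cases (auto simp: continuous_map_def)
  qed
  fix U assume U: "openin Z U"
  have eq: "{x. (i, x) \<in> {z \<in> topspace (sum_topology X I). wedge_proj p z \<in> {w \<in> wedge_carrier X p I. h w \<in> U}}}
      = {x \<in> topspace (X i). h (wedge_proj p (i, x)) \<in> U}" if "i \<in> I" for i
    using that by (auto simp: wedge_carrier_def)
  have "openin (sum_topology X I)
     {z \<in> topspace (sum_topology X I). wedge_proj p z \<in> {w \<in> wedge_carrier X p I. h w \<in> U}}"
    unfolding openin_sum_topology
  proof (intro conjI ballI)
    show "openin (X i) {x. (i, x) \<in> {z \<in> topspace (sum_topology X I). wedge_proj p z \<in> {w \<in> wedge_carrier X p I. h w \<in> U}}}"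
      if "i \<in> I" for i
      unfolding eq[OF that] using assms(1)[OF that] U by (simp add: continuous_map_def)
  qed auto
  then show "openin (wedge_topology X p I) {w \<in> topspace (wedge_topology X p I). h w \<in> U}"
    unfolding openin_wedge_topology topspace_wedge_topology by auto
qed

lemma None_in_sphere_wedge: "None \<in> topspace (sphere_wedge ds)"
  by (simp add: sphere_wedge_def topspace_wedge_topology wedge_carrier_def)

text \<open>Closed base points make the two halves of a binary wedge closed, so that maps can be
  glued from them.\<close>

lemma closedin_None_sphere_wedge: "closedin (sphere_wedge ds) {None}"
proof -
  let ?X = "\<lambda>i. nsphere (ds ! i)" and ?p = "\<lambda>i::nat. sphere_basepoint" and ?I = "{..<length ds}"
  have "openin (sum_topology ?X ?I)
     {z \<in> topspace (sum_topology ?X ?I). wedge_proj ?p z \<in> wedge_carrier ?X ?p ?I - {None}}"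
    unfolding openin_sum_topology
  proof (intro conjI ballI)
    fix i assume i: "i \<in> ?I"
    have "closedin (nsphere (ds ! i)) {sphere_basepoint}"
      by (rule closedin_Hausdorff_singleton)
        (simp add: nsphere Hausdorff_space_subtopology Hausdorff_space_product_topology,
         rule sphere_basepoint_in_nsphere)
    then have "openin (nsphere (ds ! i)) (topspace (nsphere (ds ! i)) - {sphere_basepoint})"
      by blast
    moreover have "{x. (i, x) \<in> {z \<in> topspace (sum_topology ?X ?I). wedge_proj ?p z \<in> wedge_carrier ?X ?p ?I - {None}}}
       = topspace (nsphere (ds ! i)) - {sphere_basepoint}"
      using i by (auto simp: wedge_carrier_def wedge_proj_def)
    ultimately show "openin (nsphere (ds ! i))
       {x. (i, x) \<in> {z \<in> topspace (sum_topology ?X ?I). wedge_proj ?p z \<in> wedge_carrier ?X ?p ?I - {None}}}"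
      by simp
  qed auto
  then show ?thesis
    unfolding closedin_def sphere_wedge_def openin_wedge_topology topspace_wedge_topology
    by (auto simp: wedge_carrier_def)
qed

lemma pointed_equiv_sphere_wedge_single:
  "pointed_equiv (nsphere d) sphere_basepoint (sphere_wedge [d]) None"
proof (rule pointed_equiv_homeomorphic)
  let ?p = "\<lambda>i::nat. sphere_basepoint"
  let ?g = "\<lambda>w. case w of None \<Rightarrow> sphere_basepoint | Some (i, x) \<Rightarrow> x"
  have g: "?g (wedge_proj ?p (i, x)) = x" for i :: nat and x
    by (simp add: wedge_proj_def)
  have "continuous_map (sphere_wedge [d]) (nsphere d) ?g"
    unfolding sphere_wedge_def
    by (rule continuous_map_from_wedge) (simp_all only: g, auto simp: sphere_basepoint_in_nsphere)
  moreover have "continuous_map (nsphere d) (sphere_wedge [d]) (\<lambda>x. wedge_proj ?p (0, x))"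
    unfolding sphere_wedge_def
    using continuous_map_wedge_proj[of 0 "{..<length [d]}" "\<lambda>i. nsphere ([d] ! i)"] by simp
  moreover have "wedge_proj ?p (0, ?g w) = w" if "w \<in> topspace (sphere_wedge [d])" for w
    using that g by (auto simp: sphere_wedge_def topspace_wedge_topology wedge_carrier_def wedge_proj_def)
  ultimately show "homeomorphic_maps (nsphere d) (sphere_wedge [d]) (\<lambda>x. wedge_proj ?p (0, x)) ?g"
    by (simp add: homeomorphic_maps_def g)
  show "wedge_proj ?p (0::nat, sphere_basepoint) = None" by (simp add: wedge_proj_def)
qed (rule sphere_basepoint_in_nsphere)

lemma pointed_equiv_sphere_wedge_Nil:
  assumes "x \<in> topspace X" "homotopic_with (\<lambda>h. h x = x) X X (\<lambda>_. x) id"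
  shows "pointed_equiv X x (sphere_wedge []) None"
proof -
  have top: "topspace (sphere_wedge []) = {None}"
    by (simp add: sphere_wedge_def topspace_wedge_topology wedge_carrier_def)
  have c: "continuous_map X (sphere_wedge []) (\<lambda>_. None)" "continuous_map (sphere_wedge []) X (\<lambda>_. x)"
    using assms(1) top by auto
  have "homotopic_with (\<lambda>h. h None = None) (sphere_wedge []) (sphere_wedge []) ((\<lambda>_. None) \<circ> (\<lambda>_. x)) id"
    by (rule homotopic_with_equal) (auto simp: top)
  then show ?thesis
    unfolding pointed_equiv_def using assms c top
    by (intro conjI exI[of _ "\<lambda>_. None"] exI[of _ "\<lambda>_. x"]) (auto simp: o_def)
qed

text \<open>The spheres of the second factor are numbered after those of the first. Out of the
  quotient, continuity is tested on each sphere; out of the product, the map is glued from two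
  closed halves.\<close>

lemma pointed_equiv_sphere_wedge_append:
  "pointed_equiv (pointed_wedge (sphere_wedge ds) None (sphere_wedge es) None) (None, None)
     (sphere_wedge (ds @ es)) None"
proof (rule pointed_equiv_sym, rule pointed_equiv_homeomorphic)
  let ?n = "length ds" and ?p = "\<lambda>i::nat. sphere_basepoint"
  let ?W = "pointed_wedge (sphere_wedge ds) None (sphere_wedge es) None"
  let ?S = "sphere_wedge (ds @ es)"
  let ?sh = "map_option (\<lambda>(i, x). (i + ?n, x))"
  let ?F = "\<lambda>w. case w of None \<Rightarrow> (None, None)
     | Some (i, x) \<Rightarrow> if i < ?n then (Some (i, x), None) else (None, Some (i - ?n, x))"
  let ?G = "\<lambda>(u, v). if v = None then u else ?sh v"
  have proj: "continuous_map (nsphere (fs ! i)) (sphere_wedge fs) (\<lambda>x. wedge_proj ?p (i, x))"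
    if "i < length fs" for i fs
    unfolding sphere_wedge_def
    using continuous_map_wedge_proj[of i "{..<length fs}" "\<lambda>i. nsphere (fs ! i)"] that by simp
  have cases: "w = None \<or> (\<exists>i x. w = Some (i, x) \<and> i < length fs \<and> x \<in> topspace (nsphere (fs ! i)) \<and> x \<noteq> sphere_basepoint)"
    if "w \<in> topspace (sphere_wedge fs)" for w fs
    using that by (auto simp: sphere_wedge_def topspace_wedge_topology wedge_carrier_def wedge_proj_def)
  have id: "continuous_map (sphere_wedge ds) ?S (\<lambda>w. w)"
    unfolding sphere_wedge_def[of ds]
  proof (rule continuous_map_from_wedge)
    show "continuous_map (nsphere (ds ! i)) ?S (\<lambda>x. wedge_proj ?p (i, x))" if "i \<in> {..<length ds}" for i
      using proj[of i "ds @ es"] that by (simp add: nth_append)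
  qed (simp add: None_in_sphere_wedge)
  have shp: "?sh (wedge_proj ?p (i, x)) = wedge_proj ?p (i + ?n, x)" for i x
    by (simp add: wedge_proj_def)
  have sh: "continuous_map (sphere_wedge es) ?S ?sh"
    unfolding sphere_wedge_def[of es]
  proof (rule continuous_map_from_wedge)
    show "continuous_map (nsphere (es ! i)) ?S (\<lambda>x. ?sh (wedge_proj ?p (i, x)))" if "i \<in> {..<length es}" for i
      unfolding shp using proj[of "i + ?n" "ds @ es"] that by (simp add: nth_append)
  qed (simp add: None_in_sphere_wedge)
  have Fp: "?F (wedge_proj ?p (i, x)) = (if i < ?n then (wedge_proj ?p (i, x), None) else (None, wedge_proj ?p (i - ?n, x)))" for i x
    by (simp add: wedge_proj_def)
  have contF: "continuous_map ?S ?W ?F"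
    unfolding pointed_wedge_def
  proof (subst continuous_map_in_subtopology, intro conjI)
    show "continuous_map ?S (prod_topology (sphere_wedge ds) (sphere_wedge es)) ?F"
      unfolding sphere_wedge_def[of "ds @ es"]
    proof (rule continuous_map_from_wedge)
      show "continuous_map (nsphere ((ds @ es) ! i)) (prod_topology (sphere_wedge ds) (sphere_wedge es)) (\<lambda>x. ?F (wedge_proj ?p (i, x)))"
        if "i \<in> {..<length (ds @ es)}" for i
        unfolding Fp
        using that proj[of i ds] proj[of "i - ?n" es]
        by (auto simp: nth_append None_in_sphere_wedge intro!: continuous_map_pairedI)
    qed (simp add: None_in_sphere_wedge)
    show "?F \<in> topspace ?S \<rightarrow> {(u, v). u = None \<or> v = None}"
      by (auto split: option.splits)
  qed
  have contG: "continuous_map ?W ?S ?G"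
    unfolding continuous_map_closedin
  proof (intro conjI allI impI)
    show "?G \<in> topspace ?W \<rightarrow> topspace ?S"
      using id sh by (auto simp: topspace_pointed_wedge continuous_map_def Pi_iff)
    fix C assume C: "closedin ?S C"
    let ?A = "{u \<in> topspace (sphere_wedge ds). u \<in> C}" and ?B = "{v \<in> topspace (sphere_wedge es). ?sh v \<in> C}"
    have "closedin (sphere_wedge ds) ?A" "closedin (sphere_wedge es) ?B"
      using id sh C by (auto simp: continuous_map_closedin)
    then have "closedin (prod_topology (sphere_wedge ds) (sphere_wedge es)) (?A \<times> {None} \<union> {None} \<times> ?B)"
      by (intro closedin_Un) (auto simp: closedin_prod_Times_iff closedin_None_sphere_wedge)
    moreover have "{z \<in> topspace ?W. ?G z \<in> C} = (?A \<times> {None} \<union> {None} \<times> ?B)"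
      by (auto simp: topspace_pointed_wedge None_in_sphere_wedge split: if_splits)
    moreover have "(?A \<times> {None} \<union> {None} \<times> ?B) \<subseteq> {(u, v). u = None \<or> v = None}" by auto
    ultimately show "closedin ?W {z \<in> topspace ?W. ?G z \<in> C}"
      unfolding pointed_wedge_def by (auto intro: closedin_subset_topspace)
  qed
  show "homeomorphic_maps ?S ?W ?F ?G"
    unfolding homeomorphic_maps_def
  proof (intro conjI ballI contF contG)
    fix w assume "w \<in> topspace ?S"
    from cases[OF this] show "?G (?F w) = w" by auto
  next
    fix z assume "z \<in> topspace ?W"
    then obtain u v where z: "z = (u, v)" "u \<in> topspace (sphere_wedge ds)" "v \<in> topspace (sphere_wedge es)"
      "u = None \<or> v = None" by (auto simp: topspace_pointed_wedge)
    from cases[OF z(2)] cases[OF z(3)] z(1,4) show "?F (?G z) = z" by auto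
  qed
qed (simp_all add: None_in_sphere_wedge)

lemma pointed_equiv_wedge_of_spheres:
  assumes "pointed_equiv X x (sphere_wedge ds) None" "pointed_equiv Y y (sphere_wedge es) None"
  shows "pointed_equiv (pointed_wedge X x Y y) (x, y) (sphere_wedge (ds @ es)) None"
  using pointed_equiv_trans[OF pointed_equiv_wedge[OF assms] pointed_equiv_sphere_wedge_append] .

section \<open>Independence complexes of finite graphs\<close>

definition fin_graph :: "'v set \<Rightarrow> ('v \<Rightarrow> 'v \<Rightarrow> bool) \<Rightarrow> bool" where
  "fin_graph S E \<longleftrightarrow> finite S \<and> (\<forall>u v. E u v \<longrightarrow> E v u) \<and> (\<forall>u. \<not> E u u)"

definition indep_sets :: "'v set \<Rightarrow> ('v \<Rightarrow> 'v \<Rightarrow> bool) \<Rightarrow> 'v set set" where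
  "indep_sets S E = {\<sigma>. finite \<sigma> \<and> \<sigma> \<subseteq> S \<and> (\<forall>u\<in>\<sigma>. \<forall>v\<in>\<sigma>. \<not> E u v)}"

abbreviation ind_space :: "'v set \<Rightarrow> ('v \<Rightarrow> 'v \<Rightarrow> bool) \<Rightarrow> ('v \<Rightarrow> real) topology" where
  "ind_space S E \<equiv> geometric_realization (indep_sets S E)"

definition vertex_point :: "'v \<Rightarrow> 'v \<Rightarrow> real" where
  "vertex_point v = (\<lambda>w. if w = v then 1 else 0)"

lemma fin_graph_mono: "fin_graph S E \<Longrightarrow> T \<subseteq> S \<Longrightarrow> fin_graph T E"
  by (auto simp: fin_graph_def finite_subset)

text \<open>The support varies with the point; summing over the fixed set \<open>S\<close> instead
  makes the last condition linear in \<open>x\<close>.\<close>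

lemma topspace_ind_space:
  assumes "finite S"
  shows "x \<in> topspace (ind_space S E) \<longleftrightarrow> (\<forall>v. 0 \<le> x v) \<and> (\<forall>v. x v \<noteq> 0 \<longrightarrow> v \<in> S) \<and>
     (\<forall>u v. x u \<noteq> 0 \<longrightarrow> x v \<noteq> 0 \<longrightarrow> \<not> E u v) \<and> (\<Sum>v\<in>S. x v) = 1"
proof -
  have 1: "(\<Sum>v | x v \<noteq> 0. x v) = (\<Sum>v\<in>S. x v)" if "{v. x v \<noteq> 0} \<subseteq> S"
    by (rule sum.mono_neutral_left) (use assms that in auto)
  have 2: "finite {v. x v \<noteq> 0}" if "{v. x v \<noteq> 0} \<subseteq> S"
    using that assms by (rule finite_subset)
  have 3: "{v. x v \<noteq> 0} \<subseteq> S \<longleftrightarrow> (\<forall>v. x v \<noteq> 0 \<longrightarrow> v \<in> S)" by auto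
  have "x \<in> topspace (ind_space S E) \<longleftrightarrow> (\<forall>v. 0 \<le> x v) \<and> {v. x v \<noteq> 0} \<subseteq> S \<and>
     (\<forall>u v. x u \<noteq> 0 \<longrightarrow> x v \<noteq> 0 \<longrightarrow> \<not> E u v) \<and> (\<Sum>v | x v \<noteq> 0. x v) = 1"
    unfolding geometric_realization_def indep_sets_def using 2 by (auto simp: topspace_product_topology)
  then show ?thesis using 1 3 by metis
qed

lemma continuous_map_into_ind_space:
  assumes "\<And>v. continuous_map X euclideanreal (\<lambda>p. f p v)"
    "\<And>p. p \<in> topspace X \<Longrightarrow> f p \<in> topspace (ind_space S E)"
  shows "continuous_map X (ind_space S E) f"
proof -
  have "continuous_map X (powertop_real UNIV) f"
    using assms(1) by (simp add: continuous_map_componentwise_UNIV)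
  then show ?thesis
    using assms(2) unfolding geometric_realization_def
    by (auto simp: continuous_map_in_subtopology topspace_subtopology)
qed

lemma continuous_map_ind_space_component:
  "continuous_map (ind_space S E) euclideanreal (\<lambda>x. x v)"
  unfolding geometric_realization_def
  by (rule continuous_map_from_subtopology) (rule continuous_map_product_projection, simp)

lemma continuous_map_component_of:
  "continuous_map X (ind_space S E) f \<Longrightarrow> continuous_map X euclideanreal (\<lambda>p. f p v)"
  using continuous_map_compose[OF _ continuous_map_ind_space_component] by (force simp: o_def)

lemma Hausdorff_ind_space: "Hausdorff_space (ind_space S E)"
  unfolding geometric_realization_def
  by (simp add: Hausdorff_space_subtopology Hausdorff_space_product_topology)

lemma compact_ind_space:
  assumes "finite S"
  shows "compact_space (ind_space S E)"
proof -
  let ?B = "\<Pi>\<^sub>E v\<in>UNIV. (if v \<in> S then {0..1} else {0::real})"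
  \<comment> \<open>Independence of the support is written as the vanishing of products, a closed
    condition. The realization thus becomes a closed subset of the compact cube
    \<open>?B\<close>.\<close>
  let ?C = "{x. (\<forall>v. 0 \<le> x v) \<and> (\<forall>v. v \<notin> S \<longrightarrow> x v = 0) \<and>
     (\<forall>u v. E u v \<longrightarrow> x u * x v = 0) \<and> (\<Sum>v\<in>S. x v) = (1::real)}"
  have cont: "continuous_on UNIV (\<lambda>x::'a \<Rightarrow> real. x v)" for v
    by (rule continuous_on_product_coordinates)
  have "closed ?C"
    by (intro closed_Collect_conj closed_Collect_all closed_Collect_imp closed_Collect_le closed_Collect_eq
        open_Collect_const continuous_on_const continuous_on_sum continuous_on_mult cont)
  moreover have "compact ?B"
    unfolding compactin_euclidean_iff[symmetric] euclidean_product_topology[symmetric]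
    by (subst compactin_PiE) auto
  ultimately have "compact (?C \<inter> ?B)" by (rule closed_Int_compact)
  moreover have "?C \<inter> ?B = topspace (ind_space S E)"
  proof (intro equalityI subsetI)
    fix x assume "x \<in> topspace (ind_space S E)"
    then have x: "\<And>v. 0 \<le> x v" "\<And>v. v \<notin> S \<Longrightarrow> x v = 0" "\<And>u v. x u \<noteq> 0 \<Longrightarrow> x v \<noteq> 0 \<Longrightarrow> \<not> E u v" "sum x S = 1"
      unfolding topspace_ind_space[OF assms] by blast+
    have "x v \<le> 1" if "v \<in> S" for v
      using member_le_sum[of v S x] x assms that by simp
    moreover have "x u * x v = 0" if "E u v" for u v
      using x(3) that by (metis mult_eq_0_iff)
    ultimately show "x \<in> ?C \<inter> ?B" using x by (auto simp: PiE_iff)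
  qed (auto simp: topspace_ind_space[OF assms])
  ultimately have "compactin (powertop_real UNIV) (topspace (ind_space S E))"
    by (simp add: euclidean_product_topology)
  then show ?thesis
    unfolding geometric_realization_def by (simp add: compact_space_subtopology topspace_product_topology)
qed

section \<open>Simplicial maps, contiguity and folds\<close>

lemma vertex_point_in_ind_space:
  "finite S \<Longrightarrow> v \<in> S \<Longrightarrow> \<not> E v v \<Longrightarrow> vertex_point v \<in> topspace (ind_space S E)"
  by (auto simp: topspace_ind_space vertex_point_def)

text \<open>For each \<open>p\<close> the supports of \<open>f p\<close> and \<open>g p\<close>
  together are independent, so the segment between the two points stays in the complex. It is
  constant wherever \<open>f\<close> and \<open>g\<close> agree, which is what the condition on
  \<open>P\<close> allows one to exploit for pointed homotopies.\<close>

lemma ind_space_linear_homotopy: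
  assumes S: "finite S" and f: "continuous_map X (ind_space S E) f" and g: "continuous_map X (ind_space S E) g"
    and E: "\<And>u v. E u v \<Longrightarrow> E v u"
    and fg: "\<And>p u v. p \<in> topspace X \<Longrightarrow> f p u \<noteq> 0 \<Longrightarrow> g p v \<noteq> 0 \<Longrightarrow> \<not> E u v"
    and P: "\<And>h. (\<And>p. f p = g p \<Longrightarrow> h p = f p) \<Longrightarrow> P h"
  shows "homotopic_with P X (ind_space S E) f g"
proof -
  let ?H = "\<lambda>(t, p). \<lambda>v. (1 - t) * f p v + t * g p v"
  have "continuous_map (prod_topology unit_interval X) (ind_space S E) ?H"
  proof (rule continuous_map_into_ind_space)
    fix v
    have 1: "continuous_map (prod_topology unit_interval X) euclideanreal fst"
      by (rule continuous_map_into_fulltopology[OF continuous_map_fst])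
    have 2: "continuous_map (prod_topology unit_interval X) euclideanreal (\<lambda>z. f (snd z) v)"
      "continuous_map (prod_topology unit_interval X) euclideanreal (\<lambda>z. g (snd z) v)"
      using continuous_map_compose[OF continuous_map_snd continuous_map_component_of[OF f]]
        continuous_map_compose[OF continuous_map_snd continuous_map_component_of[OF g]] by (simp_all add: o_def)
    show "continuous_map (prod_topology unit_interval X) euclideanreal (\<lambda>p. ?H p v)"
      unfolding case_prod_unfold
      by (intro continuous_map_add continuous_map_real_mult continuous_map_diff 1 2 continuous_map_const[THEN iffD2]) auto
  next
    fix z assume z: "z \<in> topspace (prod_topology unit_interval X)"
    obtain t p where tp: "z = (t, p)" "t \<in> {0..1}" "p \<in> topspace X" using z by auto
    have "f p \<in> topspace (ind_space S E)" "g p \<in> topspace (ind_space S E)"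
      using f g tp by (auto simp: continuous_map_def)
    then have F: "\<And>v. 0 \<le> f p v" "\<And>v. f p v \<noteq> 0 \<Longrightarrow> v \<in> S" "\<And>u v. f p u \<noteq> 0 \<Longrightarrow> f p v \<noteq> 0 \<Longrightarrow> \<not> E u v" "sum (f p) S = 1"
      and G: "\<And>v. 0 \<le> g p v" "\<And>v. g p v \<noteq> 0 \<Longrightarrow> v \<in> S" "\<And>u v. g p u \<noteq> 0 \<Longrightarrow> g p v \<noteq> 0 \<Longrightarrow> \<not> E u v" "sum (g p) S = 1"
      unfolding topspace_ind_space[OF S] by blast+
    have sup: "f p v \<noteq> 0 \<or> g p v \<noteq> 0" if "?H z v \<noteq> 0" for v using that tp by auto
    show "?H z \<in> topspace (ind_space S E)"
      unfolding topspace_ind_space[OF S]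
    proof (intro conjI allI impI)
      show "0 \<le> ?H z v" for v using tp F(1) G(1) by simp
      show "v \<in> S" if "?H z v \<noteq> 0" for v using sup[OF that] F(2) G(2) by blast
      show "\<not> E u v" if "?H z u \<noteq> 0" "?H z v \<noteq> 0" for u v
        using sup[OF that(1)] sup[OF that(2)] F(3) G(3) fg[OF tp(3)] E by blast
      show "(\<Sum>v\<in>S. ?H z v) = 1"
        using F(4) G(4) by (simp add: tp(1) sum.distrib flip: sum_distrib_left)
    qed
  qed
  then show ?thesis
    unfolding homotopic_with_def
    by (intro exI[of _ ?H]) (auto intro!: P simp: fun_eq_iff algebra_simps)
qed

text \<open>The affine extension of a vertex map to barycentric coordinates; vertices with a common
  image add up their weights.\<close>

definition push_forward :: "'v set \<Rightarrow> ('v \<Rightarrow> 'w) \<Rightarrow> ('v \<Rightarrow> real) \<Rightarrow> 'w \<Rightarrow> real" where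
  "push_forward S \<phi> x = (\<lambda>w. \<Sum>u\<in>S. if \<phi> u = w then x u else 0)"

lemma push_forward_nonzero:
  assumes "push_forward S \<phi> x w \<noteq> 0"
  obtains u where "u \<in> S" "\<phi> u = w" "x u \<noteq> 0"
proof -
  from sum.not_neutral_contains_not_neutral[OF assms[unfolded push_forward_def]]
  show thesis using that by (metis (mono_tags))
qed

lemma continuous_map_push_forward:
  assumes S: "finite S" and T: "finite T" and \<phi>: "\<And>u. u \<in> S \<Longrightarrow> \<phi> u \<in> T"
    and EF: "\<And>u v. u \<in> S \<Longrightarrow> v \<in> S \<Longrightarrow> \<not> E u v \<Longrightarrow> \<not> F (\<phi> u) (\<phi> v)"
  shows "continuous_map (ind_space S E) (ind_space T F) (push_forward S \<phi>)"
proof (rule continuous_map_into_ind_space)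
  show "continuous_map (ind_space S E) euclideanreal (\<lambda>p. push_forward S \<phi> p v)" for v
    unfolding push_forward_def
    by (rule continuous_map_sum[OF S]) (auto intro: continuous_map_ind_space_component)
next
  fix x assume "x \<in> topspace (ind_space S E)"
  then have x: "\<And>v. 0 \<le> x v" "\<And>u v. x u \<noteq> 0 \<Longrightarrow> x v \<noteq> 0 \<Longrightarrow> \<not> E u v" "sum x S = 1"
    unfolding topspace_ind_space[OF S] by blast+
  show "push_forward S \<phi> x \<in> topspace (ind_space T F)"
    unfolding topspace_ind_space[OF T]
  proof (intro conjI allI impI)
    show "0 \<le> push_forward S \<phi> x v" for v
      unfolding push_forward_def by (intro sum_nonneg) (auto simp: x(1))
    show "v \<in> T" if "push_forward S \<phi> x v \<noteq> 0" for v
      by (rule push_forward_nonzero[OF that]) (use \<phi> in blast)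
    show "\<not> F u v" if u: "push_forward S \<phi> x u \<noteq> 0" and v: "push_forward S \<phi> x v \<noteq> 0" for u v
      by (rule push_forward_nonzero[OF u], rule push_forward_nonzero[OF v]) (use EF x(2) in blast)
    have "(\<Sum>v\<in>T. push_forward S \<phi> x v) = (\<Sum>u\<in>S. \<Sum>w\<in>T. if \<phi> u = w then x u else 0)"
      unfolding push_forward_def by (rule sum.swap)
    also have "\<dots> = sum x S"
      using \<phi> T by (intro sum.cong) (auto simp: sum.delta)
    finally show "(\<Sum>v\<in>T. push_forward S \<phi> x v) = 1" using x(3) by simp
  qed
qed

lemma push_forward_id:
  assumes "finite S" "\<And>u. x u \<noteq> 0 \<Longrightarrow> u \<in> S \<and> \<phi> u = u"
  shows "push_forward S \<phi> x = x"
proof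
  fix w
  have "(if \<phi> u = w then x u else 0) = (if u = w then x w else 0)" for u
    using assms(2)[of u] by (cases "x u = 0") auto
  then have "push_forward S \<phi> x w = (\<Sum>u\<in>S. if u = w then x w else 0)"
    by (simp add: push_forward_def)
  then show "push_forward S \<phi> x w = x w" using assms by (auto simp: sum.delta)
qed

lemma push_forward_vertex_point:
  assumes "finite S" "v \<in> S"
  shows "push_forward S \<phi> (vertex_point v) = vertex_point (\<phi> v)"
proof
  fix w
  have "(if \<phi> u = w then vertex_point v u else 0) = (if u = v then vertex_point (\<phi> v) w else 0)" for u
    by (auto simp: vertex_point_def)
  then show "push_forward S \<phi> (vertex_point v) w = vertex_point (\<phi> v) w"
    using assms by (simp add: push_forward_def)
qed

lemma push_forward_const:
  "finite S \<Longrightarrow> x \<in> topspace (ind_space S E) \<Longrightarrow> push_forward S (\<lambda>_. c) x = vertex_point c"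
  by (auto simp: push_forward_def vertex_point_def fun_eq_iff topspace_ind_space)

text \<open>Contiguous simplicial maps are homotopic. Independence complexes are flag complexes, so
  contiguity can be tested on pairs of vertices, a vertex being paired also with itself.\<close>

lemma ind_space_contiguous:
  assumes S: "finite S" and T: "finite T" and F: "\<And>u v. F u v \<Longrightarrow> F v u"
    and \<phi>: "\<And>u. u \<in> S \<Longrightarrow> \<phi> u \<in> T" "\<And>u v. u \<in> S \<Longrightarrow> v \<in> S \<Longrightarrow> \<not> E u v \<Longrightarrow> \<not> F (\<phi> u) (\<phi> v)"
    and \<psi>: "\<And>u. u \<in> S \<Longrightarrow> \<psi> u \<in> T" "\<And>u v. u \<in> S \<Longrightarrow> v \<in> S \<Longrightarrow> \<not> E u v \<Longrightarrow> \<not> F (\<psi> u) (\<psi> v)"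
    and \<phi>\<psi>: "\<And>u v. u \<in> S \<Longrightarrow> v \<in> S \<Longrightarrow> \<not> E u v \<Longrightarrow> \<not> F (\<phi> u) (\<psi> v)"
    and P: "\<And>h. (\<And>p. push_forward S \<phi> p = push_forward S \<psi> p \<Longrightarrow> h p = push_forward S \<phi> p) \<Longrightarrow> P h"
  shows "homotopic_with P (ind_space S E) (ind_space T F) (push_forward S \<phi>) (push_forward S \<psi>)"
proof (rule ind_space_linear_homotopy[OF T])
  show "\<not> F u v" if p: "p \<in> topspace (ind_space S E)" and u: "push_forward S \<phi> p u \<noteq> 0" and v: "push_forward S \<psi> p v \<noteq> 0" for p u v
  proof -
    obtain a where "a \<in> S" "\<phi> a = u" "p a \<noteq> 0"
      using u by (rule push_forward_nonzero)
    moreover obtain b where "b \<in> S" "\<psi> b = v" "p b \<noteq> 0"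
      using v by (rule push_forward_nonzero)
    ultimately show ?thesis using p \<phi>\<psi> unfolding topspace_ind_space[OF S] by blast
  qed
qed (use assms in \<open>auto intro: continuous_map_push_forward F P\<close>)

text \<open>Sending \<open>v\<close> to \<open>u\<close> and fixing all other vertices is a
  simplicial retraction, and it is contiguous to the identity: a vertex compatible with
  \<open>v\<close> is compatible with \<open>u\<close>.\<close>

lemma pointed_equiv_fold:
  assumes G: "fin_graph S E" and uv: "u \<in> S" "v \<in> S" "u \<noteq> v"
    and dom: "\<And>w. w \<in> S \<Longrightarrow> E u w \<Longrightarrow> E v w"
    and p: "p \<in> S" "p \<noteq> v"
  shows "pointed_equiv (ind_space S E) (vertex_point p) (ind_space (S - {v}) E) (vertex_point p)"
proof -
  have S: "finite S" and E: "\<And>u v. E u v \<Longrightarrow> E v u" and irr: "\<And>u. \<not> E u u"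
    using G by (auto simp: fin_graph_def)
  let ?T = "S - {v}" and ?\<phi> = "\<lambda>w. if w = v then u else w"
  have T: "finite ?T" using S by simp
  have dom': "w \<in> S \<Longrightarrow> E w u \<Longrightarrow> E w v" for w using dom E by blast
  have ne: "\<not> E u v" "\<not> E v u" using dom[OF uv(2)] irr E by blast+
  have r: "continuous_map (ind_space S E) (ind_space ?T E) (push_forward S ?\<phi>)"
    by (rule continuous_map_push_forward[OF S T]) (use uv irr in \<open>auto split: if_splits dest: dom dom'\<close>)
  have incl: "push_forward ?T (\<lambda>w. w) x = x" if "x \<in> topspace (ind_space ?T E)" for x
    by (rule push_forward_id[OF T]) (use that in \<open>auto simp: topspace_ind_space[OF T]\<close>)
  have i: "continuous_map (ind_space ?T E) (ind_space S E) (\<lambda>x. x)"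
    using continuous_map_eq[OF continuous_map_push_forward[OF T S, of "\<lambda>w. w" E E] incl] by auto
  have idS: "push_forward S (\<lambda>w. w) x = x" if "x \<in> topspace (ind_space S E)" for x
    by (rule push_forward_id[OF S]) (use that in \<open>auto simp: topspace_ind_space[OF S]\<close>)
  have rp: "push_forward S ?\<phi> (vertex_point p) = vertex_point p"
    using push_forward_vertex_point[OF S p(1), of ?\<phi>] p(2) by simp
  have idp: "push_forward S (\<lambda>w. w) (vertex_point p) = vertex_point p"
    using push_forward_vertex_point[OF S p(1), of "\<lambda>w. w"] by simp
  have vpS: "vertex_point p \<in> topspace (ind_space S E)" and vpT: "vertex_point p \<in> topspace (ind_space ?T E)"
    using p irr S T by (auto intro: vertex_point_in_ind_space)
  have "homotopic_with (\<lambda>h. h (vertex_point p) = vertex_point p) (ind_space S E) (ind_space S E)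
      (push_forward S ?\<phi>) (push_forward S (\<lambda>w. w))"
    by (rule ind_space_contiguous[OF S S]) (use uv irr ne in \<open>auto split: if_splits dest: dom dom' simp: rp idp intro: E\<close>)
  then have 1: "homotopic_with (\<lambda>h. h (vertex_point p) = vertex_point p) (ind_space S E) (ind_space S E)
      ((\<lambda>x. x) \<circ> push_forward S ?\<phi>) id"
    by (rule homotopic_with_eq) (use idS vpS in auto)
  have 2: "homotopic_with (\<lambda>h. h (vertex_point p) = vertex_point p) (ind_space ?T E) (ind_space ?T E)
      (push_forward S ?\<phi> \<circ> (\<lambda>x. x)) id"
  proof (rule homotopic_with_equal)
    show "continuous_map (ind_space ?T E) (ind_space ?T E) (push_forward S ?\<phi> \<circ> (\<lambda>x. x))"
      by (rule continuous_map_compose[OF i r])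
    show "(push_forward S ?\<phi> \<circ> (\<lambda>x. x)) x = id x" if "x \<in> topspace (ind_space ?T E)" for x
      using that push_forward_id[OF S, of x ?\<phi>] by (auto simp: topspace_ind_space[OF T])
  qed (use rp in auto)
  show ?thesis
    unfolding pointed_equiv_def
    by (intro conjI exI[of _ "push_forward S ?\<phi>"] exI[of _ "\<lambda>x. x"] vpS vpT r i rp 1 2 refl)
qed

lemma pointed_equiv_isolated_vertex:
  assumes G: "fin_graph S E" and u: "u \<in> S" "\<And>w. w \<in> S \<Longrightarrow> \<not> E u w" and p: "p \<in> S"
  shows "pointed_equiv (ind_space S E) (vertex_point p) (sphere_wedge []) None"
proof (rule pointed_equiv_sphere_wedge_Nil)
  have S: "finite S" and E: "\<And>u v. E u v \<Longrightarrow> E v u" and irr: "\<And>u. \<not> E u u"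
    using G by (auto simp: fin_graph_def)
  show vp: "vertex_point p \<in> topspace (ind_space S E)"
    using S p irr by (rule vertex_point_in_ind_space)
  have u': "\<not> E w u" if "w \<in> S" for w using u(2)[OF that] E by blast
  \<comment> \<open>The contraction passes through the map that sends all vertices except
    \<open>p\<close> to \<open>u\<close>. Pushing everything to \<open>u\<close> at once would move
    the base point.\<close>
  let ?P = "\<lambda>h. h (vertex_point p) = vertex_point p" and ?\<phi> = "\<lambda>w. if w = p then p else u"
  have v: "push_forward S \<psi> (vertex_point p) = vertex_point p" if "\<psi> p = p" for \<psi>
    using push_forward_vertex_point[OF S p, of \<psi>] that by simp
  have "homotopic_with ?P (ind_space S E) (ind_space S E) (push_forward S (\<lambda>_. p)) (push_forward S ?\<phi>)"
    by (rule ind_space_contiguous[OF S S]) (use u u' p irr in \<open>auto simp: v intro: E\<close>)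
  moreover have "homotopic_with ?P (ind_space S E) (ind_space S E) (push_forward S ?\<phi>) (push_forward S (\<lambda>w. w))"
    by (rule ind_space_contiguous[OF S S]) (use u u' p irr in \<open>auto simp: v intro: E\<close>)
  ultimately have "homotopic_with ?P (ind_space S E) (ind_space S E) (push_forward S (\<lambda>_. p)) (push_forward S (\<lambda>w. w))"
    by (rule homotopic_with_trans)
  then show "homotopic_with ?P (ind_space S E) (ind_space S E) (\<lambda>_. vertex_point p) id"
    by (rule homotopic_with_eq)
      (use vp S in \<open>auto simp: push_forward_const[of S _ E] topspace_ind_space[OF S] intro!: push_forward_id[symmetric]\<close>)
qed

section \<open>Splitting a complex along the link of a vertex\<close>

lemma continuous_map_ind_space_inclusion:
  assumes "finite S" "T \<subseteq> S"
  shows "continuous_map (ind_space T E) (ind_space S E) (\<lambda>x. x)"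
proof (rule continuous_map_into_ind_space)
  have T: "finite T" using assms finite_subset by blast
  fix x assume x: "x \<in> topspace (ind_space T E)"
  have "sum x S = sum x T"
    using x assms by (intro sum.mono_neutral_right) (auto simp: topspace_ind_space[OF T])
  then show "x \<in> topspace (ind_space S E)"
    using x assms(2) unfolding topspace_ind_space[OF T] topspace_ind_space[OF assms(1)] by auto
qed (rule continuous_map_ind_space_component)

text \<open>The non-neighbours of \<open>v\<close> span its link, and the star of \<open>v\<close>
  is the cone over it. The cone coordinate is the barycentric coordinate of \<open>v\<close>, so the
  base lies in the deletion and the apex is \<open>v\<close>.\<close>

lemma cone_attachment_vertex:
  assumes G: "fin_graph S E" and v: "v \<in> S" and L: "L = {w \<in> S. w \<noteq> v \<and> \<not> E v w}" and ne: "L \<noteq> {}"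
  shows "cone_attachment (ind_space S E) (ind_space (S - {v}) E) (ind_space L E) (\<lambda>x. x) (\<lambda>x. x)
           (\<lambda>(t, y) w. if w = v then t else (1 - t) * y w)"
proof -
  have S: "finite S" and E: "\<And>u v. E u v \<Longrightarrow> E v u" and irr: "\<And>u. \<not> E u u"
    using G by (auto simp: fin_graph_def)
  have fL: "finite L" and fA: "finite (S - {v})" using S by (auto simp: L)
  let ?q = "\<lambda>(t::real, y) w. if w = v then t else (1 - t) * y w"
  have LD: "\<And>w. 0 \<le> y w" "\<And>w. y w \<noteq> 0 \<Longrightarrow> w \<in> L" "\<And>u w. y u \<noteq> 0 \<Longrightarrow> y w \<noteq> 0 \<Longrightarrow> \<not> E u w" "sum y L = 1" "y v = 0"
      "\<exists>w. y w \<noteq> 0"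
    if "y \<in> topspace (ind_space L E)" for y
  proof -
    show "\<And>w. 0 \<le> y w" "\<And>w. y w \<noteq> 0 \<Longrightarrow> w \<in> L" "\<And>u w. y u \<noteq> 0 \<Longrightarrow> y w \<noteq> 0 \<Longrightarrow> \<not> E u w" and s: "sum y L = 1"
      using that unfolding topspace_ind_space[OF fL] by blast+
    then show "y v = 0" by (auto simp: L)
    show "\<exists>w. y w \<noteq> 0" using s by (metis sum.neutral zero_neq_one)
  qed
  have sumS: "sum y (S - {v}) = 1" if "y \<in> topspace (ind_space L E)" for y
  proof -
    have "sum y (S - {v}) = sum y L"
      by (rule sum.mono_neutral_right) (use LD(2)[OF that] S in \<open>auto simp: L\<close>)
    then show ?thesis using LD(4)[OF that] by simp
  qed
  have q: "?q (t, y) \<in> topspace (ind_space S E)" if t: "t \<in> {0..1}" and y: "y \<in> topspace (ind_space L E)" for t y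
    unfolding topspace_ind_space[OF S]
  proof (intro conjI allI impI)
    show "0 \<le> ?q (t, y) w" for w using t LD(1)[OF y] by simp
    show "w \<in> S" if "?q (t, y) w \<noteq> 0" for w
      using that v LD(2)[OF y, of w] by (auto simp: L split: if_splits)
    show "\<not> E u w" if "?q (t, y) u \<noteq> 0" "?q (t, y) w \<noteq> 0" for u w
      using that LD(2)[OF y, of w] LD(2)[OF y, of u] LD(3)[OF y, of u w] irr E[of u w] by (auto simp: L split: if_splits)
    have "sum (?q (t, y)) S = t + (\<Sum>w\<in>S - {v}. (1 - t) * y w)"
      using S v by (subst sum.remove[of S v]) (auto intro!: sum.cong)
    also have "\<dots> = 1" using sumS[OF y] by (simp flip: sum_distrib_left)
    finally show "sum (?q (t, y)) S = 1" .
  qed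
  have incl: "continuous_map (ind_space L E) (ind_space (S - {v}) E) (\<lambda>x. x)"
    by (rule continuous_map_ind_space_inclusion[OF fA]) (auto simp: L)
  have inclA: "continuous_map (ind_space (S - {v}) E) (ind_space S E) (\<lambda>x. x)"
    by (rule continuous_map_ind_space_inclusion[OF S]) auto
  have contq: "continuous_map (prod_topology unit_interval (ind_space L E)) (ind_space S E) ?q"
  proof (rule continuous_map_into_ind_space)
    let ?P = "prod_topology unit_interval (ind_space L E)"
    have 1: "continuous_map ?P euclideanreal fst"
      by (rule continuous_map_into_fulltopology[OF continuous_map_fst])
    have 2: "continuous_map ?P euclideanreal (\<lambda>z. snd z w)" for w
      using continuous_map_compose[OF continuous_map_snd continuous_map_ind_space_component] by (simp add: o_def)
    show "continuous_map ?P euclideanreal (\<lambda>p. ?q p w)" for w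
    proof (cases "w = v")
      case True then show ?thesis using 1 by (simp add: case_prod_unfold)
    next
      case False
      then show ?thesis
        by (simp add: case_prod_unfold continuous_map_real_mult continuous_map_diff 1 2)
    qed
  qed (use q in auto)
  have vA: "a v = 0" if "a \<in> topspace (ind_space (S - {v}) E)" for a
    using that unfolding topspace_ind_space[OF fA] by blast
  have surj: "x \<in> topspace (ind_space (S - {v}) E) \<or> x \<in> ?q ` ({0..1} \<times> topspace (ind_space L E))"
    if x: "x \<in> topspace (ind_space S E)" for x
  proof -
    have X: "\<And>w. 0 \<le> x w" "\<And>w. x w \<noteq> 0 \<Longrightarrow> w \<in> S" "\<And>u w. x u \<noteq> 0 \<Longrightarrow> x w \<noteq> 0 \<Longrightarrow> \<not> E u w" "sum x S = 1"
      using x unfolding topspace_ind_space[OF S] by blast+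
    have sum: "x v + sum x (S - {v}) = 1" using X(4) S v by (simp add: sum.remove)
    consider "x v = 0" | "x v = 1" | "x v \<noteq> 0" "x v \<noteq> 1" by blast
    then show ?thesis
    proof cases
      case 1
      then have "x \<in> topspace (ind_space (S - {v}) E)"
        unfolding topspace_ind_space[OF fA] using X sum by auto
      then show ?thesis ..
    next
      case 2
      then have "sum x (S - {v}) = 0" using sum by simp
      then have 0: "x w = 0" if "w \<noteq> v" for w
        using that X(1,2) fA sum_nonneg_eq_0_iff[of "S - {v}" x] by blast
      \<comment> \<open>The point is the apex; any vertex of the link serves to write it as a value
        of \<open>?q\<close>.\<close>
      obtain u where u: "u \<in> L" using ne by blast
      have "vertex_point u \<in> topspace (ind_space L E)"
        using fL u irr by (rule vertex_point_in_ind_space)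
      moreover have "x = ?q (1, vertex_point u)" using 0 2 by auto
      ultimately have "x \<in> ?q ` ({0..1} \<times> topspace (ind_space L E))"
        by (intro image_eqI[of _ _ "(1, vertex_point u)"]) auto
      then show ?thesis ..
    next
      case 3
      have lt: "0 < x v" "x v < 1"
        using 3 X(1)[of v] sum sum_nonneg[of "S - {v}" x] X(1) by (auto simp: less_le)
      define y where "y = (\<lambda>w. if w = v then 0 else x w / (1 - x v))"
      have "y \<in> topspace (ind_space L E)"
        unfolding topspace_ind_space[OF fL]
      proof (intro conjI allI impI)
        show "0 \<le> y w" for w using X(1) lt by (simp add: y_def)
        show yL: "w \<in> L" if "y w \<noteq> 0" for w
          using that X(2,3) lt by (auto simp: y_def L split: if_splits)
        show "\<not> E u w" if "y u \<noteq> 0" "y w \<noteq> 0" for u w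
          using that X(3) by (auto simp: y_def split: if_splits)
        have "sum y L = sum y (S - {v})"
          by (rule sum.mono_neutral_left) (use yL S in \<open>auto simp: L\<close>)
        also have "\<dots> = sum x (S - {v}) / (1 - x v)"
          by (simp add: y_def sum_divide_distrib)
        also have "\<dots> = 1" using sum lt by simp
        finally show "sum y L = 1" .
      qed
      moreover have "x = ?q (x v, y)" using lt by (auto simp: y_def)
      ultimately have "x \<in> ?q ` ({0..1} \<times> topspace (ind_space L E))"
        using lt by (intro image_eqI[of _ _ "(x v, y)"]) auto
      then show ?thesis ..
    qed
  qed
  show ?thesis
    unfolding cone_attachment_def
  proof (intro conjI ballI impI)
    show "topspace (ind_space S E) = (\<lambda>x. x) ` topspace (ind_space (S - {v}) E) \<union> ?q ` ({0..1} \<times> topspace (ind_space L E))"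
      using surj q inclA by (auto simp: continuous_map_def Pi_iff)
    show "?q (0, y) = y" if "y \<in> topspace (ind_space L E)" for y
      using LD(5)[OF that] by auto
    show "?q (t, y) \<notin> (\<lambda>x. x) ` topspace (ind_space (S - {v}) E)" if "t \<in> {0<..1}" for t y
      using vA that by fastforce
    fix t t' y y' assume h: "t \<in> {0<..<1}" "t' \<in> {0<..1}" "y \<in> topspace (ind_space L E)" "y' \<in> topspace (ind_space L E)"
      "?q (t, y) = ?q (t', y')"
    from fun_cong[OF h(5), of v] show tt: "t = t'" by simp
    show "y = y'"
    proof
      fix w show "y w = y' w"
        using fun_cong[OF h(5), of w] tt h(1) LD(5)[OF h(3)] LD(5)[OF h(4)] by (cases "w = v") auto
    qed
  qed (use compact_ind_space[OF fA] compact_ind_space[OF fL] Hausdorff_ind_space incl inclA contq in auto)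
qed

text \<open>With the edge \<open>p p'\<close> added, \<open>L\<close> spans its suspension: the cone
  coordinate runs from \<open>p\<close> at 0 through the complex of \<open>L\<close> at 1/2 to
  \<open>p'\<close> at 1. A cone whose base is collapsed to a point is this suspension, and the
  wedge results when that point is \<open>a\<close>.\<close>

lemma cone_attachment_suspension:
  assumes G: "fin_graph (insert p (insert p' L)) E" and p: "p \<notin> L" "p' \<notin> L" "E p p'"
    and pL: "\<And>w. w \<in> L \<Longrightarrow> \<not> E p w \<and> \<not> E p' w" and ne: "L \<noteq> {}"
    and A: "compact_space A" "Hausdorff_space A" and a: "a \<in> topspace A"
  shows "cone_attachment (pointed_wedge A a (ind_space (insert p (insert p' L)) E) (vertex_point p)) A (ind_space L E)
           (\<lambda>_. a) (\<lambda>x. (x, vertex_point p))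
           (\<lambda>(t, y). (a, \<lambda>w. if w = p then max 0 (1 - 2 * t) else if w = p' then max 0 (2 * t - 1)
                              else (1 - \<bar>2 * t - 1\<bar>) * y w))"
proof -
  let ?S = "insert p (insert p' L)"
  let ?z = "\<lambda>(t::real) y w. if w = p then max 0 (1 - 2 * t) else if w = p' then max 0 (2 * t - 1)
                              else (1 - \<bar>2 * t - 1\<bar>) * y w"
  let ?q = "\<lambda>(t::real, y). (a, ?z t y)"
  let ?W = "pointed_wedge A a (ind_space ?S E) (vertex_point p)"
  have S: "finite ?S" and E: "\<And>u v. E u v \<Longrightarrow> E v u" and irr: "\<And>u. \<not> E u u"
    using G by (auto simp: fin_graph_def)
  have fL: "finite L" using S by auto
  have pp: "p \<noteq> p'" using p irr by metis
  have vpS: "vertex_point p \<in> topspace (ind_space ?S E)"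
    using S irr by (intro vertex_point_in_ind_space) auto
  have LD: "\<And>w. 0 \<le> y w" "\<And>w. y w \<noteq> 0 \<Longrightarrow> w \<in> L" "\<And>u w. y u \<noteq> 0 \<Longrightarrow> y w \<noteq> 0 \<Longrightarrow> \<not> E u w" "sum y L = 1"
      "y p = 0" "y p' = 0"
    if "y \<in> topspace (ind_space L E)" for y
    using that p unfolding topspace_ind_space[OF fL] by blast+
  have yne: "\<exists>w\<in>L. y w \<noteq> 0" if "y \<in> topspace (ind_space L E)" for y
    using LD(4)[OF that] by (metis sum.neutral zero_neq_one)
  have z: "?z t y \<in> topspace (ind_space ?S E)" if t: "t \<in> {0..1}" and y: "y \<in> topspace (ind_space L E)" for t y
    unfolding topspace_ind_space[OF S]
  proof (intro conjI allI impI)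
    have "0 \<le> 1 - \<bar>2 * t - 1\<bar>" using t by auto
    then show "0 \<le> ?z t y w" for w using LD(1)[OF y] by simp
    show "w \<in> ?S" if "?z t y w \<noteq> 0" for w
      using that LD(2)[OF y, of w] by (auto split: if_splits)
    show "\<not> E u w" if u: "?z t y u \<noteq> 0" and w: "?z t y w \<noteq> 0" for u w
    proof -
      have pq: "\<not> (?z t y p \<noteq> 0 \<and> ?z t y p' \<noteq> 0)" using pp by auto
      have mem: "r = p \<or> r = p' \<or> r \<in> L \<and> y r \<noteq> 0" if "?z t y r \<noteq> 0" for r
        using that LD(2)[OF y, of r] by (auto split: if_splits)
      have sym: "\<not> E w p \<and> \<not> E w p'" if "w \<in> L" for w using pL[OF that] E by blast
      from mem[OF u] mem[OF w] show ?thesis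
      proof (elim disjE)
        assume "u = p" "w = p'" then show ?thesis using pq u w pp by auto
      next
        assume "u = p'" "w = p" then show ?thesis using pq u w pp by auto
      qed (use irr pL sym LD(3)[OF y] in auto)
    qed
    have "sum (?z t y) ?S = max 0 (1 - 2 * t) + (max 0 (2 * t - 1) + (\<Sum>w\<in>L. ?z t y w))"
      using fL p pp by simp
    also have "(\<Sum>w\<in>L. ?z t y w) = (\<Sum>w\<in>L. (1 - \<bar>2 * t - 1\<bar>) * y w)"
      using p by (intro sum.cong) auto
    also have "\<dots> = 1 - \<bar>2 * t - 1\<bar>" using LD(4)[OF y] by (simp flip: sum_distrib_left)
    also have "max 0 (1 - 2 * t) + (max 0 (2 * t - 1) + (1 - \<bar>2 * t - 1\<bar>)) = 1" by auto
    finally show "sum (?z t y) ?S = 1" .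
  qed
  have contq: "continuous_map (prod_topology unit_interval (ind_space L E)) ?W ?q"
    unfolding pointed_wedge_def
  proof (subst continuous_map_in_subtopology, intro conjI)
    let ?P = "prod_topology unit_interval (ind_space L E)"
    have 1: "continuous_map ?P euclideanreal fst"
      by (rule continuous_map_into_fulltopology[OF continuous_map_fst])
    have 2: "continuous_map ?P euclideanreal (\<lambda>z. snd z w)" for w
      using continuous_map_compose[OF continuous_map_snd continuous_map_ind_space_component] by (simp add: o_def)
    have c: "continuous_map ?P euclideanreal (\<lambda>_. r)" for r by simp
    have "continuous_map ?P (ind_space ?S E) (\<lambda>z. ?z (fst z) (snd z))"
    proof (rule continuous_map_into_ind_space)
      show "continuous_map ?P euclideanreal (\<lambda>u. ?z (fst u) (snd u) w)" for w
        by (cases "w = p"; cases "w = p'"; simp only: if_True if_False simp_thms)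
          (intro continuous_map_real_max continuous_map_diff continuous_map_real_mult continuous_map_real_abs 1 2 c)+
    qed (use z in auto)
    then show "continuous_map ?P (prod_topology A (ind_space ?S E)) ?q"
      using a unfolding case_prod_unfold by (intro continuous_map_pairedI) auto
  qed auto
  have surj: "(\<exists>x\<in>topspace A. r = (x, vertex_point p)) \<or> r \<in> ?q ` ({0..1} \<times> topspace (ind_space L E))"
    if r: "r \<in> topspace ?W" for r
  proof -
    obtain u x where ux: "r = (u, x)" "u \<in> topspace A" "x \<in> topspace (ind_space ?S E)" "u = a \<or> x = vertex_point p"
      using r by (auto simp: topspace_pointed_wedge)
    show ?thesis
    proof (cases "x = vertex_point p")
      case True then show ?thesis using ux by blast
    next
      case False
      have X: "\<And>w. 0 \<le> x w" "\<And>w. x w \<noteq> 0 \<Longrightarrow> w \<in> ?S" "\<And>u w. x u \<noteq> 0 \<Longrightarrow> x w \<noteq> 0 \<Longrightarrow> \<not> E u w" "sum x ?S = 1"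
        using ux(3) unfolding topspace_ind_space[OF S] by blast+
      have sum: "x p + x p' + sum x L = 1" using X(4) fL p pp by simp
      have prod: "x p = 0 \<or> x p' = 0" using X(3) p by blast
      have c0: "0 \<le> sum x L" using X(1) by (simp add: sum_nonneg)
      \<comment> \<open>The adjacent vertices \<open>p\<close> and \<open>p'\<close> do not both
        have positive weight, so the difference of their weights determines both, and with them the
        height in the suspension.\<close>
      define t where "t = (1 + x p' - x p) / 2"
      have t: "t \<in> {0..1}" "max 0 (1 - 2 * t) = x p" "max 0 (2 * t - 1) = x p'" "1 - \<bar>2 * t - 1\<bar> = sum x L"
        using prod sum c0 X(1)[of p] X(1)[of p'] by (auto simp: t_def field_simps)
      have "\<exists>y\<in>topspace (ind_space L E). x = ?z t y"
      proof (cases "sum x L = 0")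
        case True
        then have x0: "x w = 0" if "w \<in> L" for w
          using that X(1) fL by (simp add: sum_nonneg_eq_0_iff)
        obtain l where l: "l \<in> L" using ne by blast
        have "x = ?z t (vertex_point l)"
        proof
          fix w show "x w = ?z t (vertex_point l) w"
            unfolding t(2-4) True using X(2)[of w] x0[of w] by auto
        qed
        then show ?thesis using vertex_point_in_ind_space[of L l E] fL l irr by blast
      next
        case False
        then have c: "0 < sum x L" using c0 by simp
        define y where "y = (\<lambda>w. if w \<in> L then x w / sum x L else 0)"
        have "y \<in> topspace (ind_space L E)"
          unfolding topspace_ind_space[OF fL]
        proof (intro conjI allI impI)
          show "0 \<le> y w" for w using X(1) c by (simp add: y_def)
          show "w \<in> L" if "y w \<noteq> 0" for w using that by (auto simp: y_def split: if_splits)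
          show "\<not> E u w" if "y u \<noteq> 0" "y w \<noteq> 0" for u w
            using that X(3) by (auto simp: y_def split: if_splits)
          have "sum y L = sum x L / sum x L" by (simp add: y_def flip: sum_divide_distrib)
          then show "sum y L = 1" using c by simp
        qed
        moreover have "x = ?z t y"
        proof
          fix w show "x w = ?z t y w"
            unfolding t(2-4) using X(2)[of w] c p by (auto simp: y_def)
        qed
        ultimately show ?thesis by blast
      qed
      then obtain y where "y \<in> topspace (ind_space L E)" "x = ?z t y" by blast
      then have "r \<in> ?q ` ({0..1} \<times> topspace (ind_space L E))"
        using ux False t(1) by (intro image_eqI[of _ _ "(t, y)"]) auto
      then show ?thesis ..
    qed
  qed
  show ?thesis
    unfolding cone_attachment_def
  proof (intro conjI ballI impI)
    show "Hausdorff_space ?W"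
      unfolding pointed_wedge_def
      by (rule Hausdorff_space_subtopology) (simp add: Hausdorff_space_prod_topology A Hausdorff_ind_space)
    show "continuous_map A ?W (\<lambda>x. (x, vertex_point p))"
      unfolding pointed_wedge_def continuous_map_in_subtopology using vpS
      by (auto intro!: continuous_map_pairedI)
    show "topspace ?W = (\<lambda>x. (x, vertex_point p)) ` topspace A \<union> ?q ` ({0..1} \<times> topspace (ind_space L E))"
    proof (intro equalityI subsetI)
      fix r assume "r \<in> topspace ?W"
      from surj[OF this] show "r \<in> (\<lambda>x. (x, vertex_point p)) ` topspace A \<union> ?q ` ({0..1} \<times> topspace (ind_space L E))"
        by blast
    next
      fix r assume "r \<in> (\<lambda>x. (x, vertex_point p)) ` topspace A \<union> ?q ` ({0..1} \<times> topspace (ind_space L E))"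
      then show "r \<in> topspace ?W" using z a vpS by (auto simp: topspace_pointed_wedge)
    qed
    show "inj_on (\<lambda>x. (x, vertex_point p)) (topspace A)" by (auto simp: inj_on_def)
    show "?q (0, y) = (a, vertex_point p)" for y using pp by (auto simp: vertex_point_def fun_eq_iff)
    show "?q (1, y) = ?q (1, y')" for y y' by (auto simp: fun_eq_iff)
    show "?q (t, y) \<notin> (\<lambda>x. (x, vertex_point p)) ` topspace A"
      if t: "t \<in> {0<..1}" and y: "y \<in> topspace (ind_space L E)" for t y
    proof
      assume "?q (t, y) \<in> (\<lambda>x. (x, vertex_point p)) ` topspace A"
      then have "?z t y = vertex_point p" by auto
      from fun_cong[OF this, of p] show False using t by (auto simp: vertex_point_def max_def split: if_splits)
    qed
    fix t t' y y' assume h: "t \<in> {0<..<1}" "t' \<in> {0<..1}" "y \<in> topspace (ind_space L E)" "y' \<in> topspace (ind_space L E)"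
      "?q (t, y) = ?q (t', y')"
    then have eq: "?z t y = ?z t' y'" by simp
    have tt: "max 0 (1 - 2 * t) = max 0 (1 - 2 * t')" "max 0 (2 * t - 1) = max 0 (2 * t' - 1)"
      using fun_cong[OF eq, of p] fun_cong[OF eq, of p'] pp by auto
    then show "t = t'" by (auto simp: max_def split: if_splits)
    have c: "1 - \<bar>2 * t - 1\<bar> \<noteq> 0" using h(1) by auto
    show "y = y'"
    proof
      fix w show "y w = y' w"
        using fun_cong[OF eq, of w] c \<open>t = t'\<close> LD(5,6)[OF h(3)] LD(5,6)[OF h(4)]
        by (cases "w = p"; cases "w = p'") auto
    qed
  qed (use compact_ind_space[OF fL] A a contq in auto)
qed

text \<open>The inclusion of the link is the attaching map of the star of \<open>v\<close>. Once it
  is replaced by a constant map, the attachment becomes a wedge of the deletion with the suspended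
  link, for which the edge \<open>p p'\<close> has been reserved.\<close>

theorem pointed_equiv_split:
  assumes G: "fin_graph (insert p (insert p' S)) E" and v: "v \<in> S"
    and L: "L = {w \<in> S. w \<noteq> v \<and> \<not> E v w}" "L \<noteq> {}"
    and p: "p \<notin> S" "p' \<notin> S" "E p p'" "\<And>w. w \<in> S \<Longrightarrow> \<not> E p w \<and> \<not> E p' w"
    and b: "b \<in> S" "b \<noteq> v"
    and null: "homotopic_with (\<lambda>_. True) (ind_space L E) (ind_space (S - {v}) E) (\<lambda>x. x) (\<lambda>_. vertex_point b)"
    and dl: "pointed_equiv (ind_space (S - {v}) E) (vertex_point b) (sphere_wedge ds) None"
    and lk: "pointed_equiv (ind_space (insert p (insert p' L)) E) (vertex_point p) (sphere_wedge es) None"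
  shows "pointed_equiv (ind_space S E) (vertex_point b) (sphere_wedge (ds @ es)) None"
proof -
  have GS: "fin_graph S E" and GL: "fin_graph (insert p (insert p' L)) E"
    by (rule fin_graph_mono[OF G]; auto simp: L)+
  have fA: "finite (S - {v})" and irr: "\<not> E b b" using GS by (auto simp: fin_graph_def)
  let ?A = "ind_space (S - {v}) E"
  have bA: "vertex_point b \<in> topspace ?A"
    using b fA irr by (intro vertex_point_in_ind_space) auto
  have "pointed_equiv (ind_space S E) (vertex_point b)
      (pointed_wedge ?A (vertex_point b) (ind_space (insert p (insert p' L)) E) (vertex_point p))
      (vertex_point b, vertex_point p)"
  proof (rule pointed_equiv_cone_attachment[OF cone_attachment_vertex[OF GS v L] _ null bA])
    show "cone_attachment (pointed_wedge ?A (vertex_point b) (ind_space (insert p (insert p' L)) E) (vertex_point p)) ?A (ind_space L E)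
           (\<lambda>_. vertex_point b) (\<lambda>x. (x, vertex_point p))
           (\<lambda>(t, y). (vertex_point b, \<lambda>w. if w = p then max 0 (1 - 2 * t) else if w = p' then max 0 (2 * t - 1)
                              else (1 - \<bar>2 * t - 1\<bar>) * y w))"
      by (rule cone_attachment_suspension[OF GL])
        (use p L bA compact_ind_space[OF fA] Hausdorff_ind_space in auto)
  qed
  from pointed_equiv_trans[OF this pointed_equiv_wedge_of_spheres[OF dl lk]] show ?thesis .
qed

section \<open>Relabelling, path connectedness and combinatorial null-homotopies\<close>

lemma push_forward_compose:
  assumes "finite U" "finite V" "\<And>u. u \<in> U \<Longrightarrow> g u \<in> V"
  shows "push_forward V k (push_forward U g x) = push_forward U (\<lambda>u. k (g u)) x"
proof
  fix z
  have "push_forward V k (push_forward U g x) z = (\<Sum>w\<in>V. \<Sum>u\<in>U. if g u = w then (if k w = z then x u else 0) else 0)"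
    unfolding push_forward_def by (intro sum.cong) (auto intro!: sum.cong simp: sum.neutral)
  also have "\<dots> = (\<Sum>u\<in>U. \<Sum>w\<in>V. if g u = w then (if k w = z then x u else 0) else 0)"
    by (rule sum.swap)
  also have "\<dots> = push_forward U (\<lambda>u. k (g u)) x z"
    unfolding push_forward_def using assms by (intro sum.cong) (auto simp: sum.delta)
  finally show "push_forward V k (push_forward U g x) z = push_forward U (\<lambda>u. k (g u)) x z" .
qed

lemma pointed_equiv_relabel:
  assumes S: "finite S" and f: "bij_betw f S T"
    and EF: "\<And>u v. u \<in> S \<Longrightarrow> v \<in> S \<Longrightarrow> E u v \<longleftrightarrow> F (f u) (f v)" and p: "p \<in> S" "\<not> E p p"
  shows "pointed_equiv (ind_space S E) (vertex_point p) (ind_space T F) (vertex_point (f p))"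
proof (rule pointed_equiv_homeomorphic)
  have T: "finite T" and im: "f ` S = T" and inj: "inj_on f S"
    using S f by (auto simp: bij_betw_def)
  define h where "h = inv_into S f"
  have h: "h w \<in> S" "f (h w) = w" if "w \<in> T" for w
    using that im by (auto simp: h_def inv_into_into f_inv_into_f)
  have hf: "h (f u) = u" if "u \<in> S" for u using that inj by (simp add: h_def)
  have fT: "f u \<in> T" if "u \<in> S" for u using that im by blast
  have 1: "continuous_map (ind_space S E) (ind_space T F) (push_forward S f)"
    by (rule continuous_map_push_forward[OF S T fT]) (use EF in auto)
  have 2: "continuous_map (ind_space T F) (ind_space S E) (push_forward T h)"
    by (rule continuous_map_push_forward[OF T S h(1)]) (use EF h in auto)
  have 3: "push_forward T h (push_forward S f x) = x" if "x \<in> topspace (ind_space S E)" for x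
  proof -
    have "push_forward S (\<lambda>u. h (f u)) x = x"
      by (rule push_forward_id[OF S]) (use that hf in \<open>auto simp: topspace_ind_space[OF S]\<close>)
    then show ?thesis using push_forward_compose[where k = h, OF S T fT] by simp
  qed
  have 4: "push_forward S f (push_forward T h x) = x" if "x \<in> topspace (ind_space T F)" for x
  proof -
    have "push_forward T (\<lambda>u. f (h u)) x = x"
      by (rule push_forward_id[OF T]) (use that h in \<open>auto simp: topspace_ind_space[OF T]\<close>)
    then show ?thesis using push_forward_compose[where k = f, OF T S h(1)] by simp
  qed
  show "homeomorphic_maps (ind_space S E) (ind_space T F) (push_forward S f) (push_forward T h)"
    unfolding homeomorphic_maps_def using 1 2 3 4 by blast
  show "vertex_point p \<in> topspace (ind_space S E)" using S p by (rule vertex_point_in_ind_space)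
  show "push_forward S f (vertex_point p) = vertex_point (f p)" using S p(1) by (rule push_forward_vertex_point)
qed

text \<open>The complement graph is the 1-skeleton of the independence complex, so this is path
  connectedness in combinatorial form. It holds vacuously for the empty complex.\<close>

definition connected_complement :: "'v set \<Rightarrow> ('v \<Rightarrow> 'v \<Rightarrow> bool) \<Rightarrow> bool" where
  "connected_complement S E \<longleftrightarrow> (\<forall>u\<in>S. \<forall>v\<in>S. (u, v) \<in> {(x, y). x \<in> S \<and> y \<in> S \<and> \<not> E x y}\<^sup>*)"

lemma path_component_ind_space:
  assumes G: "fin_graph S E" and x: "x \<in> topspace (ind_space S E)" and y: "y \<in> topspace (ind_space S E)"
    and xy: "\<And>u v. x u \<noteq> 0 \<Longrightarrow> y v \<noteq> 0 \<Longrightarrow> \<not> E u v"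
  shows "path_component_of (ind_space S E) x y"
proof -
  have "homotopic_with (\<lambda>_. True) (ind_space S E) (ind_space S E) (\<lambda>_. x) (\<lambda>_. y)"
    by (rule ind_space_linear_homotopy) (use G x y xy in \<open>auto simp: fin_graph_def\<close>)
  then show ?thesis using x by (auto simp: homotopic_constant_maps)
qed

text \<open>A segment joins each point to a vertex of its support, and vertices are joined along the
  complement graph.\<close>

lemma path_connected_ind_space:
  assumes G: "fin_graph S E" and c: "connected_complement S E"
  shows "path_connected_space (ind_space S E)"
proof -
  have S: "finite S" and E: "\<And>u v. E u v \<Longrightarrow> E v u" and irr: "\<And>u. \<not> E u u"
    using G by (auto simp: fin_graph_def)
  let ?X = "ind_space S E"
  have v: "vertex_point u \<in> topspace ?X" if "u \<in> S" for u
    using S that irr by (rule vertex_point_in_ind_space)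
  have path: "path_component_of ?X (vertex_point u) (vertex_point w)"
    if "(u, w) \<in> {(x, y). x \<in> S \<and> y \<in> S \<and> \<not> E x y}\<^sup>*" "u \<in> S" for u w
    using that
  proof (induction rule: rtrancl_induct)
    case base
    then show ?case using v by (simp add: path_component_of_refl)
  next
    case (step y z)
    have "path_component_of ?X (vertex_point y) (vertex_point z)"
      by (rule path_component_ind_space[OF G]) (use step v E in \<open>auto simp: vertex_point_def split: if_splits\<close>)
    then show ?case using step path_component_of_trans by metis
  qed
  have ex: "\<exists>u\<in>S. path_component_of ?X x (vertex_point u)" if x: "x \<in> topspace ?X" for x
  proof -
    have X: "\<And>w. x w \<noteq> 0 \<Longrightarrow> w \<in> S" "\<And>u w. x u \<noteq> 0 \<Longrightarrow> x w \<noteq> 0 \<Longrightarrow> \<not> E u w" "sum x S = 1"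
      using x unfolding topspace_ind_space[OF S] by blast+
    obtain u where u: "u \<in> S" "x u \<noteq> 0" using X(3) by (metis sum.neutral zero_neq_one)
    have "path_component_of ?X x (vertex_point u)"
      by (rule path_component_ind_space[OF G x v[OF u(1)]]) (use X u in \<open>auto simp: vertex_point_def split: if_splits\<close>)
    then show ?thesis using u by blast
  qed
  show ?thesis
    unfolding path_connected_space_iff_path_component
  proof (intro ballI)
    fix x y assume "x \<in> topspace ?X" "y \<in> topspace ?X"
    then obtain u w where u: "u \<in> S" "path_component_of ?X x (vertex_point u)"
      and w: "w \<in> S" "path_component_of ?X y (vertex_point w)" using ex by meson
    have "path_component_of ?X (vertex_point u) (vertex_point w)"
      using path u(1) w(1) c by (auto simp: connected_complement_def)
    then show "path_component_of ?X x y"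
      using u w by (meson path_component_of_sym path_component_of_trans)
  qed
qed

text \<open>A null-homotopy of the simplicial map \<open>\<phi>\<close> in contiguous steps, each changing
  the image of a single vertex, until the image lies in the star of a vertex \<open>u\<close>.\<close>

inductive null_chain :: "'v set \<Rightarrow> 'v set \<Rightarrow> ('v \<Rightarrow> 'v \<Rightarrow> bool) \<Rightarrow> ('v \<Rightarrow> 'v) \<Rightarrow> bool"
  for L A E where
  null_chain_cone: "u \<in> A \<Longrightarrow> (\<And>y. y \<in> L \<Longrightarrow> \<not> E u (\<phi> y)) \<Longrightarrow> null_chain L A E \<phi>"
| null_chain_move: "w \<in> L \<Longrightarrow> w' \<in> A \<Longrightarrow> \<not> E (\<phi> w) w' \<Longrightarrow>
    (\<And>y. y \<in> L \<Longrightarrow> y \<noteq> w \<Longrightarrow> \<not> E w y \<Longrightarrow> \<not> E w' (\<phi> y)) \<Longrightarrow>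
    null_chain L A E (\<phi>(w := w')) \<Longrightarrow> null_chain L A E \<phi>"

text \<open>A move is a contiguity: the new image \<open>w'\<close> is compatible with the old image
  of \<open>w\<close> and with the images of all vertices compatible with \<open>w\<close>. In the
  final position everything contracts to \<open>u\<close>, and a path in the connected target
  carries \<open>u\<close> to \<open>b\<close>.\<close>

lemma null_chain_homotopic:
  assumes "null_chain L A E \<phi>" "finite L" "fin_graph A E" "connected_complement A E" "b \<in> A"
    "\<And>u. u \<in> L \<Longrightarrow> \<phi> u \<in> A" "\<And>u v. u \<in> L \<Longrightarrow> v \<in> L \<Longrightarrow> \<not> E u v \<Longrightarrow> \<not> E (\<phi> u) (\<phi> v)"
  shows "homotopic_with (\<lambda>_. True) (ind_space L E) (ind_space A E) (push_forward L \<phi>) (\<lambda>_. vertex_point b)"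
  using assms
proof (induction rule: null_chain.induct)
  case (null_chain_cone u \<phi>)
  have A: "finite A" and E: "\<And>u v. E u v \<Longrightarrow> E v u" and irr: "\<And>u. \<not> E u u"
    using null_chain_cone.prems(2) by (auto simp: fin_graph_def)
  have "homotopic_with (\<lambda>_. True) (ind_space L E) (ind_space A E) (push_forward L \<phi>) (push_forward L (\<lambda>_. u))"
    by (rule ind_space_contiguous) (use null_chain_cone A irr in \<open>auto intro: E\<close>)
  then have 1: "homotopic_with (\<lambda>_. True) (ind_space L E) (ind_space A E) (push_forward L \<phi>) (\<lambda>_. vertex_point u)"
    by (rule homotopic_with_eq) (use null_chain_cone.prems(1) in \<open>auto simp: push_forward_const[of L _ E]\<close>)
  have "path_component_of (ind_space A E) (vertex_point u) (vertex_point b)"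
    using path_connected_ind_space[OF null_chain_cone.prems(2,3)] null_chain_cone A irr vertex_point_in_ind_space
    unfolding path_connected_space_iff_path_component by metis
  then have "homotopic_with (\<lambda>_. True) (ind_space L E) (ind_space A E) (\<lambda>_. vertex_point u) (\<lambda>_. vertex_point b)"
    by (simp add: homotopic_constant_maps)
  with 1 show ?case by (rule homotopic_with_trans)
next
  case (null_chain_move w w' \<phi>)
  have A: "finite A" and E: "\<And>u v. E u v \<Longrightarrow> E v u" and irr: "\<And>u. \<not> E u u"
    using null_chain_move.prems(2) by (auto simp: fin_graph_def)
  have new: "\<not> E ((\<phi>(w := w')) u) ((\<phi>(w := w')) v)" "\<not> E (\<phi> u) ((\<phi>(w := w')) v)"
    if "u \<in> L" "v \<in> L" "\<not> E u v" for u v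
  proof -
    have "\<not> E v u" using that(3) E by blast
    then show "\<not> E ((\<phi>(w := w')) u) ((\<phi>(w := w')) v)" "\<not> E (\<phi> u) ((\<phi>(w := w')) v)"
      using null_chain_move.hyps(3,4) null_chain_move.prems(6)[OF that] that irr E by (metis fun_upd_apply)+
  qed
  have "homotopic_with (\<lambda>_. True) (ind_space L E) (ind_space A E) (push_forward L \<phi>) (push_forward L (\<phi>(w := w')))"
    by (rule ind_space_contiguous) (use null_chain_move.prems null_chain_move.hyps(2) A new in \<open>auto intro: E\<close>)
  moreover have "homotopic_with (\<lambda>_. True) (ind_space L E) (ind_space A E) (push_forward L (\<phi>(w := w'))) (\<lambda>_. vertex_point b)"
    by (rule null_chain_move.IH) (use null_chain_move.prems null_chain_move.hyps(2) new in auto)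
  ultimately show ?case by (rule homotopic_with_trans)
qed

text \<open>A checkable witness for contractibility: in the complement graph \<open>v\<close> is
  dominated by \<open>u\<close>, and dominated vertices are removed until the rest is a cone with
  apex \<open>u\<close>.\<close>

inductive foldable :: "('v \<Rightarrow> 'v \<Rightarrow> bool) \<Rightarrow> 'v set \<Rightarrow> bool" for E where
  foldable_isolated: "u \<in> S \<Longrightarrow> (\<And>w. w \<in> S \<Longrightarrow> \<not> E u w) \<Longrightarrow> foldable E S"
| foldable_fold: "u \<in> S \<Longrightarrow> v \<in> S \<Longrightarrow> u \<noteq> v \<Longrightarrow> (\<And>w. w \<in> S \<Longrightarrow> E u w \<Longrightarrow> E v w) \<Longrightarrow>
    foldable E (S - {v}) \<Longrightarrow> foldable E S"

lemma foldable_nonempty: "foldable E S \<Longrightarrow> S \<noteq> {}"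
  by (auto elim: foldable.cases)

text \<open>The vertices of \<open>P\<close> are compatible with all of \<open>S\<close>, so they do
  not disturb the folds, and a base point in \<open>P\<close> is never deleted. Taking an edge for
  \<open>P\<close> gives the suspended link with its base point on that edge.\<close>

lemma foldable_pointed_equiv:
  assumes "foldable E S" "fin_graph (S \<union> P) E" "P \<inter> S = {}" "\<And>p s. p \<in> P \<Longrightarrow> s \<in> S \<Longrightarrow> \<not> E s p" "p \<in> P"
  shows "pointed_equiv (ind_space (S \<union> P) E) (vertex_point p) (sphere_wedge []) None"
  using assms
proof (induction rule: foldable.induct)
  case (foldable_isolated u S)
  then show ?case by (intro pointed_equiv_isolated_vertex[of _ _ u]) auto
next
  case (foldable_fold u S v)
  have eq: "S \<union> P - {v} = (S - {v}) \<union> P" using foldable_fold by blast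
  have "pointed_equiv (ind_space (S \<union> P) E) (vertex_point p) (ind_space (S \<union> P - {v}) E) (vertex_point p)"
    by (rule pointed_equiv_fold[OF foldable_fold.prems(1), of u]) (use foldable_fold in auto)
  moreover have "pointed_equiv (ind_space (S - {v} \<union> P) E) (vertex_point p) (sphere_wedge []) None"
    by (rule foldable_fold.IH)
      (use foldable_fold.prems in \<open>auto intro: fin_graph_mono\<close>)
  ultimately show ?case unfolding eq by (rule pointed_equiv_trans)
qed

lemma foldable_contractible:
  assumes "foldable E S" "fin_graph S E"
  shows "contractible_space (ind_space S E)"
  using assms
proof (induction rule: foldable.induct)
  case (foldable_isolated u S)
  have "ind_space S E homotopy_equivalent_space sphere_wedge []"
    by (rule pointed_equiv_imp_homotopy_equivalent, rule pointed_equiv_isolated_vertex[of _ _ u u]) (use foldable_isolated in auto)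
  moreover have "topspace (sphere_wedge []) = {None}"
    by (simp add: sphere_wedge_def topspace_wedge_topology wedge_carrier_def)
  then have "contractible_space (sphere_wedge [])" by (simp add: contractible_space_subset_singleton)
  ultimately show ?case by (simp add: homotopy_equivalent_space_contractibility)
next
  case (foldable_fold u S v)
  have "ind_space S E homotopy_equivalent_space ind_space (S - {v}) E"
    by (rule pointed_equiv_imp_homotopy_equivalent, rule pointed_equiv_fold[of _ _ u _ u]) (use foldable_fold in auto)
  moreover have "contractible_space (ind_space (S - {v}) E)"
    by (rule foldable_fold.IH) (use foldable_fold.prems in \<open>auto intro: fin_graph_mono\<close>)
  ultimately show ?case by (simp add: homotopy_equivalent_space_contractibility)
qed

lemma pointed_equiv_wedge_contractible:
  assumes "pointed_equiv Y y (sphere_wedge []) None" "a \<in> topspace A"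
  shows "pointed_equiv (pointed_wedge A a Y y) (a, y) A a"
proof -
  let ?N = "sphere_wedge []"
  have top: "topspace ?N = {None}"
    by (simp add: sphere_wedge_def topspace_wedge_topology wedge_carrier_def)
  have "homeomorphic_maps (pointed_wedge A a ?N None) A fst (\<lambda>x. (x, None))"
    unfolding homeomorphic_maps_def
  proof (intro conjI ballI)
    show "continuous_map (pointed_wedge A a ?N None) A fst"
      by (simp add: pointed_wedge_def continuous_map_from_subtopology continuous_map_fst)
    show "continuous_map A (pointed_wedge A a ?N None) (\<lambda>x. (x, None))"
      unfolding pointed_wedge_def continuous_map_in_subtopology
      by (auto simp: top intro!: continuous_map_pairedI)
  qed (auto simp: topspace_pointed_wedge top)
  then have "pointed_equiv (pointed_wedge A a ?N None) (a, None) A a"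
    by (rule pointed_equiv_homeomorphic) (use assms(2) in \<open>auto simp: topspace_pointed_wedge top\<close>)
  with pointed_equiv_wedge[OF pointed_equiv_refl[OF assms(2)] assms(1)] show ?thesis
    by (rule pointed_equiv_trans)
qed

text \<open>A contractible link makes the splitting trivial: its inclusion is null-homotopic, and
  its suspension contributes only a contractible wedge summand.\<close>

lemma pointed_equiv_delete_vertex:
  assumes G: "fin_graph (insert p (insert p' S)) E" and v: "v \<in> S"
    and L: "L = {w \<in> S. w \<noteq> v \<and> \<not> E v w}" "foldable E L"
    and p: "p \<notin> S" "p' \<notin> S" "E p p'" "\<And>w. w \<in> S \<Longrightarrow> \<not> E p w \<and> \<not> E p' w"
    and b: "b \<in> S" "b \<noteq> v" and c: "connected_complement (S - {v}) E"
  shows "pointed_equiv (ind_space S E) (vertex_point b) (ind_space (S - {v}) E) (vertex_point b)"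
proof -
  have GS: "fin_graph S E" and GL: "fin_graph (L \<union> {p, p'}) E" and GA: "fin_graph (S - {v}) E" and GL': "fin_graph L E"
    by (rule fin_graph_mono[OF G]; auto simp: L)+
  have E: "\<And>u v. E u v \<Longrightarrow> E v u" using G by (auto simp: fin_graph_def)
  have fA: "finite (S - {v})" and irr: "\<not> E b b" using GS by (auto simp: fin_graph_def)
  let ?A = "ind_space (S - {v}) E"
  have bA: "vertex_point b \<in> topspace ?A"
    using b fA irr by (intro vertex_point_in_ind_space) auto
  have LA: "continuous_map (ind_space L E) ?A (\<lambda>x. x)"
    by (rule continuous_map_ind_space_inclusion[OF fA]) (auto simp: L)
  obtain z where z: "homotopic_with (\<lambda>_. True) (ind_space L E) ?A (\<lambda>x. x) (\<lambda>_. z)"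
    using nullhomotopic_from_contractible_space[OF LA foldable_contractible[OF L(2) GL']] by auto
  \<comment> \<open>Contractibility yields a null-homotopy with some end point \<open>z\<close>;
    connectedness of the deletion moves it to the base point \<open>b\<close>.\<close>
  have "homotopic_with (\<lambda>_. True) (ind_space L E) ?A (\<lambda>_. z) (\<lambda>_. vertex_point b)"
  proof (cases "topspace (ind_space L E) = {}")
    case True
    then show ?thesis by (intro homotopic_with_equal) (use bA in auto)
  next
    case False
    then have "z \<in> topspace ?A" using homotopic_with_imp_continuous_maps[OF z] by auto
    then show ?thesis
      using path_connected_ind_space[OF GA c] bA
      by (simp add: homotopic_constant_maps path_connected_space_iff_path_component)
  qed
  with z have null: "homotopic_with (\<lambda>_. True) (ind_space L E) ?A (\<lambda>x. x) (\<lambda>_. vertex_point b)"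
    by (rule homotopic_with_trans)
  have Leq: "insert p (insert p' L) = L \<union> {p, p'}" by auto
  have "pointed_equiv (ind_space S E) (vertex_point b)
      (pointed_wedge ?A (vertex_point b) (ind_space (insert p (insert p' L)) E) (vertex_point p))
      (vertex_point b, vertex_point p)"
  proof (rule pointed_equiv_cone_attachment[OF cone_attachment_vertex[OF GS v L(1) foldable_nonempty[OF L(2)]] _ null bA])
    show "cone_attachment (pointed_wedge ?A (vertex_point b) (ind_space (insert p (insert p' L)) E) (vertex_point p)) ?A (ind_space L E)
           (\<lambda>_. vertex_point b) (\<lambda>x. (x, vertex_point p))
           (\<lambda>(t, y). (vertex_point b, \<lambda>w. if w = p then max 0 (1 - 2 * t) else if w = p' then max 0 (2 * t - 1)
                              else (1 - \<bar>2 * t - 1\<bar>) * y w))"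
      by (rule cone_attachment_suspension)
        (use GL[folded Leq] p L foldable_nonempty[OF L(2)] bA compact_ind_space[OF fA] Hausdorff_ind_space in auto)
  qed
  moreover have "pointed_equiv (ind_space (insert p (insert p' L)) E) (vertex_point p) (sphere_wedge []) None"
    unfolding Leq
    by (rule foldable_pointed_equiv[OF L(2) GL]) (use p L(1) E in auto)
  ultimately show ?thesis
    using pointed_equiv_trans pointed_equiv_wedge_contractible bA by metis
qed

text \<open>The independent sets of \<open>d + 1\<close> disjoint edges form the boundary of a
  cross-polytope. The differences \<open>?D\<close> are signed coordinates of 1-norm one, which
  radial projection carries to the unit sphere; backwards, a coordinate is split into its positive
  and negative parts and divided by the 1-norm.\<close>

lemma pointed_equiv_cross_polytope:
  "pointed_equiv (ind_space ({..d} \<times> UNIV) (\<lambda>(k, s) (k', s'). k = k' \<and> s \<noteq> s')) (vertex_point (0::nat, True))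
     (sphere_wedge [d]) None"
proof -
  let ?S = "{..d} \<times> (UNIV :: bool set)" and ?E = "\<lambda>(k, s) (k', s'). k = k' \<and> (s::bool) \<noteq> s'"
  let ?X = "ind_space ?S ?E"
  have S: "finite ?S" by simp
  let ?D = "\<lambda>x k. x (k, True) - x (k, False) :: real"
  let ?f = "\<lambda>x k. if k \<le> d then ?D x k / sqrt (\<Sum>i\<le>d. (?D x i)\<^sup>2) else 0"
  let ?n = "\<lambda>y. \<Sum>i\<le>d. \<bar>y i\<bar> :: real"
  let ?g = "\<lambda>y (k, s). if k \<le> d then (if s then max 0 (y k) else max 0 (- y k)) / ?n y else 0"
  have sumS: "sum x ?S = (\<Sum>k\<le>d. x (k, True) + x (k, False))" for x :: "nat \<times> bool \<Rightarrow> real"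
  proof -
    have "sum x ?S = (\<Sum>k\<le>d. \<Sum>s\<in>UNIV. x (k, s))" by (simp add: sum.cartesian_product)
    then show ?thesis by (simp add: UNIV_bool add.commute)
  qed
  have X: "\<And>w. 0 \<le> x w" "\<And>k s. x (k, s) \<noteq> 0 \<Longrightarrow> k \<le> d" "\<And>k. x (k, True) = 0 \<or> x (k, False) = 0"
      "(\<Sum>k\<le>d. \<bar>?D x k\<bar>) = 1" "(\<Sum>i\<le>d. (?D x i)\<^sup>2) > 0"
    if "x \<in> topspace ?X" for x
  proof -
    have x: "\<And>w. 0 \<le> x w" "\<And>w. x w \<noteq> 0 \<Longrightarrow> w \<in> ?S" "\<And>u w. x u \<noteq> 0 \<Longrightarrow> x w \<noteq> 0 \<Longrightarrow> \<not> ?E u w" "sum x ?S = 1"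
      using that unfolding topspace_ind_space[OF S] by blast+
    show "\<And>w. 0 \<le> x w" by (rule x(1))
    show "\<And>k s. x (k, s) \<noteq> 0 \<Longrightarrow> k \<le> d" using x(2) by auto
    show z: "x (k, True) = 0 \<or> x (k, False) = 0" for k using x(3)[of "(k, True)" "(k, False)"] by auto
    have "\<bar>?D x k\<bar> = x (k, True) + x (k, False)" for k using z[of k] x(1) by auto
    then show n: "(\<Sum>k\<le>d. \<bar>?D x k\<bar>) = 1" using x(4) sumS by simp
    have "\<exists>k\<le>d. ?D x k \<noteq> 0"
    proof (rule ccontr)
      assume "\<not> ?thesis"
      then have "(\<Sum>k\<le>d. \<bar>?D x k\<bar>) = 0" by simp
      with n show False by simp
    qed
    then obtain k where "k \<le> d" "?D x k \<noteq> 0" by blast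
    then show "(\<Sum>i\<le>d. (?D x i)\<^sup>2) > 0" by (intro sum_pos2[of _ k]) auto
  qed
  have Y: "(\<Sum>i\<le>d. (y i)\<^sup>2) = 1" "\<And>i. i > d \<Longrightarrow> y i = 0" "?n y > 0" if "y \<in> topspace (nsphere d)" for y
  proof -
    show s: "(\<Sum>i\<le>d. (y i)\<^sup>2) = 1" "\<And>i. i > d \<Longrightarrow> y i = 0" using that by (auto simp: nsphere)
    have "\<exists>k\<le>d. y k \<noteq> 0"
    proof (rule ccontr)
      assume "\<not> ?thesis"
      then have "(\<Sum>i\<le>d. (y i)\<^sup>2) = 0" by simp
      with s show False by simp
    qed
    then obtain k where "k \<le> d" "y k \<noteq> 0" by blast
    then show "?n y > 0" by (intro sum_pos2[of _ k]) auto
  qed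
  have fmem: "?f x \<in> topspace (nsphere d)" if "x \<in> topspace ?X" for x
  proof -
    have "(\<Sum>k\<le>d. (?f x k)\<^sup>2) = (\<Sum>k\<le>d. (?D x k)\<^sup>2 / (\<Sum>i\<le>d. (?D x i)\<^sup>2))"
      using X(5)[OF that] by (intro sum.cong) (auto simp: power_divide)
    also have "\<dots> = 1" using X(5)[OF that] by (simp flip: sum_divide_distrib)
    finally show ?thesis by (simp add: nsphere)
  qed
  have gmem: "?g y \<in> topspace ?X" if "y \<in> topspace (nsphere d)" for y
    unfolding topspace_ind_space[OF S]
  proof (intro conjI allI impI)
    show "0 \<le> ?g y w" for w using Y(3)[OF that] by (cases w) auto
    show "w \<in> ?S" if "?g y w \<noteq> 0" for w using that by (cases w) (auto split: if_splits)
    show "\<not> ?E u w" if "?g y u \<noteq> 0" "?g y w \<noteq> 0" for u w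
      using that by (cases u; cases w) (auto split: if_splits)
    have "sum (?g y) ?S = (\<Sum>k\<le>d. \<bar>y k\<bar> / ?n y)"
      unfolding sumS by (intro sum.cong) (auto simp flip: add_divide_distrib)
    also have "\<dots> = 1" using Y(3)[OF that] by (simp flip: sum_divide_distrib)
    finally show "sum (?g y) ?S = 1" .
  qed
  have contD: "continuous_map ?X euclideanreal (\<lambda>x. ?D x k)" for k
    by (intro continuous_map_diff continuous_map_ind_space_component)
  have "continuous_map ?X euclideanreal (\<lambda>x. ?f x k)" for k
  proof (cases "k \<le> d")
    case True
    have "continuous_map ?X euclideanreal (\<lambda>x. sqrt (\<Sum>i\<le>d. (?D x i)\<^sup>2))"
      by (intro continuous_map_compose[OF _ continuous_map_square_root, unfolded o_def]
          continuous_map_sum continuous_map_real_pow contD) simp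
    then have "continuous_map ?X euclideanreal (\<lambda>x. ?D x k / sqrt (\<Sum>i\<le>d. (?D x i)\<^sup>2))"
      by (intro continuous_map_real_divide contD) (use X(5) in force)+
    then show ?thesis using True by simp
  qed simp
  then have contf: "continuous_map ?X (nsphere d) ?f"
    using fmem unfolding nsphere continuous_map_in_subtopology continuous_map_componentwise_UNIV
    by (auto simp: topspace_subtopology)
  have contg: "continuous_map (nsphere d) ?X ?g"
  proof (rule continuous_map_into_ind_space)
    show "continuous_map (nsphere d) euclideanreal (\<lambda>y. ?g y w)" for w
    proof -
      obtain k s where w: "w = (k, s)" by (cases w)
      have c: "continuous_map (nsphere d) euclideanreal (\<lambda>y. y i)" for i
        by (rule continuous_map_nsphere_projection)
      have "continuous_map (nsphere d) euclideanreal (\<lambda>y. (if s then max 0 (y k) else max 0 (- y k)) / ?n y)"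
      proof (rule continuous_map_real_divide)
        show "continuous_map (nsphere d) euclideanreal (\<lambda>y. if s then max 0 (y k) else max 0 (- y k))"
          by (cases s) (simp_all add: continuous_map_real_max c)
        show "continuous_map (nsphere d) euclideanreal ?n"
          by (intro continuous_map_sum continuous_map_real_abs c) simp
      qed (use Y(3) in force)
      then show ?thesis using w by simp
    qed
  qed (rule gmem)
  have gf: "?g (?f x) = x" if x: "x \<in> topspace ?X" for x
  proof
    fix w :: "nat \<times> bool"
    obtain k s where w: "w = (k, s)" by (cases w)
    let ?N = "sqrt (\<Sum>i\<le>d. (?D x i)\<^sup>2)"
    have N: "?N > 0" using X(5)[OF x] by simp
    have "?n (?f x) = (\<Sum>k\<le>d. \<bar>?D x k\<bar> / ?N)"
      using N by (intro sum.cong) (auto simp: abs_divide)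
    also have "\<dots> = 1 / ?N" using X(4)[OF x] by (simp flip: sum_divide_distrib)
    finally have n: "?n (?f x) = 1 / ?N" .
    show "?g (?f x) w = x w"
    proof (cases "k \<le> d")
      case True
      have m: "max 0 (r / ?N) = max 0 r / ?N" for r using N by (auto simp: max_def divide_le_0_iff zero_le_divide_iff)
      have "?g (?f x) w = (if s then max 0 (?D x k) else max 0 (- ?D x k))"
      proof -
        have "max 0 (- (r / ?N)) = max 0 (- r) / ?N" for r using m[of "- r"] by simp
        from this[of "?D x k"] have "max 0 (- (?D x k / ?N)) = max 0 (- ?D x k) / ?N" .
        then show ?thesis unfolding w prod.case n using True N m[of "?D x k"] by (cases s) simp_all
      qed
      also have "\<dots> = x w" using X(3)[OF x, of k] X(1)[OF x] w by (cases s) auto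
      finally show ?thesis .
    next
      case False
      then show ?thesis using X(2)[OF x, of k s] w by auto
    qed
  qed
  have fg: "?f (?g y) = y" if y: "y \<in> topspace (nsphere d)" for y
  proof
    fix k
    have n: "?n y > 0" by (rule Y(3)[OF y])
    have D: "?D (?g y) i = (if i \<le> d then y i / ?n y else 0)" for i
      by (auto simp: max_def)
    have "(\<Sum>i\<le>d. (?D (?g y) i)\<^sup>2) = (\<Sum>i\<le>d. (y i)\<^sup>2 / (?n y)\<^sup>2)"
      unfolding D by (intro sum.cong) (auto simp: power_divide)
    also have "\<dots> = 1 / (?n y)\<^sup>2" using Y(1)[OF y] by (simp flip: sum_divide_distrib)
    finally have "sqrt (\<Sum>i\<le>d. (?D (?g y) i)\<^sup>2) = 1 / ?n y"
      using n by (simp add: real_sqrt_divide)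
    then show "?f (?g y) k = y k"
      unfolding D using n Y(2)[OF y, of k] by auto
  qed
  have h: "homeomorphic_maps ?X (nsphere d) ?f ?g"
    unfolding homeomorphic_maps_def using contf contg gf fg by blast
  have v: "vertex_point (0, True) \<in> topspace ?X"
    by (rule vertex_point_in_ind_space) auto
  have b: "?f (vertex_point (0, True)) = sphere_basepoint"
  proof -
    have D: "?D (vertex_point (0, True)) k = sphere_basepoint k" for k
      by (auto simp: vertex_point_def sphere_basepoint_def)
    have "(\<Sum>i\<le>d. (sphere_basepoint i)\<^sup>2) = 1" "\<And>i. i > d \<Longrightarrow> sphere_basepoint i = 0"
      using sphere_basepoint_in_nsphere[of d] by (auto simp: nsphere simp del: sphere_basepoint_in_nsphere)
    then show ?thesis unfolding D by (auto simp: fun_eq_iff)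
  qed
  have "pointed_equiv ?X (vertex_point (0, True)) (nsphere d) sphere_basepoint"
    by (rule pointed_equiv_homeomorphic[OF h v]) (rule b)
  then show ?thesis using pointed_equiv_sphere_wedge_single by (rule pointed_equiv_trans)
qed

section \<open>Iterated suspensions\<close>

text \<open>Adding \<open>m\<close> disjoint edges to a graph suspends its independence complex
  \<open>m\<close> times.\<close>

definition susp_verts :: "nat \<Rightarrow> 'v set \<Rightarrow> ('v + nat \<times> bool) set" where
  "susp_verts m S = Inl ` S \<union> Inr ` ({..<m} \<times> UNIV)"

definition susp_adj :: "('v \<Rightarrow> 'v \<Rightarrow> bool) \<Rightarrow> 'v + nat \<times> bool \<Rightarrow> 'v + nat \<times> bool \<Rightarrow> bool" where
  "susp_adj E x y = (case (x, y) of (Inl u, Inl v) \<Rightarrow> E u v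
     | (Inr (k, s), Inr (k', s')) \<Rightarrow> k = k' \<and> s \<noteq> s' | _ \<Rightarrow> False)"

lemma susp_adj_simps [simp]:
  "susp_adj E (Inl u) (Inl v) = E u v"
  "susp_adj E (Inl u) (Inr p) = False"
  "susp_adj E (Inr p) (Inl u) = False"
  "susp_adj E (Inr p) (Inr q) = (fst p = fst q \<and> snd p \<noteq> snd q)"
  by (auto simp: susp_adj_def split: prod.splits)

lemma susp_verts_iff [simp]:
  "Inl u \<in> susp_verts m S \<longleftrightarrow> u \<in> S" "Inr p \<in> susp_verts m S \<longleftrightarrow> fst p < m"
  by (cases p; auto simp: susp_verts_def)+

lemma susp_verts_cases:
  assumes "x \<in> susp_verts m S"
  obtains u where "x = Inl u" "u \<in> S" | k s where "x = Inr (k, s)" "k < m"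
  using assms by (auto simp: susp_verts_def)

lemma fin_graph_susp: "fin_graph S E \<Longrightarrow> fin_graph (susp_verts m S) (susp_adj E)"
  unfolding fin_graph_def
  by (auto simp: susp_verts_def susp_adj_def split: sum.splits prod.splits)

lemma susp_verts_remove: "susp_verts m (S - {v}) = susp_verts m S - {Inl v}"
  by (auto simp: susp_verts_def)

lemma susp_verts_Suc: "susp_verts (Suc m) S = insert (Inr (m, True)) (insert (Inr (m, False)) (susp_verts m S))"
  by (auto simp: susp_verts_def UNIV_bool less_Suc_eq image_iff)

text \<open>The ends of an added edge are non-adjacent to every old vertex, so one suspension of a
  nonempty complex is already connected; only \<open>m = 0\<close> needs a hypothesis on the graph
  itself.\<close>

lemma connected_complement_susp:
  assumes "m \<noteq> 0 \<Longrightarrow> S \<noteq> {}" "m = 0 \<Longrightarrow> connected_complement S E"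
  shows "connected_complement (susp_verts m S) (susp_adj E)"
proof (cases "m = 0")
  case True
  let ?R = "{(x, y). x \<in> S \<and> y \<in> S \<and> \<not> E x y}"
  let ?R' = "{(x, y). x \<in> susp_verts m S \<and> y \<in> susp_verts m S \<and> \<not> susp_adj E x y}"
  have "(Inl u, Inl v) \<in> ?R'\<^sup>*" if "(u, v) \<in> ?R\<^sup>*" for u v
    using that by (induction rule: rtrancl_induct) (auto intro: rtrancl_into_rtrancl)
  then show ?thesis
    using assms(2)[OF True] True by (auto simp: connected_complement_def susp_verts_def)
next
  case False
  let ?R' = "{(x, y). x \<in> susp_verts m S \<and> y \<in> susp_verts m S \<and> \<not> susp_adj E x y}"
  obtain s where s: "s \<in> S" using assms(1)[OF False] by blast
  have 1: "(Inl s, x) \<in> ?R'\<^sup>*" "(x, Inl s) \<in> ?R'\<^sup>*" if "x \<in> susp_verts m S" for x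
  proof -
    have *: "(Inl u, Inr (k, b)) \<in> ?R'" "(Inr (k, b), Inl u) \<in> ?R'" if "u \<in> S" "k < m" for u k b
      using that by auto
    show "(Inl s, x) \<in> ?R'\<^sup>*"
      using that
    proof (cases rule: susp_verts_cases)
      case (1 u)
      have "(Inl s, Inr (0, True)) \<in> ?R'" "(Inr (0, True), x) \<in> ?R'"
        using *[of s 0 True] *[of u 0 True] s False 1 by auto
      then show ?thesis by (rule rtrancl_into_rtrancl[OF r_into_rtrancl])
    qed (use * s in blast)
    show "(x, Inl s) \<in> ?R'\<^sup>*"
      using that
    proof (cases rule: susp_verts_cases)
      case (1 u)
      have "(x, Inr (0, True)) \<in> ?R'" "(Inr (0, True), Inl s) \<in> ?R'"
        using *[of s 0 True] *[of u 0 True] s False 1 by auto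
      then show ?thesis by (rule rtrancl_into_rtrancl[OF r_into_rtrancl])
    qed (use * s in blast)
  qed
  then show ?thesis unfolding connected_complement_def by (meson rtrancl_trans)
qed

lemma foldable_susp:
  assumes "foldable E S"
  shows "foldable (susp_adj E) (susp_verts m S)"
  using assms
proof (induction rule: foldable.induct)
  case (foldable_isolated u S)
  show ?case
  proof (rule foldable.foldable_isolated[of "Inl u"])
    show "\<not> susp_adj E (Inl u) w" if "w \<in> susp_verts m S" for w
      using that by (cases rule: susp_verts_cases) (use foldable_isolated in simp_all)
  qed (use foldable_isolated in simp)
next
  case (foldable_fold u S v)
  show ?case
  proof (rule foldable.foldable_fold[of "Inl u" _ "Inl v"])
    show "susp_adj E (Inl v) w" if "w \<in> susp_verts m S" "susp_adj E (Inl u) w" for w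
      using that by (cases rule: susp_verts_cases) (use foldable_fold.hyps(4) in simp_all)
  qed (use foldable_fold in \<open>simp_all add: susp_verts_remove\<close>)
qed

text \<open>All moves concern old vertices. An added vertex is fixed and compatible with every old
  one, so it obstructs neither a move nor the final cone.\<close>

lemma null_chain_susp:
  assumes "null_chain L A E \<phi>" "\<And>u. u \<in> L \<Longrightarrow> \<psi> (Inl u) = Inl (\<phi> u)" "\<And>p. \<psi> (Inr p) = Inr p"
  shows "null_chain (susp_verts m L) (susp_verts m A) (susp_adj E) \<psi>"
  using assms
proof (induction arbitrary: \<psi> rule: null_chain.induct)
  case (null_chain_cone u \<phi>)
  show ?case
  proof (rule null_chain.null_chain_cone[of "Inl u"])
    show "\<not> susp_adj E (Inl u) (\<psi> y)" if "y \<in> susp_verts m L" for y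
      using that by (cases rule: susp_verts_cases) (use null_chain_cone in simp_all)
  qed (use null_chain_cone in simp)
next
  case (null_chain_move w w' \<phi>)
  have IH: "null_chain (susp_verts m L) (susp_verts m A) (susp_adj E) (\<psi>(Inl w := Inl w'))"
    by (rule null_chain_move.IH) (use null_chain_move.prems in auto)
  have y: "\<not> susp_adj E (Inl w') (\<psi> y)"
    if y: "y \<in> susp_verts m L" "y \<noteq> Inl w" "\<not> susp_adj E (Inl w) y" for y
    using y(1)
  proof (cases rule: susp_verts_cases)
    case (1 u)
    then show ?thesis using y null_chain_move.hyps(4)[of u] null_chain_move.prems(1)[of u] by auto
  qed (use null_chain_move.prems(2) in auto)
  show ?case
    by (rule null_chain.null_chain_move[of "Inl w" _ "Inl w'"])
      (use null_chain_move.hyps null_chain_move.prems y IH in simp_all)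
qed

section \<open>Bouquets\<close>

definition bouquet_at :: "'v set \<Rightarrow> ('v \<Rightarrow> 'v \<Rightarrow> bool) \<Rightarrow> nat \<Rightarrow> 'v + nat \<times> bool \<Rightarrow> bool" where
  "bouquet_at S E m x \<longleftrightarrow> (\<exists>ds. pointed_equiv (ind_space (susp_verts m S) (susp_adj E)) (vertex_point x)
     (sphere_wedge ds) None)"

text \<open>The flag says whether the complex itself or only its suspensions are considered: the
  independence complex may be empty or a 0-sphere. Path connectedness makes the base point
  irrelevant.\<close>

definition bouquet :: "bool \<Rightarrow> 'v set \<Rightarrow> ('v \<Rightarrow> 'v \<Rightarrow> bool) \<Rightarrow> bool" where
  "bouquet b S E \<longleftrightarrow> (\<forall>m. bouquet_at S E (Suc m) (Inr (m, True))) \<and>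
     (b \<longrightarrow> connected_complement S E \<and> (\<exists>x\<in>S. bouquet_at S E 0 (Inl x)))"

section \<open>Reduction rules for bouquets\<close>

lemma bouquet_at_transfer:
  "pointed_equiv (ind_space (susp_verts m S) (susp_adj E)) (vertex_point x)
     (ind_space (susp_verts m' T) (susp_adj F)) (vertex_point y) \<Longrightarrow> bouquet_at T F m' y \<Longrightarrow> bouquet_at S E m x"
  unfolding bouquet_at_def by (blast intro: pointed_equiv_trans)

lemma bouquet_weaken: "bouquet b S E \<Longrightarrow> bouquet False S E"
  by (simp add: bouquet_def)

lemma connected_complement_insert:
  assumes "connected_complement (S - {v}) E" "w \<in> S - {v}" "\<not> E v w" "\<not> E w v"
  shows "connected_complement S E"
proof -
  let ?R = "{(x, y). x \<in> S - {v} \<and> y \<in> S - {v} \<and> \<not> E x y}" and ?R' = "{(x, y). x \<in> S \<and> y \<in> S \<and> \<not> E x y}"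
  have sub: "?R\<^sup>* \<subseteq> ?R'\<^sup>*" by (rule rtrancl_mono) auto
  have 1: "(x, w) \<in> ?R'\<^sup>*" "(w, x) \<in> ?R'\<^sup>*" if "x \<in> S" for x
  proof -
    have "(x, w) \<in> ?R'\<^sup>* \<and> (w, x) \<in> ?R'\<^sup>*"
    proof (cases "x = v")
      case True
      then have "(x, w) \<in> ?R'" "(w, x) \<in> ?R'" using assms that by auto
      then show ?thesis by (auto intro: r_into_rtrancl)
    next
      case False
      then have "(x, w) \<in> ?R\<^sup>*" "(w, x) \<in> ?R\<^sup>*"
        using assms(1,2) that unfolding connected_complement_def by auto
      then show ?thesis using sub by blast
    qed
    then show "(x, w) \<in> ?R'\<^sup>*" "(w, x) \<in> ?R'\<^sup>*" by auto
  qed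
  show ?thesis unfolding connected_complement_def using 1 by (meson rtrancl_trans)
qed

lemma bouquet_fold:
  assumes G: "fin_graph S E" and uv: "u \<in> S" "v \<in> S" "u \<noteq> v"
    and dom: "\<And>w. w \<in> S \<Longrightarrow> E u w \<Longrightarrow> E v w" and B: "bouquet b (S - {v}) E"
  shows "bouquet b S E"
proof -
  have E: "\<And>u v. E u v \<Longrightarrow> E v u" and irr: "\<And>u. \<not> E u u" using G by (auto simp: fin_graph_def)
  have at: "bouquet_at S E m x" if "bouquet_at (S - {v}) E m x" "x \<in> susp_verts m S" "x \<noteq> Inl v" for m x
  proof (rule bouquet_at_transfer[OF _ that(1)])
    show "pointed_equiv (ind_space (susp_verts m S) (susp_adj E)) (vertex_point x)
       (ind_space (susp_verts m (S - {v})) (susp_adj E)) (vertex_point x)"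
      unfolding susp_verts_remove
    proof (rule pointed_equiv_fold[OF fin_graph_susp[OF G]])
      show "susp_adj E (Inl v) w" if "w \<in> susp_verts m S" "susp_adj E (Inl u) w" for w
        using that by (cases rule: susp_verts_cases) (use dom in simp_all)
    qed (use uv that in simp_all)
  qed
  have ne: "\<not> E v u" "\<not> E u v" using dom[OF uv(2)] irr E by blast+
  show ?thesis
    unfolding bouquet_def
  proof (intro conjI allI impI)
    show "bouquet_at S E (Suc m) (Inr (m, True))" for m
      by (rule at) (use B in \<open>simp_all add: bouquet_def\<close>)
    assume b
    then obtain x where x: "x \<in> S - {v}" "bouquet_at (S - {v}) E 0 (Inl x)" and c: "connected_complement (S - {v}) E"
      using B by (auto simp: bouquet_def)
    have "bouquet_at S E 0 (Inl x)" by (rule at[OF x(2)]) (use x in auto)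
    then show "\<exists>x\<in>S. bouquet_at S E 0 (Inl x)" using x by blast
    show "connected_complement S E"
      by (rule connected_complement_insert[OF c, of u]) (use uv ne in auto)
  qed
qed

lemma bouquet_isolated:
  assumes G: "fin_graph S E" and u: "u \<in> S" "\<And>w. w \<in> S \<Longrightarrow> \<not> E u w"
  shows "bouquet b S E"
proof -
  have E: "\<And>u v. E u v \<Longrightarrow> E v u" using G by (auto simp: fin_graph_def)
  have at: "bouquet_at S E m x" if "x \<in> susp_verts m S" for m x
    unfolding bouquet_at_def
  proof (rule exI, rule pointed_equiv_isolated_vertex[OF fin_graph_susp[OF G], of "Inl u"])
    show "\<not> susp_adj E (Inl u) w" if "w \<in> susp_verts m S" for w
      using that by (cases rule: susp_verts_cases) (use u in simp_all)
  qed (use u that in simp_all)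
  let ?R = "{(x, y). x \<in> S \<and> y \<in> S \<and> \<not> E x y}"
  have "(x, y) \<in> ?R\<^sup>*" if "x \<in> S" "y \<in> S" for x y
  proof -
    have "(x, u) \<in> ?R" "(u, y) \<in> ?R" using that u E by blast+
    then show ?thesis by (rule rtrancl_into_rtrancl[OF r_into_rtrancl])
  qed
  then show ?thesis
    unfolding bouquet_def connected_complement_def using at u by auto
qed

lemma bouquet_empty: "bouquet False {} E"
  unfolding bouquet_def bouquet_at_def
proof (intro conjI allI impI)
  fix m
  \<comment> \<open>Level \<open>Suc m\<close> has its base point on the last edge, number
    \<open>m\<close>, whereas the cross-polytope has it on edge 0; hence the reversed
    numbering.\<close>
  let ?f = "\<lambda>(k, s). Inr (m - k, s) :: 'a + nat \<times> bool"
  have "pointed_equiv (ind_space ({..m} \<times> UNIV) (\<lambda>(k, s) (k', s'). k = k' \<and> s \<noteq> s')) (vertex_point (0, True))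
      (ind_space (susp_verts (Suc m) {}) (susp_adj E)) (vertex_point (?f (0, True)))"
  proof (rule pointed_equiv_relabel)
    show "bij_betw ?f ({..m} \<times> UNIV) (susp_verts (Suc m) {})"
      by (rule bij_betw_byWitness[where f' = "\<lambda>x. case x of Inr (k, s) \<Rightarrow> (m - k, s)"])
        (auto simp: susp_verts_def)
  qed auto
  from pointed_equiv_trans[OF pointed_equiv_sym[OF this] pointed_equiv_cross_polytope]
  have "pointed_equiv (ind_space (susp_verts (Suc m) {}) (susp_adj E)) (vertex_point (?f (0, True))) (sphere_wedge [m]) None" .
  then show "\<exists>ds. pointed_equiv (ind_space (susp_verts (Suc m) {}) (susp_adj E)) (vertex_point (Inr (m, True)))
      (sphere_wedge ds) None" by auto
qed auto

text \<open>An isolated edge is itself a suspension edge, so level \<open>m\<close> of the graph is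
  level \<open>Suc m\<close> of the rest, and only suspensions of the rest are involved.
  Connectedness of the complex itself does need a further vertex: a lone edge gives a
  0-sphere.\<close>

lemma bouquet_edge:
  assumes G: "fin_graph S E" and uv: "u \<in> S" "v \<in> S" "E u v"
    and iso: "\<And>w. w \<in> S \<Longrightarrow> w \<noteq> v \<Longrightarrow> \<not> E u w" "\<And>w. w \<in> S \<Longrightarrow> w \<noteq> u \<Longrightarrow> \<not> E v w"
    and ne: "b \<Longrightarrow> S - {u, v} \<noteq> {}" and B: "bouquet False (S - {u, v}) E"
  shows "bouquet b S E"
proof -
  have E: "\<And>u v. E u v \<Longrightarrow> E v u" and irr: "\<And>u. \<not> E u u" using G by (auto simp: fin_graph_def)
  have neq: "u \<noteq> v" using uv irr by blast
  \<comment> \<open>The isolated edge receives number 0 and the others move up, so that the base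
    point on the last edge stays on the last edge. At level 0 the base point is \<open>u\<close>
    itself.\<close>
  let ?f = "\<lambda>x. case x of Inl w \<Rightarrow> if w = u then Inr (0, True) else if w = v then Inr (0, False) else Inl w
     | Inr (k, s) \<Rightarrow> Inr (Suc k, s)"
  let ?g = "\<lambda>x. case x of Inl w \<Rightarrow> Inl w
     | Inr (k, s) \<Rightarrow> if k = 0 then (if s then Inl u else Inl v) else Inr (k - 1, s)"
  have at: "bouquet_at S E m x" if x: "x \<in> susp_verts m S" and fx: "?f x = Inr (m, True)" for m x
  proof (rule bouquet_at_transfer)
    show "pointed_equiv (ind_space (susp_verts m S) (susp_adj E)) (vertex_point x)
       (ind_space (susp_verts (Suc m) (S - {u, v})) (susp_adj E)) (vertex_point (?f x))"
    proof (rule pointed_equiv_relabel)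
      show "finite (susp_verts m S)" using fin_graph_susp[OF G, of m] by (simp add: fin_graph_def)
      show "bij_betw ?f (susp_verts m S) (susp_verts (Suc m) (S - {u, v}))"
        by (rule bij_betw_byWitness[where f' = ?g])
          (use uv neq in \<open>auto elim!: susp_verts_cases split: if_splits\<close>)
      show "susp_adj E a c \<longleftrightarrow> susp_adj E (?f a) (?f c)"
        if "a \<in> susp_verts m S" "c \<in> susp_verts m S" for a c
        using that(1)
      proof (cases rule: susp_verts_cases)
        case a: (1 a')
        show ?thesis
          using that(2)
        proof (cases rule: susp_verts_cases)
          case c: (1 c')
          have "\<not> E a' u" if "a' \<noteq> v" using iso(1)[OF a(2) that] E by blast
          moreover have "\<not> E a' v" if "a' \<noteq> u" using iso(2)[OF a(2) that] E by blast
          moreover have "E v u" using uv E by blast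
          ultimately show ?thesis using a c iso uv neq irr by auto
        qed (use a in auto)
      next
        case a: (2 k s)
        show ?thesis
          using that(2) by (cases rule: susp_verts_cases) (use a in auto)
      qed
      show "x \<in> susp_verts m S" by (rule x)
      show "\<not> susp_adj E x x" using fin_graph_susp[OF G, of m] by (simp add: fin_graph_def)
    qed
    show "bouquet_at (S - {u, v}) E (Suc m) (?f x)" unfolding fx using B by (simp add: bouquet_def)
  qed
  have at0: "bouquet_at S E 0 (Inl u)" by (rule at) (use uv in auto)
  have atS: "bouquet_at S E (Suc m) (Inr (m, True))" for m by (rule at) auto
  have "connected_complement S E" if b
  proof -
    obtain w where w: "w \<in> S - {u, v}" using ne[OF \<open>b\<close>] by blast
    let ?R = "{(x, y). x \<in> S \<and> y \<in> S \<and> \<not> E x y}"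
    have wu: "(w, u) \<in> ?R" "(u, w) \<in> ?R" "(w, v) \<in> ?R" "(v, w) \<in> ?R"
      using w uv iso E by blast+
    have 1: "(x, w) \<in> ?R\<^sup>* \<and> (w, x) \<in> ?R\<^sup>*" if "x \<in> S" for x
    proof (cases "x = u \<or> x = v")
      case True then show ?thesis using wu by (auto intro: r_into_rtrancl)
    next
      case False
      then have "(x, u) \<in> ?R" "(u, x) \<in> ?R" using that uv iso E by blast+
      then show ?thesis using wu by (meson r_into_rtrancl rtrancl_into_rtrancl)
    qed
    then show ?thesis unfolding connected_complement_def by (meson rtrancl_trans)
  qed
  then show ?thesis unfolding bouquet_def using at0 atS uv by blast
qed

lemma null_chain_nonempty: "null_chain L A E \<phi> \<Longrightarrow> A \<noteq> {}"
  by (induction rule: null_chain.induct) auto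

lemma bouquet_at_split:
  assumes G: "fin_graph S E" and v: "v \<in> S" and L: "L = {w \<in> S. w \<noteq> v \<and> \<not> E v w}"
    and ch: "null_chain L (S - {v}) E (\<lambda>x. x)" and x: "x \<in> susp_verts m (S - {v})"
    and m0: "m = 0 \<Longrightarrow> L \<noteq> {}" "m = 0 \<Longrightarrow> connected_complement (S - {v}) E"
    and A: "bouquet_at (S - {v}) E m x" and B: "bouquet_at L E (Suc m) (Inr (m, True))"
  shows "bouquet_at S E m x"
proof -
  let ?p = "Inr (m, True)" and ?p' = "Inr (m, False)" and ?S = "susp_verts m S" and ?E = "susp_adj E"
  have GL: "fin_graph L E" and GA: "fin_graph (S - {v}) E" by (rule fin_graph_mono[OF G]; auto simp: L)+
  have E: "\<And>u v. E u v \<Longrightarrow> E v u" using G by (auto simp: fin_graph_def)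
  obtain ds where ds: "pointed_equiv (ind_space (susp_verts m (S - {v})) ?E) (vertex_point x) (sphere_wedge ds) None"
    using A by (auto simp: bouquet_at_def)
  obtain es where es: "pointed_equiv (ind_space (susp_verts (Suc m) L) ?E) (vertex_point ?p) (sphere_wedge es) None"
    using B by (auto simp: bouquet_at_def)
  have fL: "finite (susp_verts m L)" using fin_graph_susp[OF GL, of m] by (simp add: fin_graph_def)
  have "homotopic_with (\<lambda>_. True) (ind_space (susp_verts m L) ?E) (ind_space (susp_verts m (S - {v})) ?E)
      (push_forward (susp_verts m L) (\<lambda>x. x)) (\<lambda>_. vertex_point x)"
  proof (rule null_chain_homotopic[OF null_chain_susp[OF ch] fL fin_graph_susp[OF GA] _ x])
    show "connected_complement (susp_verts m (S - {v})) ?E"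
      by (rule connected_complement_susp) (use m0 null_chain_nonempty[OF ch] in auto)
    show "u \<in> susp_verts m (S - {v})" if "u \<in> susp_verts m L" for u
      using that by (cases rule: susp_verts_cases) (auto simp: L)
  qed auto
  then have null: "homotopic_with (\<lambda>_. True) (ind_space (susp_verts m L) ?E) (ind_space (susp_verts m (S - {v})) ?E)
      (\<lambda>x. x) (\<lambda>_. vertex_point x)"
    by (rule homotopic_with_eq)
      (auto simp: topspace_ind_space[OF fL] intro!: push_forward_id[OF fL, symmetric])
  have "pointed_equiv (ind_space ?S ?E) (vertex_point x) (sphere_wedge (ds @ es)) None"
  proof (rule pointed_equiv_split[of ?p ?p' _ _ "Inl v"])
    show "fin_graph (insert ?p (insert ?p' ?S)) ?E"
      using fin_graph_susp[OF G, of "Suc m"] by (simp add: susp_verts_Suc)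
    show eq: "susp_verts m L = {w \<in> ?S. w \<noteq> Inl v \<and> \<not> ?E (Inl v) w}"
      by (auto simp: L elim!: susp_verts_cases)
    show "susp_verts m L \<noteq> {}"
    proof (cases "m = 0")
      case True then show ?thesis using m0(1) by (auto simp: susp_verts_def)
    next
      case False
      then have "Inr (0, True) \<in> susp_verts m L" by simp
      then show ?thesis by blast
    qed
    show "\<not> ?E ?p w \<and> \<not> ?E ?p' w" if "w \<in> ?S" for w
      using that by (cases rule: susp_verts_cases) auto
    show "homotopic_with (\<lambda>_. True) (ind_space (susp_verts m L) ?E) (ind_space (?S - {Inl v}) ?E) (\<lambda>x. x) (\<lambda>_. vertex_point x)"
      using null by (simp add: susp_verts_remove)
    show "pointed_equiv (ind_space (?S - {Inl v}) ?E) (vertex_point x) (sphere_wedge ds) None"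
      using ds by (simp add: susp_verts_remove)
    show "pointed_equiv (ind_space (insert ?p (insert ?p' (susp_verts m L))) ?E) (vertex_point ?p) (sphere_wedge es) None"
      using es by (simp add: susp_verts_Suc)
    show "x \<in> ?S" "x \<noteq> Inl v" using x by (auto simp: susp_verts_remove)
  qed (use v in auto)
  then show ?thesis unfolding bouquet_at_def by blast
qed

text \<open>The link occurs only suspended, so the weak flag is enough for it.\<close>

lemma bouquet_split:
  assumes G: "fin_graph S E" and v: "v \<in> S" and L: "L = {w \<in> S. w \<noteq> v \<and> \<not> E v w}"
    and ch: "null_chain L (S - {v}) E (\<lambda>x. x)" and ne: "b \<Longrightarrow> L \<noteq> {}"
    and A: "bouquet b (S - {v}) E" and B: "bouquet False L E"
  shows "bouquet b S E"
  unfolding bouquet_def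
proof (intro conjI allI impI)
  show "bouquet_at S E (Suc m) (Inr (m, True))" for m
    by (rule bouquet_at_split[OF G v L ch]) (use A B in \<open>auto simp: bouquet_def\<close>)
  assume b
  then obtain x where x: "x \<in> S - {v}" "bouquet_at (S - {v}) E 0 (Inl x)" and c: "connected_complement (S - {v}) E"
    using A by (auto simp: bouquet_def)
  have "bouquet_at S E 0 (Inl x)"
    by (rule bouquet_at_split[OF G v L ch]) (use x c ne[OF \<open>b\<close>] B in \<open>auto simp: bouquet_def\<close>)
  then show "\<exists>x\<in>S. bouquet_at S E 0 (Inl x)" using x by blast
  obtain w where "w \<in> L" using ne[OF \<open>b\<close>] by blast
  then show "connected_complement S E"
    by (intro connected_complement_insert[OF c, of w]) (use L G in \<open>auto simp: fin_graph_def\<close>)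
qed

lemma bouquet_relabel:
  assumes G: "fin_graph S E" and f: "bij_betw f S T"
    and EF: "\<And>u v. u \<in> S \<Longrightarrow> v \<in> S \<Longrightarrow> E u v \<longleftrightarrow> F (f u) (f v)" and B: "bouquet b T F"
  shows "bouquet b S E"
proof -
  define h where "h = inv_into S f"
  have h: "h w \<in> S" "f (h w) = w" if "w \<in> T" for w
    using that f by (auto simp: h_def bij_betw_def inv_into_into f_inv_into_f)
  have hf: "h (f u) = u" if "u \<in> S" for u using that f by (simp add: h_def bij_betw_def)
  have fT: "f u \<in> T" if "u \<in> S" for u using that f by (auto simp: bij_betw_def)
  let ?f = "map_sum f id"
  have at: "bouquet_at S E m x" if x: "x \<in> susp_verts m S" and B: "bouquet_at T F m (?f x)" for m x
  proof (rule bouquet_at_transfer[OF _ B])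
    show "pointed_equiv (ind_space (susp_verts m S) (susp_adj E)) (vertex_point x)
       (ind_space (susp_verts m T) (susp_adj F)) (vertex_point (?f x))"
    proof (rule pointed_equiv_relabel)
      show "finite (susp_verts m S)" "\<not> susp_adj E x x"
        using fin_graph_susp[OF G, of m] by (simp_all add: fin_graph_def)
      show "bij_betw ?f (susp_verts m S) (susp_verts m T)"
        by (rule bij_betw_byWitness[where f' = "map_sum h id"])
          (use h hf fT in \<open>auto elim!: susp_verts_cases\<close>)
      show "susp_adj E a c \<longleftrightarrow> susp_adj F (?f a) (?f c)"
        if "a \<in> susp_verts m S" "c \<in> susp_verts m S" for a c
        using that EF by (auto elim!: susp_verts_cases)
    qed (rule x)
  qed
  show ?thesis
    unfolding bouquet_def
  proof (intro conjI allI impI)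
    show "bouquet_at S E (Suc m) (Inr (m, True))" for m
      by (rule at) (use B in \<open>auto simp: bouquet_def\<close>)
    assume b
    then obtain x where x: "x \<in> T" "bouquet_at T F 0 (Inl x)" and c: "connected_complement T F"
      using B by (auto simp: bouquet_def)
    have "bouquet_at S E 0 (Inl (h x))" by (rule at) (use x h in auto)
    then show "\<exists>x\<in>S. bouquet_at S E 0 (Inl x)" using x h by blast
    let ?R = "{(x, y). x \<in> S \<and> y \<in> S \<and> \<not> E x y}" and ?R' = "{(x, y). x \<in> T \<and> y \<in> T \<and> \<not> F x y}"
    have R: "(h u, h v) \<in> ?R\<^sup>*" if "(u, v) \<in> ?R'\<^sup>*" for u v
      using that
    proof (induction rule: rtrancl_induct)
      case (step y z)
      then have "(h y, h z) \<in> ?R" using h EF by auto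
      with step.IH show ?case by (rule rtrancl_into_rtrancl)
    qed simp
    have "(u, v) \<in> ?R\<^sup>*" if "u \<in> S" "v \<in> S" for u v
    proof -
      have "(f u, f v) \<in> ?R'\<^sup>*"
        using c fT[OF that(1)] fT[OF that(2)] unfolding connected_complement_def by blast
      from R[OF this] show ?thesis by (simp only: hf[OF that(1)] hf[OF that(2)])
    qed
    then show "connected_complement S E" unfolding connected_complement_def by blast
  qed
qed

lemma bouquet_imp_wedge_of_spheres:
  assumes G: "fin_graph S E" and B: "bouquet True S E"
  shows "homotopy_equivalent_to_wedge_of_spheres (ind_space S E)"
proof -
  obtain x ds where x: "x \<in> S" "pointed_equiv (ind_space (susp_verts 0 S) (susp_adj E)) (vertex_point (Inl x)) (sphere_wedge ds) None"
    using B by (auto simp: bouquet_def bouquet_at_def)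
  have "pointed_equiv (ind_space S E) (vertex_point x) (ind_space (susp_verts 0 S) (susp_adj E)) (vertex_point (Inl x))"
    by (rule pointed_equiv_relabel)
      (use G x in \<open>auto simp: fin_graph_def susp_verts_def bij_betw_def\<close>)
  from pointed_equiv_imp_homotopy_equivalent[OF pointed_equiv_trans[OF this x(2)]]
  show ?thesis unfolding homotopy_equivalent_to_wedge_of_spheres_def by blast
qed

section \<open>Adding and removing an edge\<close>

lemma foldable_cong:
  assumes "foldable E S" "\<And>x y. x \<in> S \<Longrightarrow> y \<in> S \<Longrightarrow> E x y \<longleftrightarrow> F x y"
  shows "foldable F S"
  using assms
proof (induction rule: foldable.induct)
  case (foldable_isolated u S)
  show ?case by (rule foldable.foldable_isolated[of u]) (use foldable_isolated in auto)
next
  case (foldable_fold u S v)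
  show ?case by (rule foldable.foldable_fold[of u _ v]) (use foldable_fold in auto)
qed

text \<open>The complex of the union is a join with that of \<open>S\<close>; since \<open>P\<close>
  is compatible with all of \<open>S\<close>, the folds of \<open>S\<close> remain folds.\<close>

lemma foldable_Un:
  assumes "foldable E S" "P \<inter> S = {}" "\<And>p s. p \<in> P \<Longrightarrow> s \<in> S \<Longrightarrow> \<not> E s p"
  shows "foldable E (P \<union> S)"
  using assms
proof (induction rule: foldable.induct)
  case (foldable_isolated u S)
  show ?case by (rule foldable.foldable_isolated[of u]) (use foldable_isolated in auto)
next
  case (foldable_fold u S v)
  have "P \<union> S - {v} = P \<union> (S - {v})" using foldable_fold by blast
  then show ?case by (intro foldable.foldable_fold[of u "P \<union> S" v]) (use foldable_fold in auto)
qed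

lemma foldable_fold_set:
  assumes "finite D" "D \<subseteq> S" "u \<in> S - D" "\<And>v w. v \<in> D \<Longrightarrow> w \<in> S \<Longrightarrow> E u w \<Longrightarrow> E v w" "foldable E (S - D)"
  shows "foldable E S"
  using assms
proof (induction D arbitrary: S rule: finite_induct)
  case (insert d D)
  show ?case
  proof (rule foldable.foldable_fold[of u _ d])
    have "S - insert d D = S - {d} - D" by blast
    then have "foldable E (S - {d} - D)" using insert.prems(4) by simp
    then show "foldable E (S - {d})"
      by (rule insert.IH[rotated -1]) (use insert.prems(1-3) insert.hyps in auto)
  qed (use insert.prems in auto)
qed simp

lemma ind_space_cong:
  "(\<And>x y. x \<in> S \<Longrightarrow> y \<in> S \<Longrightarrow> E x y \<longleftrightarrow> F x y) \<Longrightarrow> ind_space S E = ind_space S F"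
  by (rule arg_cong[of _ _ geometric_realization]) (auto simp: indep_sets_def subset_iff)

lemma connected_complement_cong:
  assumes "\<And>x y. x \<in> S \<Longrightarrow> y \<in> S \<Longrightarrow> E x y \<longleftrightarrow> F x y"
  shows "connected_complement S E \<longleftrightarrow> connected_complement S F"
proof -
  have "{(x, y). x \<in> S \<and> y \<in> S \<and> \<not> E x y} = {(x, y). x \<in> S \<and> y \<in> S \<and> \<not> F x y}" using assms by auto
  then show ?thesis by (simp add: connected_complement_def)
qed

text \<open>The two graphs arise from a common one by deleting a vertex: a new vertex \<open>z\<close> is added as a
  copy of \<open>v\<close> lacking the edge to \<open>u\<close>.  It dominates \<open>v\<close>, and its own link is contractible.\<close>

lemma pointed_equiv_add_edge:
  fixes S :: "'v set"
  assumes inf: "infinite (UNIV :: 'v set)" and G: "fin_graph S E" and G': "fin_graph S F"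
    and uv: "u \<in> S" "v \<in> S" "u \<noteq> v" and E: "\<not> E u v"
    and F: "\<And>x y. F x y \<longleftrightarrow> E x y \<or> x = u \<and> y = v \<or> x = v \<and> y = u"
    and fold: "foldable E {w \<in> S. w \<noteq> u \<and> w \<noteq> v \<and> \<not> E u w \<and> \<not> E v w}"
    and x: "x \<in> susp_verts m S" "x \<noteq> Inl v" and c: "m = 0 \<Longrightarrow> connected_complement S F"
  shows "pointed_equiv (ind_space (susp_verts m S) (susp_adj E)) (vertex_point x)
     (ind_space (susp_verts m S) (susp_adj F)) (vertex_point x)"
proof -
  have S: "finite S" and Es: "\<And>u v. E u v \<Longrightarrow> E v u" and irr: "\<And>u. \<not> E u u"
    using G by (auto simp: fin_graph_def)
  obtain z where z: "z \<notin> S" using S inf by (metis ex_new_if_finite)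
  \<comment> \<open>The vertex \<open>z\<close> has the neighbours of \<open>v\<close> in
    \<open>E\<close>, so not \<open>u\<close>, while \<open>v\<close> itself is adjacent to
    \<open>u\<close> as in \<open>F\<close>.\<close>
  define H where "H = (\<lambda>a b. if a = z then b \<in> S \<and> E v b else if b = z then a \<in> S \<and> E v a else F a b)"
  have GH: "fin_graph (insert z S) H"
    using S G' z by (auto simp: fin_graph_def H_def)
  have HF: "H a b \<longleftrightarrow> F a b" if "a \<in> S" "b \<in> S" for a b using that z by (auto simp: H_def)
  have sHF: "susp_adj H a b \<longleftrightarrow> susp_adj F a b" if "a \<in> susp_verts m S" "b \<in> susp_verts m S" for a b
    using that HF by (auto elim!: susp_verts_cases)
  let ?K = "susp_verts m (insert z S)" and ?H = "susp_adj H"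
  let ?L = "{w \<in> S. \<not> E v w}" and ?M = "{w \<in> S. w \<noteq> u \<and> w \<noteq> v \<and> \<not> E u w \<and> \<not> E v w}"
  have KS: "?K - {Inl z} = susp_verts m S" using z by (auto simp: susp_verts_def)
  have xK: "x \<in> ?K" "x \<noteq> Inl z" using x z by (auto elim!: susp_verts_cases)
  have 1: "pointed_equiv (ind_space ?K ?H) (vertex_point x) (ind_space (?K - {Inl z}) ?H) (vertex_point x)"
  proof (rule pointed_equiv_delete_vertex[of "Inr (m, True)" "Inr (m, False)" _ _ _ "susp_verts m ?L"])
    show "fin_graph (insert (Inr (m, True)) (insert (Inr (m, False)) ?K)) ?H"
      using fin_graph_susp[OF GH, of "Suc m"] by (simp add: susp_verts_Suc)
    show "susp_verts m ?L = {w \<in> ?K. w \<noteq> Inl z \<and> \<not> ?H (Inl z) w}"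
      using z by (auto simp: H_def elim!: susp_verts_cases)
    have "foldable H ?M"
      by (rule foldable_cong[OF fold]) (use HF F in auto)
    \<comment> \<open>Within the link \<open>?L\<close> of \<open>z\<close> the only neighbour of
      \<open>v\<close> is \<open>u\<close>. Hence every other neighbour of \<open>u\<close> in the
      link folds onto \<open>v\<close>, and what remains is the isolated edge \<open>u v\<close>
      together with the foldable set \<open>?M\<close>.\<close>
    then have "foldable H ({u, v} \<union> ?M)"
      by (rule foldable_Un) (use HF F Es uv in auto)
    moreover have "{u, v} \<union> ?M = ?L - {w \<in> ?L. w \<noteq> v \<and> E u w}"
      using uv E Es irr by auto
    ultimately have "foldable H (?L - {w \<in> ?L. w \<noteq> v \<and> E u w})" by simp
    then have "foldable H ?L"
      by (rule foldable_fold_set[of _ _ v, rotated -1]) (use S uv irr E Es HF F in auto)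
    then show "foldable ?H (susp_verts m ?L)" by (rule foldable_susp)
    show "\<not> ?H (Inr (m, True)) w \<and> \<not> ?H (Inr (m, False)) w" if "w \<in> ?K" for w
      using that by (cases rule: susp_verts_cases) auto
    have "connected_complement (susp_verts m S) ?H \<longleftrightarrow> connected_complement (susp_verts m S) (susp_adj F)"
      by (rule connected_complement_cong) (rule sHF)
    moreover have "connected_complement (susp_verts m S) (susp_adj F)"
      by (rule connected_complement_susp) (use uv c in auto)
    ultimately show "connected_complement (?K - {Inl z}) ?H" unfolding KS by simp
  qed (use xK in simp_all)
  \<comment> \<open>The neighbours of \<open>z\<close> are neighbours of \<open>v\<close>, so
    \<open>v\<close> may be deleted; \<open>z\<close> then takes its place without the edge to
    \<open>u\<close>, which gives \<open>E\<close> back.\<close>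
  have 2: "pointed_equiv (ind_space ?K ?H) (vertex_point x) (ind_space (?K - {Inl v}) ?H) (vertex_point x)"
  proof (rule pointed_equiv_fold[of _ _ "Inl z"])
    show "fin_graph ?K ?H" by (rule fin_graph_susp[OF GH])
    show "?H (Inl v) w" if "w \<in> ?K" "?H (Inl z) w" for w
      using that uv z F by (cases rule: susp_verts_cases) (auto simp: H_def)
  qed (use uv z xK x in auto)
  let ?f = "\<lambda>y. if y = Inl z then Inl v else y"
  have 3: "pointed_equiv (ind_space (?K - {Inl v}) ?H) (vertex_point x) (ind_space (susp_verts m S) (susp_adj E)) (vertex_point (?f x))"
  proof (rule pointed_equiv_relabel)
    show "finite (?K - {Inl v})" using fin_graph_susp[OF GH, of m] by (simp add: fin_graph_def)
    show "bij_betw ?f (?K - {Inl v}) (susp_verts m S)"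
      by (rule bij_betw_byWitness[where f' = "\<lambda>y. if y = Inl v then Inl z else y"])
        (use uv z in \<open>auto elim!: susp_verts_cases split: if_splits\<close>)
    have HE: "H a b \<longleftrightarrow> E (if a = z then v else a) (if b = z then v else b)"
      if "a \<in> insert z S" "b \<in> insert z S" "a \<noteq> v" "b \<noteq> v" for a b
      using that z irr F Es by (auto simp: H_def)
    show "?H a b \<longleftrightarrow> susp_adj E (?f a) (?f b)" if "a \<in> ?K - {Inl v}" "b \<in> ?K - {Inl v}" for a b
    proof -
      have ab: "a \<in> ?K" "b \<in> ?K" "a \<noteq> Inl v" "b \<noteq> Inl v" using that by auto
      show ?thesis
        using ab(1)
      proof (cases rule: susp_verts_cases)
        case a: (1 a')
        show ?thesis
          using ab(2)
        proof (cases rule: susp_verts_cases)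
          case b: (1 b')
          have "H a' b' \<longleftrightarrow> E (if a' = z then v else a') (if b' = z then v else b')"
            by (rule HE) (use a b ab in auto)
          then show ?thesis using a b by auto
        qed (use a in auto)
      next
        case a: (2 k s)
        show ?thesis using ab(2) by (cases rule: susp_verts_cases) (use a in auto)
      qed
    qed
    show "x \<in> ?K - {Inl v}" using xK x by simp
    show "\<not> ?H x x" using fin_graph_susp[OF GH, of m] by (simp add: fin_graph_def)
  qed
  have "pointed_equiv (ind_space (susp_verts m S) (susp_adj E)) (vertex_point x) (ind_space (?K - {Inl v}) ?H) (vertex_point x)"
    using pointed_equiv_sym[OF 3] xK by simp
  from pointed_equiv_trans[OF pointed_equiv_trans[OF this pointed_equiv_sym[OF 2]] 1]
  show ?thesis unfolding KS using ind_space_cong[of "susp_verts m S" ?H "susp_adj F"] sHF by simp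
qed

text \<open>The common non-neighbours of \<open>u\<close> and \<open>v\<close> are the same in both
  graphs, so \<open>pointed_equiv_add_edge\<close> serves in either direction, according to whether
  the edge is present.\<close>

lemma bouquet_toggle_edge:
  fixes S :: "'v set"
  assumes inf: "infinite (UNIV :: 'v set)" and G: "fin_graph S E" and uv: "u \<in> S" "v \<in> S" "u \<noteq> v"
    and F: "\<And>x y. F x y \<longleftrightarrow> (if x = u \<and> y = v \<or> x = v \<and> y = u then \<not> E x y else E x y)"
    and fold: "foldable E {w \<in> S. w \<noteq> u \<and> w \<noteq> v \<and> \<not> E u w \<and> \<not> E v w}"
    and B: "bouquet b S F"
  shows "bouquet b S E"
proof -
  have S: "finite S" and Es: "\<And>u v. E u v \<Longrightarrow> E v u" and irr: "\<And>u. \<not> E u u"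
    using G by (auto simp: fin_graph_def)
  have G': "fin_graph S F" using G uv by (auto simp: fin_graph_def F)
  let ?M = "\<lambda>E u v. {w \<in> S. w \<noteq> u \<and> w \<noteq> v \<and> \<not> E u w \<and> \<not> E v w}"
  have M: "?M F u v = ?M E u v" "?M E v u = ?M E u v" "?M F v u = ?M E u v" by (auto simp: F)
  have foldF: "foldable F (?M E u v)"
    by (rule foldable_cong[OF fold]) (auto simp: F)
  \<comment> \<open>A common non-neighbour joins \<open>u\<close> and \<open>v\<close> in the
    complement of either graph, so toggling the edge does not affect connectedness.\<close>
  obtain w where w: "w \<in> ?M E u v" using foldable_nonempty[OF fold] by blast
  let ?R = "\<lambda>E. {(x, y). x \<in> S \<and> y \<in> S \<and> \<not> E x y}"
  have cc: "connected_complement S E2"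
    if c: "connected_complement S E1" and eq: "\<And>x y. \<not> (x = u \<and> y = v \<or> x = v \<and> y = u) \<Longrightarrow> E1 x y = E2 x y"
      and E2: "\<not> E2 u w" "\<not> E2 v w" "\<not> E2 w u" "\<not> E2 w v" for E1 E2
  proof -
    have wS: "w \<in> S" using w by auto
    have uw: "(u, w) \<in> (?R E2)\<^sup>*" "(w, v) \<in> (?R E2)\<^sup>*" "(v, w) \<in> (?R E2)\<^sup>*" "(w, u) \<in> (?R E2)\<^sup>*"
      using E2 wS uv by (auto intro!: r_into_rtrancl)
    have "?R E1 \<subseteq> (?R E2)\<^sup>*"
    proof
      fix p assume p: "p \<in> ?R E1"
      show "p \<in> (?R E2)\<^sup>*"
      proof (cases "p = (u, v) \<or> p = (v, u)")
        case True
        then show ?thesis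
          using rtrancl_trans[OF uw(1,2)] rtrancl_trans[OF uw(3,4)] by (elim disjE) simp_all
      next
        case False
        then have "p \<in> ?R E2" using p eq by auto
        then show ?thesis by blast
      qed
    qed
    then have "(?R E1)\<^sup>* \<subseteq> (?R E2)\<^sup>*" by (rule rtrancl_subset_rtrancl)
    then show ?thesis using c unfolding connected_complement_def by blast
  qed
  have wE: "\<not> E u w" "\<not> E v w" "\<not> E w u" "\<not> E w v" using w Es by auto
  have wF: "\<not> F u w" "\<not> F v w" "\<not> F w u" "\<not> F w v" using wE w by (auto simp: F)
  have cE: "connected_complement S E" if "connected_complement S F"
    by (rule cc[OF that _ wE]) (auto simp: F)
  have cF: "connected_complement S F" if "connected_complement S E"
    by (rule cc[OF that _ wF]) (auto simp: F)
  have at: "bouquet_at S E m x"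
    if x: "x \<in> susp_verts m S" and Bx: "bouquet_at S F m x" and c: "m = 0 \<Longrightarrow> connected_complement S F" for m x
  proof -
    \<comment> \<open>The end called \<open>b\<close> is the vertex that is copied and deleted, so
      it must not be the base point; one of the two orders of \<open>u\<close> and \<open>v\<close>
      is always suitable.\<close>
    have step: "bouquet_at S E m x" if ab: "a \<in> S" "b \<in> S" "a \<noteq> b" "x \<noteq> Inl b" "a = u \<and> b = v \<or> a = v \<and> b = u" for a b
    proof (rule bouquet_at_transfer[OF _ Bx])
      have MEab: "?M E a b = ?M E u v" using ab(5) by (elim disjE) (simp_all add: M(2))
      have MFab: "?M F a b = ?M E u v" using ab(5) by (elim disjE) (simp_all add: M(1,3))
      show "pointed_equiv (ind_space (susp_verts m S) (susp_adj E)) (vertex_point x)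
         (ind_space (susp_verts m S) (susp_adj F)) (vertex_point x)"
      proof (cases "E a b")
        case False
        have ab': "\<not> E b a" using False Es by blast
        show ?thesis
          by (rule pointed_equiv_add_edge[OF inf G G' ab(1,2,3) False _ _ x ab(4) c])
            (use False ab' ab(5) fold[folded MEab] in \<open>auto simp: F\<close>)
      next
        case True
        have ab': "E b a" using True Es by blast
        have nF: "\<not> F a b" using True ab(5) by (auto simp: F)
        show ?thesis
        proof (rule pointed_equiv_sym, rule pointed_equiv_add_edge[OF inf G' G ab(1,2,3) nF _ _ x ab(4)])
          show "E y z \<longleftrightarrow> F y z \<or> y = a \<and> z = b \<or> y = b \<and> z = a" for y z
            using True ab' ab(5) by (auto simp: F)
          show "foldable F (?M F a b)" unfolding MFab by (rule foldF)
          show "connected_complement S E" if "m = 0" using cE c that by blast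
        qed
      qed
    qed
    show ?thesis
      using step[of u v] step[of v u] uv by (cases "x = Inl v") auto
  qed
  show ?thesis
    unfolding bouquet_def
  proof (intro conjI allI impI)
    show "bouquet_at S E (Suc m) (Inr (m, True))" for m
      by (rule at) (use B in \<open>simp_all add: bouquet_def\<close>)
    assume b
    then obtain x where x: "x \<in> S" "bouquet_at S F 0 (Inl x)" and c: "connected_complement S F"
      using B by (auto simp: bouquet_def)
    have "bouquet_at S E 0 (Inl x)" by (rule at) (use x c in simp_all)
    then show "\<exists>x\<in>S. bouquet_at S E 0 (Inl x)" using x by blast
    show "connected_complement S E" by (rule cE[OF c])
  qed
qed

section \<open>Certificates for reductions of windows\<close>

text \<open>Rows are counted from 0 here but columns from 1, hence \<open>Suc i + j\<close> in the
  parity condition. Edges are oriented downwards within a column and to the right between columns;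
  \<open>window_adj\<close> symmetrises them.\<close>

definition grid_step :: "nat \<times> nat \<Rightarrow> nat \<times> nat \<Rightarrow> bool" where
  "grid_step p q = (case (p, q) of ((i, j), (i', j')) \<Rightarrow>
     i' = Suc i \<and> j' = j \<or> i' = i \<and> j' = Suc j \<or>
     i' = Suc i \<and> j' = Suc j \<and> odd (Suc i + j) \<or> i = Suc i' \<and> j' = Suc j \<and> odd (Suc i' + j))"

definition adj :: "(nat \<times> nat) list \<Rightarrow> nat \<Rightarrow> nat \<Rightarrow> bool" where
  "adj Es a b \<longleftrightarrow> a \<noteq> b \<and> ((a, b) \<in> set Es \<or> (b, a) \<in> set Es)"

text \<open>A window is a finite graph glued to the left end of the strip with \<open>2 * N\<close> columns.  Its
  vertices are labelled by numbers at least 4 and placed in column 0; the labels 0 to 3 stand for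
  the vertices of the first column of the strip.\<close>

definition label :: "nat \<Rightarrow> nat \<times> nat" where
  "label a = (a, if a < 4 then 1 else 0)"

definition window_verts :: "nat list \<Rightarrow> nat \<Rightarrow> (nat \<times> nat) set" where
  "window_verts Vs N = (\<lambda>a. (a, 0)) ` set Vs \<union> {(i, j). i < 4 \<and> 1 \<le> j \<and> j \<le> 2 * N}"

definition window_adj :: "(nat \<times> nat) list \<Rightarrow> nat \<times> nat \<Rightarrow> nat \<times> nat \<Rightarrow> bool" where
  "window_adj Es p q =
     (if snd p \<ge> 1 \<and> snd q \<ge> 1 then grid_step p q \<or> grid_step q p
      else snd p \<le> 1 \<and> snd q \<le> 1 \<and> (snd p = 1 \<longrightarrow> fst p < 4) \<and> (snd q = 1 \<longrightarrow> fst q < 4) \<and>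
        adj Es (fst p) (fst q))"

definition ports :: "nat \<Rightarrow> nat list" where
  "ports N = (if N = 0 then [] else [0, 1, 2, 3])"

text \<open>The columns out of reach of the gadget. A condition on the neighbours of a gadget vertex
  therefore has to be tested on gadget and ports only, whatever the value of
  \<open>N\<close>.\<close>

definition deep :: "nat \<Rightarrow> (nat \<times> nat) set" where
  "deep N = {(i, j). i < 4 \<and> 2 \<le> j \<and> j \<le> 2 * N}"

lemma adj_sym: "adj Es a b \<longleftrightarrow> adj Es b a"
  by (auto simp: adj_def)

lemma window_verts_eq:
  assumes "\<forall>a\<in>set Vs. 4 \<le> a"
  shows "window_verts Vs N = label ` set (Vs @ ports N) \<union> deep N"
proof -
  have "(\<lambda>a. (a, 0)) ` set Vs = label ` set Vs"
    using assms by (intro image_cong) (auto simp: label_def)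
  moreover have "{(i, j). i < 4 \<and> 1 \<le> j \<and> j \<le> 2 * N} = label ` set (ports N) \<union> deep N"
  proof (cases "N = 0")
    case False
    have "label ` set (ports N) = {(i, 1) | i. i < 4}"
      using False by (auto simp: ports_def label_def image_iff numeral_eq_Suc less_Suc_eq)
    moreover have "j = 1 \<or> 2 \<le> j" if "1 \<le> j" for j :: nat using that by auto
    ultimately show ?thesis using False by (auto simp: deep_def)
  qed (auto simp: deep_def ports_def)
  ultimately show ?thesis by (simp add: window_verts_def image_Un Un_assoc)
qed

lemma fin_graph_window: "fin_graph (window_verts Vs N) (window_adj Es)"
proof -
  have "{(i, j). i < (4::nat) \<and> 1 \<le> j \<and> j \<le> 2 * N} \<subseteq> {..<4} \<times> {..2 * N}" by auto
  then have "finite (window_verts Vs N)"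
    unfolding window_verts_def by (auto intro: finite_subset)
  moreover have "\<not> grid_step p p" for p by (auto simp: grid_step_def)
  ultimately show ?thesis
    unfolding fin_graph_def window_adj_def using adj_sym by (auto simp: adj_def)
qed

lemma window_adj_sym: "window_adj Es p q \<longleftrightarrow> window_adj Es q p"
  using fin_graph_window[of "[]" 0 Es] unfolding fin_graph_def by blast

lemma window_adj_label [simp]: "4 \<le> a \<Longrightarrow> window_adj Es (a, 0) (label c) \<longleftrightarrow> adj Es a c"
  by (auto simp: window_adj_def label_def)

lemma window_adj_deep [simp]: "x \<in> deep N \<Longrightarrow> \<not> window_adj Es (a, 0) x"
  by (auto simp: window_adj_def deep_def)

lemma window_adj_column0 [simp]: "window_adj Es (a, 0) (c, 0) \<longleftrightarrow> adj Es a c"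
  by (simp add: window_adj_def)

lemma label_ge: "4 \<le> a \<Longrightarrow> label a = (a, 0)"
  by (simp add: label_def)

lemma inj_label: "label a = label b \<longleftrightarrow> a = b"
  by (simp add: label_def)

lemma label_notin_deep [simp]: "label a \<notin> deep N"
  by (simp add: label_def deep_def)

lemma column0_notin_deep [simp]: "(a, 0) \<notin> deep N"
  by (simp add: deep_def)

lemma window_verts_removeAll:
  "window_verts (removeAll v Vs) N = window_verts Vs N - {(v, 0)}"
  by (auto simp: window_verts_def)

lemma mem_window_verts [simp]: "(a, 0) \<in> window_verts Vs N \<longleftrightarrow> a \<in> set Vs"
  by (auto simp: window_verts_def)

text \<open>The executable form of \<open>null_chain\<close>. Only gadget vertices are moved, and
  only to gadget vertices, so ports and deep columns stay fixed; the ports \<open>ps\<close> enter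
  the tests as vertices whose images could be adjacent to \<open>w'\<close> or
  \<open>u\<close>.\<close>

fun chain_ok :: "(nat \<times> nat) list \<Rightarrow> nat list \<Rightarrow> nat list \<Rightarrow> nat list \<Rightarrow> (nat \<Rightarrow> nat) \<Rightarrow> (nat \<times> nat) list \<Rightarrow> nat \<Rightarrow> bool" where
  "chain_ok Es As Ls ps \<phi> [] u \<longleftrightarrow> u \<in> set As \<and> (\<forall>y\<in>set (Ls @ ps). \<not> adj Es u (\<phi> y))"
| "chain_ok Es As Ls ps \<phi> ((w, w') # ch) u \<longleftrightarrow> w \<in> set Ls \<and> w' \<in> set As \<and> \<not> adj Es w' (\<phi> w) \<and>
     (\<forall>y\<in>set (Ls @ ps). y = w \<or> adj Es w y \<or> \<not> adj Es w' (\<phi> y)) \<and>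
     chain_ok Es As Ls ps (\<phi>(w := w')) ch u"

fun folds_ok :: "(nat \<times> nat) list \<Rightarrow> nat list \<Rightarrow> nat list \<Rightarrow> (nat \<times> nat) list \<Rightarrow> nat \<Rightarrow> bool" where
  "folds_ok Es Ms ps [] u \<longleftrightarrow> u \<in> set Ms \<and> (\<forall>y\<in>set (Ms @ ps). \<not> adj Es u y)"
| "folds_ok Es Ms ps ((u', v) # fs) u \<longleftrightarrow> u' \<in> set Ms \<and> v \<in> set Ms \<and> u' \<noteq> v \<and>
     (\<forall>y\<in>set (Ms @ ps). adj Es u' y \<longrightarrow> adj Es v y) \<and> folds_ok Es (removeAll v Ms) ps fs u"

definition toggle_edge :: "nat \<Rightarrow> nat \<Rightarrow> (nat \<times> nat) list \<Rightarrow> (nat \<times> nat) list" where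
  "toggle_edge u v Es = (if adj Es u v then filter (\<lambda>e. e \<noteq> (u, v) \<and> e \<noteq> (v, u)) Es else (u, v) # Es)"

lemma adj_toggle_edge:
  "u \<noteq> v \<Longrightarrow> adj (toggle_edge u v Es) a b \<longleftrightarrow> (if a = u \<and> b = v \<or> a = v \<and> b = u then \<not> adj Es a b else adj Es a b)"
  by (auto simp: toggle_edge_def adj_def)

definition reflect :: "bool \<Rightarrow> nat \<Rightarrow> nat" where
  "reflect r p = (if r then 3 - p else p)"

text \<open>An isomorphism is given on the gadget alone, by an association list; on the strip it is
  the identity or the reflection. Compatibility then has to be tested only inside the gadget and at
  the ports.\<close>

definition iso_ok :: "nat list \<Rightarrow> (nat \<times> nat) list \<Rightarrow> nat list \<Rightarrow> (nat \<times> nat) list \<Rightarrow> (nat \<times> nat) list \<Rightarrow> bool \<Rightarrow> bool" where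
  "iso_ok Vs Es Ws Fs \<pi> r \<longleftrightarrow>
     distinct (map snd \<pi>) \<and> distinct (map fst \<pi>) \<and> set (map fst \<pi>) = set Vs \<and> set (map snd \<pi>) = set Ws \<and>
     (\<forall>(a, a')\<in>set \<pi>. (\<forall>(b, b')\<in>set \<pi>. adj Es a b \<longleftrightarrow> adj Fs a' b') \<and>
        (\<forall>p\<in>set [0, 1, 2, 3]. adj Es a p \<longleftrightarrow> adj Fs a' (reflect r p)))"

text \<open>A certificate prescribes a reduction of the window. \<open>Fold u v\<close> deletes
  \<open>v\<close>, \<open>Edge u v\<close> removes an isolated edge, \<open>Iso u\<close> stops
  at an isolated vertex, \<open>Leaf k \<pi> r\<close> identifies the window with the
  \<open>k\<close>-th known one along \<open>\<pi>\<close>, the strip being turned upside down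
  if \<open>r\<close>. In \<open>Split v ch u\<close> and \<open>Toggle u v fs w\<close> the
  lists encode the null-homotopy of the link and the folds proving contractibility. The argument
  \<open>z\<close> of \<open>check\<close> says that the strip is empty, and \<open>b\<close> is
  the flag of the bouquet to be established.\<close>

datatype cert = Empty | Iso nat | Leaf nat "(nat \<times> nat) list" bool | Fold nat nat cert | Edge nat nat cert
  | Split nat "(nat \<times> nat) list" nat cert cert | Toggle nat nat "(nat \<times> nat) list" nat cert

type_synonym window = "nat list \<times> (nat \<times> nat) list"

fun check :: "(bool \<times> window) list \<Rightarrow> bool \<Rightarrow> bool \<Rightarrow> nat list \<Rightarrow> (nat \<times> nat) list \<Rightarrow> cert \<Rightarrow> bool" where
  "check Ws z b Vs Es Empty \<longleftrightarrow> z \<and> \<not> b \<and> Vs = []"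
| "check Ws z b Vs Es (Iso u) \<longleftrightarrow> u \<in> set Vs \<and> (\<forall>y\<in>set (Vs @ (if z then [] else [0, 1, 2, 3])). \<not> adj Es u y)"
| "check Ws z b Vs Es (Leaf k \<pi> r) \<longleftrightarrow> k < length Ws \<and> (b \<longrightarrow> fst (Ws ! k)) \<and>
     iso_ok Vs Es (fst (snd (Ws ! k))) (snd (snd (Ws ! k))) \<pi> r"
| "check Ws z b Vs Es (Fold u v c) \<longleftrightarrow> u \<in> set Vs \<and> v \<in> set Vs \<and> u \<noteq> v \<and>
     (\<forall>y\<in>set (Vs @ (if z then [] else [0, 1, 2, 3])). adj Es u y \<longrightarrow> adj Es v y) \<and> check Ws z b (removeAll v Vs) Es c"
| "check Ws z b Vs Es (Edge u v c) \<longleftrightarrow> u \<in> set Vs \<and> v \<in> set Vs \<and> adj Es u v \<and>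
     (\<forall>y\<in>set (Vs @ (if z then [] else [0, 1, 2, 3])). (y \<noteq> v \<longrightarrow> \<not> adj Es u y) \<and> (y \<noteq> u \<longrightarrow> \<not> adj Es v y)) \<and>
     (b \<longrightarrow> removeAll u (removeAll v Vs) \<noteq> []) \<and> check Ws z False (removeAll u (removeAll v Vs)) Es c"
| "check Ws z b Vs Es (Split v ch u c1 c2) \<longleftrightarrow> v \<in> set Vs \<and>
     (\<forall>p\<in>set (if z then [] else [0, 1, 2, 3]). \<not> adj Es v p) \<and>
     (let Ls = filter (\<lambda>w. w \<noteq> v \<and> \<not> adj Es v w) Vs in
        (b \<longrightarrow> Ls \<noteq> []) \<and>
        chain_ok Es (removeAll v Vs) Ls (if z then [] else [0, 1, 2, 3]) (\<lambda>x. x) ch u \<and>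
        check Ws z False Ls Es c2) \<and> check Ws z b (removeAll v Vs) Es c1"
| "check Ws z b Vs Es (Toggle u v fs w c) \<longleftrightarrow> u \<in> set Vs \<and> v \<in> set Vs \<and> u \<noteq> v \<and>
     (let P = (\<lambda>y. y \<noteq> u \<and> y \<noteq> v \<and> \<not> adj Es u y \<and> \<not> adj Es v y) in
        folds_ok Es (filter P Vs) (filter P (if z then [] else [0, 1, 2, 3])) fs w) \<and>
     check Ws z b Vs (toggle_edge u v Es) c"

section \<open>Soundness of the certificates\<close>

lemma chain_ok_null_chain:
  assumes "chain_ok Es As Ls ps \<phi> ch u" "\<forall>a\<in>set As. 4 \<le> a" "\<forall>a\<in>set Ls. 4 \<le> a" "set ps = set (ports N)"
    "\<forall>y\<in>set (Ls @ ps). \<Phi> (label y) = label (\<phi> y)" "\<forall>x\<in>deep N. \<Phi> x = x"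
  shows "null_chain (window_verts Ls N) (window_verts As N) (window_adj Es) \<Phi>"
  using assms
proof (induction ch arbitrary: \<phi> \<Phi>)
  case Nil
  show ?case
  proof (rule null_chain_cone[of "(u, 0)"])
    show "(u, 0) \<in> window_verts As N" using Nil by simp
    have u: "4 \<le> u" using Nil by simp
    show "\<not> window_adj Es (u, 0) (\<Phi> y)" if "y \<in> window_verts Ls N" for y
      using that Nil u by (auto simp: window_verts_eq)
  qed
next
  case (Cons m ch)
  obtain w w' where m: "m = (w, w')" by (cases m)
  have w: "4 \<le> w" "4 \<le> w'" "w \<in> set Ls" "w' \<in> set As" "\<not> adj Es w' (\<phi> w)"
      "\<forall>y\<in>set (Ls @ ps). y = w \<or> adj Es w y \<or> \<not> adj Es w' (\<phi> y)" "chain_ok Es As Ls ps (\<phi>(w := w')) ch u"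
    using Cons.prems m by auto
  have \<Phi>w: "\<Phi> (w, 0) = label (\<phi> w)"
    using Cons.prems(5) w(3) label_ge[OF w(1)] by (metis UnCI set_append)
  show ?case
  proof (rule null_chain_move[of "(w, 0)" _ "(w', 0)"])
    show "\<not> window_adj Es (\<Phi> (w, 0)) (w', 0)"
      using w by (subst window_adj_sym) (simp add: \<Phi>w)
    show "\<not> window_adj Es (w', 0) (\<Phi> y)"
      if y: "y \<in> window_verts Ls N" "y \<noteq> (w, 0)" "\<not> window_adj Es (w, 0) y" for y
    proof (cases "y \<in> deep N")
      case True
      then show ?thesis using Cons.prems(6) by simp
    next
      case False
      then obtain c where c: "c \<in> set (Ls @ ps)" "y = label c"
        using y(1) Cons.prems(4) unfolding window_verts_eq[OF Cons.prems(3)] by auto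
      have "c \<noteq> w" using y(2) c(2) label_ge[OF w(1)] by auto
      moreover have "\<not> adj Es w c" using y(3) c(2) w(1) by simp
      ultimately show ?thesis using c Cons.prems(5) w(2,6) by auto
    qed
    show "null_chain (window_verts Ls N) (window_verts As N) (window_adj Es) (\<Phi>((w, 0) := (w', 0)))"
    proof (rule Cons.IH[OF w(7) Cons.prems(2,3,4)])
      show "\<forall>y\<in>set (Ls @ ps). (\<Phi>((w, 0) := (w', 0))) (label y) = label ((\<phi>(w := w')) y)"
      proof
        fix y assume y: "y \<in> set (Ls @ ps)"
        show "(\<Phi>((w, 0) := (w', 0))) (label y) = label ((\<phi>(w := w')) y)"
        proof (cases "y = w")
          case True then show ?thesis using w by (simp add: label_ge)
        next
          case False
          then have "label y \<noteq> (w, 0)" using inj_label[of y w] label_ge[OF w(1)] by simp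
          then show ?thesis using False y Cons.prems(5) by simp
        qed
      qed
      show "\<forall>x\<in>deep N. (\<Phi>((w, 0) := (w', 0))) x = x" using Cons.prems(6) by auto
    qed
  qed (use w in simp_all)
qed

lemma folds_ok_foldable:
  assumes "folds_ok Es Ms ps fs u" "\<forall>a\<in>set Ms. 4 \<le> a"
  shows "foldable (window_adj Es) (label ` set (Ms @ ps) \<union> deep N)"
  using assms
proof (induction fs arbitrary: Ms)
  case Nil
  then have u: "4 \<le> u" "u \<in> set Ms" by auto
  show ?case
  proof (rule foldable_isolated[of "(u, 0)"])
    show "(u, 0) \<in> label ` set (Ms @ ps) \<union> deep N" using u by (auto simp: label_ge intro!: image_eqI[of _ _ u])
    show "\<not> window_adj Es (u, 0) w" if "w \<in> label ` set (Ms @ ps) \<union> deep N" for w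
      using that Nil u by auto
  qed
next
  case (Cons m fs)
  obtain u' v where m: "m = (u', v)" by (cases m)
  have h: "4 \<le> u'" "4 \<le> v" "u' \<in> set Ms" "v \<in> set Ms" "u' \<noteq> v"
      "\<forall>y\<in>set (Ms @ ps). adj Es u' y \<longrightarrow> adj Es v y" "folds_ok Es (removeAll v Ms) ps fs u"
    using Cons.prems m by auto
  show ?case
  \<comment> \<open>Here \<open>ps\<close> is arbitrary: a vertex occurring in it as well does not
    disappear with its removal from \<open>Ms\<close>, and the vertex set is unchanged.\<close>
  proof (cases "v \<in> set ps")
    case True
    have eq: "label ` set (Ms @ ps) \<union> deep N = label ` set (removeAll v Ms @ ps) \<union> deep N"
      using True by auto
    show ?thesis unfolding eq by (rule Cons.IH[OF h(7)]) (use Cons.prems(2) in auto)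
  next
    case False
    have "inj label" by (simp add: inj_def inj_label)
    then have "label ` set (Ms @ ps) - {label v} = label ` (set (Ms @ ps) - {v})"
      by (simp add: image_set_diff)
    moreover have "set (removeAll v Ms @ ps) = set (Ms @ ps) - {v}" using False by auto
    moreover have "label ` set (Ms @ ps) \<union> deep N - {label v} = (label ` set (Ms @ ps) - {label v}) \<union> deep N"
      using label_notin_deep[of v N] by blast
    ultimately have eq: "label ` set (Ms @ ps) \<union> deep N - {(v, 0)} = label ` set (removeAll v Ms @ ps) \<union> deep N"
      by (simp only: label_ge[OF h(2)])
    show ?thesis
    proof (rule foldable_fold[of "(u', 0)" _ "(v, 0)"])
      show "(u', 0) \<in> label ` set (Ms @ ps) \<union> deep N" using h by (auto simp: label_ge intro!: image_eqI[of _ _ u'])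
      show "(v, 0) \<in> label ` set (Ms @ ps) \<union> deep N" using h by (auto simp: label_ge intro!: image_eqI[of _ _ v])
      show "window_adj Es (v, 0) w" if "w \<in> label ` set (Ms @ ps) \<union> deep N" "window_adj Es (u', 0) w" for w
        using that h by auto
      show "foldable (window_adj Es) (label ` set (Ms @ ps) \<union> deep N - {(v, 0)})"
        unfolding eq by (rule Cons.IH[OF h(7)]) (use Cons.prems(2) in auto)
    qed (use h in simp)
  qed
qed

text \<open>Counted from 1, the rows i and i+1 go to 5-i and 4-i. The smaller row number changes
  from i to 4-i, which has the same parity, so the diagonals are preserved.\<close>

lemma grid_step_reflect:
  assumes "i < 4" "i' < 4"
  shows "grid_step (3 - i, j) (3 - i', j') \<or> grid_step (3 - i', j') (3 - i, j) \<longleftrightarrow>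
    grid_step (i, j) (i', j') \<or> grid_step (i', j') (i, j)"
proof -
  have "i = 0 \<or> i = 1 \<or> i = 2 \<or> i = 3" "i' = 0 \<or> i' = 1 \<or> i' = 2 \<or> i' = 3" using assms by auto
  then show ?thesis by (elim disjE; simp add: grid_step_def; argo?)
qed

lemma iso_ok_bouquet:
  assumes ok: "iso_ok Vs Es Ws Fs \<pi> r" and V: "\<forall>a\<in>set Vs. 4 \<le> a" and W: "\<forall>a\<in>set Ws. 4 \<le> a"
    and B: "bouquet b (window_verts Ws N) (window_adj Fs)"
  shows "bouquet b (window_verts Vs N) (window_adj Es)"
proof (rule bouquet_relabel[OF fin_graph_window _ _ B])
  have d: "distinct (map snd \<pi>)" and mV: "set (map fst \<pi>) = set Vs" and mW: "set (map snd \<pi>) = set Ws"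
    using ok unfolding iso_ok_def by blast+
  have e: "adj Es a b \<longleftrightarrow> adj Fs a' b'" if "(a, a') \<in> set \<pi>" "(b, b') \<in> set \<pi>" for a a' b b'
    using ok that unfolding iso_ok_def by fast
  have p: "adj Es a p \<longleftrightarrow> adj Fs a' (reflect r p)" if "(a, a') \<in> set \<pi>" "p \<in> set [0, 1, 2, 3]" for a a' p
    using ok that unfolding iso_ok_def by fast
  define h where "h a = the (map_of \<pi> a)" for a
  have h: "(a, h a) \<in> set \<pi>" if "a \<in> set Vs" for a
  proof -
    have "map_of \<pi> a \<noteq> None" using that mV by (auto simp: map_of_eq_None_iff)
    then show ?thesis by (auto simp: h_def map_of_SomeD)
  qed
  have hW: "h a \<in> set Ws" if "a \<in> set Vs" for a
  proof -
    have "snd (a, h a) \<in> snd ` set \<pi>" using h[OF that] by (rule imageI)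
    then show ?thesis using mW by simp
  qed
  have inj: "inj_on h (set Vs)"
  proof (rule inj_onI)
    fix a a' assume "a \<in> set Vs" "a' \<in> set Vs" "h a = h a'"
    then have "(a, h a) \<in> set \<pi>" "(a', h a) \<in> set \<pi>" using h[of a] h[of a'] by simp_all
    moreover have "inj_on snd (set \<pi>)" using d by (simp add: distinct_map)
    ultimately have "(a, h a) = (a', h a)" by (elim inj_onD) simp_all
    then show "a = a'" by simp
  qed
  have surj: "w \<in> h ` set Vs" if "w \<in> set Ws" for w
  proof -
    have "w \<in> set (map snd \<pi>)" using that mW by simp
    then obtain a where a: "(a, w) \<in> set \<pi>" by auto
    then have "fst (a, w) \<in> fst ` set \<pi>" by (rule imageI)
    then have aV: "a \<in> set Vs" using mV by simp
    have "distinct (map fst \<pi>)" using ok unfolding iso_ok_def by blast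
    then have "h a = w" using a by (simp add: h_def)
    then show ?thesis using aV by blast
  qed
  have bij: "bij_betw h (set Vs) (set Ws)"
    using inj surj hW by (auto simp: bij_betw_def)
  have rr: "reflect r p < 4" "reflect r (reflect r p) = p" if "p < 4" for p
    using that by (auto simp: reflect_def)
  let ?f = "\<lambda>(a, j). if j = 0 then (h a, 0) else (reflect r a, j)"
  have hinv: "inv_into (set Vs) h (h a) = a" if "a \<in> set Vs" for a using that inj by simp
  have hinv': "inv_into (set Vs) h w \<in> set Vs" "h (inv_into (set Vs) h w) = w" if "w \<in> set Ws" for w
    using surj[OF that] by (auto simp: inv_into_into f_inv_into_f)
  show "bij_betw ?f (window_verts Vs N) (window_verts Ws N)"
    by (rule bij_betw_byWitness[where f' = "\<lambda>(a, j). if j = 0 then (inv_into (set Vs) h a, 0) else (reflect r a, j)"])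
      (use hW hinv hinv' rr in \<open>auto simp: window_verts_def split: if_splits\<close>)
  have A: "adj Es a a' \<longleftrightarrow> adj Fs (h a) (h a')" if "a \<in> set Vs" "a' \<in> set Vs" for a a'
    using e[OF h[OF that(1)] h[OF that(2)]] .
  have P: "adj Es a p \<longleftrightarrow> adj Fs (h a) (reflect r p)" if "a \<in> set Vs" "p < 4" for a p
  proof -
    have "p \<in> set [0, 1, 2, 3]" using that(2) by auto
    then show ?thesis by (rule p[OF h[OF that(1)]])
  qed
  have G: "window_adj Es (i, j) (i', j') \<longleftrightarrow> window_adj Fs (reflect r i, j) (reflect r i', j')"
    if "i < 4" "i' < 4" "1 \<le> j" "1 \<le> j'" for i j i' j'
    using that grid_step_reflect[OF that(1,2), of j j'] by (auto simp: window_adj_def reflect_def)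
  have Q: "window_adj Es (a, 0) (i, j) \<longleftrightarrow> window_adj Fs (h a, 0) (reflect r i, j)"
    if "a \<in> set Vs" "i < 4" "1 \<le> j" for a i j
    using P[OF that(1,2)] that(2,3) rr[OF that(2)] by (auto simp: window_adj_def)
  have A': "window_adj Es (a, 0) (a', 0) \<longleftrightarrow> window_adj Fs (h a, 0) (h a', 0)"
    if "a \<in> set Vs" "a' \<in> set Vs" for a a'
    using A[OF that] by (simp add: window_adj_def)
  show "window_adj Es x y \<longleftrightarrow> window_adj Fs (?f x) (?f y)"
    if xy: "x \<in> window_verts Vs N" "y \<in> window_verts Vs N" for x y
  proof -
    have cases: "(\<exists>a\<in>set Vs. x = (a, 0)) \<or> (\<exists>i j. x = (i, j) \<and> i < 4 \<and> 1 \<le> j)" if "x \<in> window_verts Vs N" for x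
      using that by (auto simp: window_verts_def)
    from cases[OF xy(1)] cases[OF xy(2)] show ?thesis
    proof (elim disjE bexE exE conjE)
      fix a i j assume "a \<in> set Vs" "y = (a, 0)" "x = (i, j)" "i < 4" "1 \<le> j"
      then show ?thesis using Q[of a i j] window_adj_sym[of Es x y] window_adj_sym[of Fs "?f x" "?f y"] by simp
    qed (use A' G Q in simp_all)
  qed
qed

lemma chain_ok_no_ports: "chain_ok Es As Ls ps \<phi> ch u \<Longrightarrow> chain_ok Es As Ls [] \<phi> ch u"
  by (induction ch arbitrary: \<phi>) auto

lemma folds_ok_no_ports: "folds_ok Es Ms ps fs u \<Longrightarrow> folds_ok Es Ms [] fs u"
  by (induction fs arbitrary: Ms) auto

text \<open>Without a strip there are fewer tests and no more neighbours. Thus a certificate checked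
  once with ports also covers the case where unrolling has used up the strip.\<close>

lemma check_no_ports: "check Ws False b Vs Es c \<Longrightarrow> check Ws True b Vs Es c"
proof (induction c arbitrary: b Vs Es)
  case (Split v ch u c1 c2)
  then show ?case using chain_ok_no_ports by (auto simp: Let_def)
next
  case (Toggle u v fs w c)
  then show ?case using folds_ok_no_ports by (auto simp: Let_def)
qed auto

text \<open>Each constructor applies one of the rules for bouquets. A vertex of the window is a
  gadget vertex, a port or a deep vertex, and the last kind never meets the gadget, so tests on
  labels decide each rule.\<close>

theorem check_sound:
  assumes "check Ws z b Vs Es c" "\<forall>a\<in>set Vs. 4 \<le> a" "z \<longleftrightarrow> N = 0"
    "\<And>k. k < length Ws \<Longrightarrow> (\<forall>a\<in>set (fst (snd (Ws ! k))). 4 \<le> a) \<and>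
       bouquet (fst (Ws ! k)) (window_verts (fst (snd (Ws ! k))) N) (window_adj (snd (snd (Ws ! k))))"
  shows "bouquet b (window_verts Vs N) (window_adj Es)"
  using assms(1-3)
proof (induction c arbitrary: b Vs Es)
  case Empty
  then have "window_verts Vs N = {}" by (auto simp: window_verts_def)
  then show ?case using Empty bouquet_empty by simp
next
  case (Iso u)
  have ps: "set (if z then [] else [0, 1, 2, 3]) = set (ports N)" using Iso by (simp add: ports_def)
  show ?case
  proof (rule bouquet_isolated[OF fin_graph_window, of "(u, 0)"])
    show "\<not> window_adj Es (u, 0) w" if "w \<in> window_verts Vs N" for w
      using that Iso.prems ps unfolding window_verts_eq[OF Iso.prems(2)] by auto
  qed (use Iso in simp)
next
  case (Leaf k \<pi> r)
  let ?W = "Ws ! k"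
  have "bouquet (fst ?W) (window_verts Vs N) (window_adj Es)"
    by (rule iso_ok_bouquet[of _ _ "fst (snd ?W)" "snd (snd ?W)" \<pi> r]) (use Leaf.prems assms(4)[of k] in auto)
  then show ?case using Leaf.prems(1) bouquet_weaken by (cases b) auto
next
  case (Fold u v c)
  have ps: "set (if z then [] else [0, 1, 2, 3]) = set (ports N)" using Fold.prems by (simp add: ports_def)
  have u: "4 \<le> u" "4 \<le> v" using Fold.prems by auto
  show ?case
  proof (rule bouquet_fold[OF fin_graph_window, of "(u, 0)" _ _ "(v, 0)"])
    show "window_adj Es (v, 0) w" if "w \<in> window_verts Vs N" "window_adj Es (u, 0) w" for w
      using that Fold.prems u ps unfolding window_verts_eq[OF Fold.prems(2)] by auto
    show "bouquet b (window_verts Vs N - {(v, 0)}) (window_adj Es)"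
      using Fold.IH[of b "removeAll v Vs" Es] Fold.prems by (simp add: window_verts_removeAll)
  qed (use Fold.prems in simp_all)
next
  case (Edge u v c)
  have ps: "set (if z then [] else [0, 1, 2, 3]) = set (ports N)" using Edge.prems by (simp add: ports_def)
  have u: "4 \<le> u" "4 \<le> v" using Edge.prems by auto
  have eq: "window_verts Vs N - {(u, 0), (v, 0)} = window_verts (removeAll u (removeAll v Vs)) N"
    by (auto simp: window_verts_removeAll)
  show ?case
  proof (rule bouquet_edge[OF fin_graph_window, of "(u, 0)" _ _ "(v, 0)"])
    show "window_adj Es (u, 0) (v, 0)" using Edge.prems u by (simp add: window_adj_def)
    show "\<not> window_adj Es (u, 0) w" if "w \<in> window_verts Vs N" "w \<noteq> (v, 0)" for w
      using that Edge.prems(1) u ps label_ge[OF u(1)] label_ge[OF u(2)]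
      unfolding window_verts_eq[OF Edge.prems(2)] by auto
    show "\<not> window_adj Es (v, 0) w" if "w \<in> window_verts Vs N" "w \<noteq> (u, 0)" for w
      using that Edge.prems(1) u ps label_ge[OF u(1)] label_ge[OF u(2)]
      unfolding window_verts_eq[OF Edge.prems(2)] by auto
    show "window_verts Vs N - {(u, 0), (v, 0)} \<noteq> {}" if b
    proof -
      have "removeAll u (removeAll v Vs) \<noteq> []" using Edge.prems(1) that by simp
      then obtain a where "a \<in> set (removeAll u (removeAll v Vs))" by (metis hd_in_set)
      then have "(a, 0) \<in> window_verts (removeAll u (removeAll v Vs)) N" by simp
      then show ?thesis unfolding eq by blast
    qed
    show "bouquet False (window_verts Vs N - {(u, 0), (v, 0)}) (window_adj Es)"
      unfolding eq using Edge.prems by (intro Edge.IH) auto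
  qed (use Edge.prems in simp_all)
next
  case (Split v ch u c1 c2)
  let ?ps = "if z then [] else [0, 1, 2, 3]" and ?L = "filter (\<lambda>w. w \<noteq> v \<and> \<not> adj Es v w) Vs"
  have ps: "set ?ps = set (ports N)" using Split.prems by (simp add: ports_def)
  have v: "4 \<le> v" "v \<in> set Vs" "\<forall>p\<in>set ?ps. \<not> adj Es v p" using Split.prems by auto
  have ch: "chain_ok Es (removeAll v Vs) ?L ?ps (\<lambda>x. x) ch u" "b \<longrightarrow> ?L \<noteq> []"
      "check Ws z False ?L Es c2" "check Ws z b (removeAll v Vs) Es c1"
    using Split.prems(1) by (auto simp: Let_def)
  have L4: "\<forall>a\<in>set ?L. 4 \<le> a" using Split.prems(2) by auto
  show ?case
  proof (rule bouquet_split[OF fin_graph_window, of "(v, 0)" _ _ "window_verts ?L N"])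
    show "window_verts ?L N = {w \<in> window_verts Vs N. w \<noteq> (v, 0) \<and> \<not> window_adj Es (v, 0) w}"
    proof -
      \<comment> \<open>The split vertex has no neighbour among the ports. Its link therefore
        contains the whole strip and is again a window.\<close>
      have "\<not> window_adj Es (v, 0) (i, j)" if "i < 4" "1 \<le> j" "j \<le> 2 * N" for i j
      proof -
        have "i \<in> set (ports N)" using that by (auto simp: ports_def)
        then show ?thesis using v(3) ps that(2) by (auto simp: window_adj_def)
      qed
      moreover have "window_adj Es (v, 0) (a, 0) \<longleftrightarrow> adj Es v a" for a by (simp add: window_adj_def)
      ultimately show ?thesis by (auto simp: window_verts_def)
    qed
    show "null_chain (window_verts ?L N) (window_verts Vs N - {(v, 0)}) (window_adj Es) (\<lambda>x. x)"
      unfolding window_verts_removeAll[symmetric]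
      by (rule chain_ok_null_chain[OF ch(1) _ L4 ps]) (use Split.prems(2) in auto)
    show "window_verts ?L N \<noteq> {}" if b
    proof -
      have "?L \<noteq> []" using ch(2) that by blast
      then obtain a where "a \<in> set ?L" by (metis hd_in_set)
      then have "(a, 0) \<in> window_verts ?L N" unfolding mem_window_verts .
      then show ?thesis by blast
    qed
    show "bouquet b (window_verts Vs N - {(v, 0)}) (window_adj Es)"
      unfolding window_verts_removeAll[symmetric] using ch(4) Split.prems by (intro Split.IH(1)) auto
    show "bouquet False (window_verts ?L N) (window_adj Es)"
      by (rule Split.IH(2)[OF ch(3) L4 Split.prems(3)])
  qed (use v in simp)
next
  case (Toggle u v fs w c)
  let ?ps = "if z then [] else [0, 1, 2, 3]" and ?P = "\<lambda>y. y \<noteq> u \<and> y \<noteq> v \<and> \<not> adj Es u y \<and> \<not> adj Es v y"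
  have ps: "set ?ps = set (ports N)" using Toggle.prems by (simp add: ports_def)
  have uv: "4 \<le> u" "4 \<le> v" "u \<in> set Vs" "v \<in> set Vs" "u \<noteq> v" using Toggle.prems by auto
  have fs: "folds_ok Es (filter ?P Vs) (filter ?P ?ps) fs w" "check Ws z b Vs (toggle_edge u v Es) c"
    using Toggle.prems(1) by (auto simp: Let_def)
  show ?case
  proof (rule bouquet_toggle_edge[OF _ fin_graph_window, of "(u, 0)" _ _ "(v, 0)" "window_adj (toggle_edge u v Es)"])
    show "infinite (UNIV :: (nat \<times> nat) set)" by (simp add: finite_prod)
    show "window_adj (toggle_edge u v Es) x y \<longleftrightarrow> (if x = (u, 0) \<and> y = (v, 0) \<or> x = (v, 0) \<and> y = (u, 0)
      then \<not> window_adj Es x y else window_adj Es x y)" for x y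
      using uv by (cases x; cases y) (auto simp: window_adj_def adj_toggle_edge)
    let ?Q = "\<lambda>x. x \<noteq> (u, 0) \<and> x \<noteq> (v, 0) \<and> \<not> window_adj Es (u, 0) x \<and> \<not> window_adj Es (v, 0) x"
    have "label y = (u, 0) \<longleftrightarrow> y = u" "label y = (v, 0) \<longleftrightarrow> y = v" for y
      using inj_label[of y u] inj_label[of y v] label_ge[OF uv(1)] label_ge[OF uv(2)] by simp_all
    then have Q: "?Q (label y) \<longleftrightarrow> ?P y" for y using uv(1,2) by simp
    have QD: "?Q x" if "x \<in> deep N" for x using that by auto
    have "{x \<in> label ` A \<union> D. R x} = label ` {y \<in> A. R (label y)} \<union> D"
      if "\<forall>x\<in>D. R x" for A D and R :: "nat \<times> nat \<Rightarrow> bool" using that by blast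
    from this[of "deep N" ?Q "set (Vs @ ports N)"] QD
    have "{x \<in> window_verts Vs N. ?Q x} = label ` {y \<in> set (Vs @ ports N). ?P y} \<union> deep N"
      unfolding window_verts_eq[OF Toggle.prems(2)] Q by blast
    moreover have "{y \<in> set (Vs @ ports N). ?P y} = set (filter ?P Vs @ filter ?P ?ps)"
      unfolding set_append set_filter ps[symmetric] by blast
    ultimately have "{x \<in> window_verts Vs N. ?Q x} = label ` set (filter ?P Vs @ filter ?P ?ps) \<union> deep N"
      by (simp only:)
    moreover have "foldable (window_adj Es) (label ` set (filter ?P Vs @ filter ?P ?ps) \<union> deep N)"
      by (rule folds_ok_foldable[OF fs(1)]) (use Toggle.prems(2) in simp)
    ultimately show "foldable (window_adj Es) {x \<in> window_verts Vs N. ?Q x}" by (simp only:)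
    show "bouquet b (window_verts Vs N) (window_adj (toggle_edge u v Es))"
      by (rule Toggle.IH[OF fs(2) Toggle.prems(2,3)])
  qed (use uv in simp_all)
qed

section \<open>The twelve families of windows\<close>

text \<open>The first two columns of the strip become the window vertices \<open>k, \<dots>, k + 7\<close>.\<close>

definition unroll_verts :: "nat \<Rightarrow> nat list \<Rightarrow> nat list" where
  "unroll_verts k Vs = Vs @ map (\<lambda>i. k + i) [0, 1, 2, 3, 4, 5, 6, 7]"

text \<open>The ports of the old window become the first absorbed column, \<open>k\<close> to
  \<open>k + 3\<close>. Diagonals cross the two middle rows between the absorbed columns and the two
  outer pairs of rows between the second of them and the new ports.\<close>

definition unroll_edges :: "nat \<Rightarrow> (nat \<times> nat) list \<Rightarrow> (nat \<times> nat) list" where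
  "unroll_edges k Es = (let r = (\<lambda>a. if a < 4 then k + a else a) in
     map (\<lambda>(a, b). (r a, r b)) Es @
     map (\<lambda>(a, b). (k + a, k + b)) [(0, 1), (1, 2), (2, 3), (4, 5), (5, 6), (6, 7), (0, 4), (1, 5), (2, 6), (3, 7), (1, 6), (2, 5)] @
     map (\<lambda>(p, b). (p, k + b)) [(0, 4), (1, 5), (2, 6), (3, 7), (1, 4), (0, 5), (3, 6), (2, 7)])"

text \<open>The starting value 3 keeps the fresh label at least 4 for a window without
  vertices.\<close>

definition fresh_label :: "nat list \<Rightarrow> nat" where
  "fresh_label Vs = Suc (foldr max Vs 3)"

text \<open>Edges between two ports are excluded, since \<open>grid_step\<close> alone supplies
  those of the strip; after unrolling, a listed one would become an edge of the gadget.\<close>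

definition window_ok :: "nat list \<Rightarrow> (nat \<times> nat) list \<Rightarrow> bool" where
  "window_ok Vs Es \<longleftrightarrow> (\<forall>a\<in>set Vs. 4 \<le> a) \<and>
     (\<forall>(a, b)\<in>set Es. a < fresh_label Vs \<and> b < fresh_label Vs \<and> (4 \<le> a \<or> 4 \<le> b))"

section \<open>Absorbing two columns into the gadget\<close>

lemma adj_unroll:
  assumes E: "\<forall>(a, b)\<in>set Es. a < k \<and> b < k \<and> (4 \<le> a \<or> 4 \<le> b)" and k: "4 \<le> k"
  shows "4 \<le> a \<Longrightarrow> a < k \<Longrightarrow> 4 \<le> b \<Longrightarrow> b < k \<Longrightarrow> adj (unroll_edges k Es) a b \<longleftrightarrow> adj Es a b"
    and "4 \<le> a \<Longrightarrow> a < k \<Longrightarrow> i < 4 \<Longrightarrow> adj (unroll_edges k Es) a (k + i) \<longleftrightarrow> adj Es a i"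
    and "4 \<le> a \<Longrightarrow> a < k \<Longrightarrow> i < 4 \<Longrightarrow> \<not> adj (unroll_edges k Es) a (k + 4 + i)"
    and "4 \<le> a \<Longrightarrow> a < k \<Longrightarrow> i < 4 \<Longrightarrow> \<not> adj (unroll_edges k Es) a i"
    and "i < 4 \<Longrightarrow> i' < 4 \<Longrightarrow> adj (unroll_edges k Es) (k + i) (k + i') \<longleftrightarrow> i' = Suc i \<or> i = Suc i'"
    and "i < 4 \<Longrightarrow> i' < 4 \<Longrightarrow> adj (unroll_edges k Es) (k + i) (k + 4 + i') \<longleftrightarrow> i = i' \<or> i = 1 \<and> i' = 2 \<or> i = 2 \<and> i' = 1"
    and "i < 4 \<Longrightarrow> i' < 4 \<Longrightarrow> adj (unroll_edges k Es) (k + 4 + i) (k + 4 + i') \<longleftrightarrow> i' = Suc i \<or> i = Suc i'"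
    and "i < 4 \<Longrightarrow> i' < 4 \<Longrightarrow> \<not> adj (unroll_edges k Es) (k + i) i'"
    and "i < 4 \<Longrightarrow> i' < 4 \<Longrightarrow> adj (unroll_edges k Es) (k + 4 + i) i' \<longleftrightarrow>
      i = i' \<or> i = 0 \<and> i' = 1 \<or> i = 1 \<and> i' = 0 \<or> i = 2 \<and> i' = 3 \<or> i = 3 \<and> i' = 2"
proof -
  define r where "r = (\<lambda>a. if a < 4 then k + a else a)"
  \<comment> \<open>On the labels from 4 to \<open>k + 3\<close>, \<open>s\<close> inverts the
    renaming \<open>r\<close>: the labels \<open>k\<close> to \<open>k + 3\<close> go back to the
    ports 0 to 3.\<close>
  define s where "s = (\<lambda>x. if k \<le> x then x - k else x)"
  let ?A = "set [(0, 1), (1, 2), (2, 3), (4, 5), (5, 6), (6, 7), (0, 4), (1, 5), (2, 6), (3, 7), (1, 6), (2, 5)] :: (nat \<times> nat) set"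
  let ?B = "set [(0, 4), (1, 5), (2, 6), (3, 7), (1, 4), (0, 5), (3, 6), (2, 7)] :: (nat \<times> nat) set"
  have sr: "s (r a) = a" "4 \<le> r a" "r a < k + 4" if "a < k" for a using that k by (auto simp: r_def s_def)
  have rs: "r (s x) = x" if "4 \<le> x" "x < k + 4" for x using that by (auto simp: r_def s_def)
  have E1: "a < k" "b < k" "4 \<le> a \<or> 4 \<le> b" if "(a, b) \<in> set Es" for a b using E that by auto
  have Es: "(x, y) \<in> (\<lambda>(a, b). (r a, r b)) ` set Es \<longleftrightarrow>
      4 \<le> x \<and> x < k + 4 \<and> 4 \<le> y \<and> y < k + 4 \<and> (s x, s y) \<in> set Es" for x y
  proof
    assume "(x, y) \<in> (\<lambda>(a, b). (r a, r b)) ` set Es"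
    then obtain a b where "(a, b) \<in> set Es" "x = r a" "y = r b" by auto
    then show "4 \<le> x \<and> x < k + 4 \<and> 4 \<le> y \<and> y < k + 4 \<and> (s x, s y) \<in> set Es"
      using E1[of a b] sr[of a] sr[of b] by simp
  next
    assume "4 \<le> x \<and> x < k + 4 \<and> 4 \<le> y \<and> y < k + 4 \<and> (s x, s y) \<in> set Es"
    then show "(x, y) \<in> (\<lambda>(a, b). (r a, r b)) ` set Es"
      using rs[of x] rs[of y] by (intro image_eqI[where x = "(s x, s y)"]) simp_all
  qed
  have A: "(x, y) \<in> (\<lambda>(a, b). (k + a, k + b)) ` ?A \<longleftrightarrow> k \<le> x \<and> k \<le> y \<and> (x - k, y - k) \<in> ?A" for x y
  proof
    assume "k \<le> x \<and> k \<le> y \<and> (x - k, y - k) \<in> ?A"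
    then show "(x, y) \<in> (\<lambda>(a, b). (k + a, k + b)) ` ?A"
      by (intro image_eqI[where x = "(x - k, y - k)"]) simp_all
  qed (clarify, simp only: le_add1 add_diff_cancel_left' simp_thms)
  have B: "(x, y) \<in> (\<lambda>(a, b). (a, k + b)) ` ?B \<longleftrightarrow> k \<le> y \<and> (x, y - k) \<in> ?B" for x y
  proof
    assume "k \<le> y \<and> (x, y - k) \<in> ?B"
    then show "(x, y) \<in> (\<lambda>(a, b). (a, k + b)) ` ?B"
      by (intro image_eqI[where x = "(x, y - k)"]) simp_all
  qed (clarify, simp only: le_add1 add_diff_cancel_left' simp_thms)
  have mem: "(x, y) \<in> set (unroll_edges k Es) \<longleftrightarrow>
      4 \<le> x \<and> x < k + 4 \<and> 4 \<le> y \<and> y < k + 4 \<and> (s x, s y) \<in> set Es \<or>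
      k \<le> x \<and> k \<le> y \<and> (x - k, y - k) \<in> ?A \<or> k \<le> y \<and> (x, y - k) \<in> ?B" for x y
    unfolding unroll_edges_def Let_def set_append set_map r_def[symmetric] Un_iff Es A B by blast
  have i4: "i = 0 \<or> i = 1 \<or> i = 2 \<or> i = 3" if "i < 4" for i :: nat using that by auto
  have small: "(i, i') \<notin> set Es" if "i < 4" "i' < 4" for i i' using E1(3)[of i i'] that by auto
  show "adj (unroll_edges k Es) a b \<longleftrightarrow> adj Es a b" if "4 \<le> a" "a < k" "4 \<le> b" "b < k"
    using that by (auto simp: adj_def mem s_def)
  show "adj (unroll_edges k Es) a (k + i) \<longleftrightarrow> adj Es a i" if "4 \<le> a" "a < k" "i < 4" for i
    using that by (auto simp: adj_def mem s_def)
  show "\<not> adj (unroll_edges k Es) a (k + 4 + i)" if "4 \<le> a" "a < k" "i < 4" for i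
    using that by (auto simp: adj_def mem s_def)
  show "\<not> adj (unroll_edges k Es) a i" if "4 \<le> a" "a < k" "i < 4" for i
    using that k by (auto simp: adj_def mem s_def)
  show "adj (unroll_edges k Es) (k + i) (k + i') \<longleftrightarrow> i' = Suc i \<or> i = Suc i'" if "i < 4" "i' < 4" for i i'
    using i4[OF that(1)] i4[OF that(2)] k small by (elim disjE) (simp_all add: adj_def mem s_def)
  show "adj (unroll_edges k Es) (k + i) (k + 4 + i') \<longleftrightarrow> i = i' \<or> i = 1 \<and> i' = 2 \<or> i = 2 \<and> i' = 1"
    if "i < 4" "i' < 4" for i i'
    using i4[OF that(1)] i4[OF that(2)] k by (elim disjE) (simp_all add: adj_def mem)
  show "adj (unroll_edges k Es) (k + 4 + i) (k + 4 + i') \<longleftrightarrow> i' = Suc i \<or> i = Suc i'" if "i < 4" "i' < 4" for i i'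
    using i4[OF that(1)] i4[OF that(2)] k by (elim disjE) (simp_all add: adj_def mem)
  show "\<not> adj (unroll_edges k Es) (k + i) i'" if "i < 4" "i' < 4" for i i'
    using i4[OF that(1)] i4[OF that(2)] k by (elim disjE) (simp_all add: adj_def mem)
  show "adj (unroll_edges k Es) (k + 4 + i) i' \<longleftrightarrow>
      i = i' \<or> i = 0 \<and> i' = 1 \<or> i = 1 \<and> i' = 0 \<or> i = 2 \<and> i' = 3 \<or> i = 3 \<and> i' = 2" if "i < 4" "i' < 4" for i i'
    using i4[OF that(1)] i4[OF that(2)] k by (elim disjE) (simp_all add: adj_def mem)
qed

lemma bouquet_unroll:
  assumes V: "\<forall>a\<in>set Vs. 4 \<le> a \<and> a < k" and E: "\<forall>(a, b)\<in>set Es. a < k \<and> b < k \<and> (4 \<le> a \<or> 4 \<le> b)" and k: "4 \<le> k"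
    and B: "bouquet b (window_verts (unroll_verts k Vs) N) (window_adj (unroll_edges k Es))"
  shows "bouquet b (window_verts Vs (Suc N)) (window_adj Es)"
proof (rule bouquet_relabel[OF fin_graph_window _ _ B])
  note U = adj_unroll[OF E k]
  let ?U = "unroll_edges k Es"
  \<comment> \<open>Columns 1 and 2 move into column 0 under the labels \<open>k + a\<close> and
    \<open>k + 4 + a\<close>; all later columns move left by two.\<close>
  define f where "f = (\<lambda>(a, j). if j = 0 then (a, 0) else if j = 1 then (k + a, 0)
     else if j = 2 then (k + 4 + a, 0) else (a, j - 2 :: nat))"
  define h where "h = (\<lambda>(a, j). if j = 0 then (if a < k then (a, 0) else if a < k + 4 then (a - k, 1) else (a - (k + 4), 2))
     else (a, j + 2 :: nat))"
  have f0: "f (a, 0) = (a, 0)" "f (i, Suc 0) = (k + i, 0)" "f (i, 2) = (k + 4 + i, 0)" for a i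
    by (simp_all add: f_def)
  have f3: "f (i, j) = (i, j - 2)" if "3 \<le> j" for i j using that by (simp add: f_def)
  have W: "window_verts (unroll_verts k Vs) N =
      (\<lambda>a. (a, 0)) ` set Vs \<union> {(k + i, 0) | i. i < 4} \<union> {(k + 4 + i, 0) | i. i < 4} \<union> {(i, j). i < 4 \<and> 1 \<le> j \<and> j \<le> 2 * N}"
  proof -
    have "(\<lambda>i. k + i) ` set [0, 1, 2, 3, 4, 5, 6, 7] = {k + i | i. i < 4} \<union> {k + 4 + i | i. i < 4}"
    proof -
      have "set [0, 1, 2, 3, 4, 5, 6, 7] = {i. i < 4} \<union> (\<lambda>i. 4 + i) ` {i. i < (4::nat)}"
        by (auto simp: numeral_eq_Suc less_Suc_eq image_iff)
      then show ?thesis by (auto simp: image_iff add.assoc)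
    qed
    then show ?thesis unfolding window_verts_def unroll_verts_def set_append set_map by auto
  qed
  have cases: "(\<exists>a\<in>set Vs. x = (a, 0)) \<or> (\<exists>i<4. x = (i, Suc 0)) \<or> (\<exists>i<4. x = (i, 2)) \<or>
      (\<exists>i j. i < 4 \<and> 3 \<le> j \<and> j \<le> 2 * Suc N \<and> x = (i, j))" if x: "x \<in> window_verts Vs (Suc N)" for x
  proof -
    obtain i j where ij: "x = (i, j)" by (cases x)
    consider "j = 0" | "j = 1" | "j = 2" | "3 \<le> j" by linarith
    then show ?thesis by cases (use x ij in \<open>auto simp: window_verts_def\<close>)
  qed
  show "bij_betw f (window_verts Vs (Suc N)) (window_verts (unroll_verts k Vs) N)"
  proof (rule bij_betw_byWitness[where f' = h])
    show "\<forall>x\<in>window_verts Vs (Suc N). h (f x) = x"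
    proof
      fix x assume "x \<in> window_verts Vs (Suc N)"
      from cases[OF this] show "h (f x) = x"
        by (elim disjE bexE exE conjE) (use V in \<open>auto simp: f_def h_def\<close>)
    qed
    show "\<forall>y\<in>window_verts (unroll_verts k Vs) N. f (h y) = y"
      unfolding W using V by (auto simp: f_def h_def)
    show "f ` window_verts Vs (Suc N) \<subseteq> window_verts (unroll_verts k Vs) N"
    proof
      fix y assume "y \<in> f ` window_verts Vs (Suc N)"
      then obtain x where x: "x \<in> window_verts Vs (Suc N)" "y = f x" by blast
      from cases[OF x(1)] show "y \<in> window_verts (unroll_verts k Vs) N"
        unfolding W x(2) by (elim disjE bexE exE conjE) (auto simp: f_def)
    qed
    show "h ` window_verts (unroll_verts k Vs) N \<subseteq> window_verts Vs (Suc N)"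
      unfolding W using V by (auto simp: h_def window_verts_def)
  qed
  have WW: "window_adj Es (a, 0) (b, 0) \<longleftrightarrow> window_adj ?U (a, 0) (b, 0)" if "a \<in> set Vs" "b \<in> set Vs" for a b
    using U(1)[of a b] V that by simp
  have W1: "window_adj Es (a, 0) (i, Suc 0) \<longleftrightarrow> window_adj ?U (a, 0) (k + i, 0)" if "a \<in> set Vs" "i < 4" for a i
    using U(2)[of a i] V that by (simp add: window_adj_def)
  have W2: "window_adj Es (a, 0) (i, 2) \<longleftrightarrow> window_adj ?U (a, 0) (k + 4 + i, 0)" if "a \<in> set Vs" "i < 4" for a i
    using U(3)[of a i] V that by (simp add: window_adj_def)
  have W3: "window_adj Es (a, 0) (i, j) \<longleftrightarrow> window_adj ?U (a, 0) (i, j - 2)" if "a \<in> set Vs" "i < 4" "3 \<le> j" for a i j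
    using U(4)[of a i] V that by (auto simp: window_adj_def)
  have C11: "window_adj Es (i, Suc 0) (i', Suc 0) \<longleftrightarrow> window_adj ?U (k + i, 0) (k + i', 0)" if "i < 4" "i' < 4" for i i'
    using U(5)[OF that] by (auto simp: window_adj_def grid_step_def)
  have C12: "window_adj Es (i, Suc 0) (i', 2) \<longleftrightarrow> window_adj ?U (k + i, 0) (k + 4 + i', 0)" if "i < 4" "i' < 4" for i i'
  proof -
    have "i = 0 \<or> i = 1 \<or> i = 2 \<or> i = 3" "i' = 0 \<or> i' = 1 \<or> i' = 2 \<or> i' = 3" using that by auto
    then have "grid_step (i, Suc 0) (i', 2) \<or> grid_step (i', 2) (i, Suc 0) \<longleftrightarrow> i = i' \<or> i = 1 \<and> i' = 2 \<or> i = 2 \<and> i' = 1"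
      by (elim disjE; simp add: grid_step_def)
    then show ?thesis using U(6)[OF that] by (simp add: window_adj_def)
  qed
  have C13: "window_adj Es (i, Suc 0) (i', j) \<longleftrightarrow> window_adj ?U (k + i, 0) (i', j - 2)" if "i < 4" "i' < 4" "3 \<le> j" for i i' j
    using U(8)[OF that(1,2)] that(3) by (auto simp: window_adj_def grid_step_def)
  have C22: "window_adj Es (i, 2) (i', 2) \<longleftrightarrow> window_adj ?U (k + 4 + i, 0) (k + 4 + i', 0)" if "i < 4" "i' < 4" for i i'
    using U(7)[OF that] by (auto simp: window_adj_def grid_step_def)
  have C23: "window_adj Es (i, 2) (i', j) \<longleftrightarrow> window_adj ?U (k + 4 + i, 0) (i', j - 2)" if "i < 4" "i' < 4" "3 \<le> j" for i i' j
  proof (cases "j = 3")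
    case True
    have "i = 0 \<or> i = 1 \<or> i = 2 \<or> i = 3" "i' = 0 \<or> i' = 1 \<or> i' = 2 \<or> i' = 3" using that by auto
    then have "grid_step (i, 2) (i', 3) \<or> grid_step (i', 3) (i, 2) \<longleftrightarrow>
        i = i' \<or> i = 0 \<and> i' = 1 \<or> i = 1 \<and> i' = 0 \<or> i = 2 \<and> i' = 3 \<or> i = 3 \<and> i' = 2"
      by (elim disjE; simp add: grid_step_def)
    then show ?thesis using U(9)[OF that(1,2)] that True by (simp add: window_adj_def)
  next
    case False
    then show ?thesis using that by (auto simp: window_adj_def grid_step_def)
  qed
  \<comment> \<open>A shift by two columns preserves the parities in
    \<open>grid_step\<close>.\<close>
  have C33: "window_adj Es (i, j) (i', j') \<longleftrightarrow> window_adj ?U (i, j - 2) (i', j' - 2)" if "3 \<le> j" "3 \<le> j'" for i i' j j'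
  proof -
    have "j = (j - 3) + 3" "j' = (j' - 3) + 3" using that by simp_all
    then obtain m m' where "j = m + 3" "j' = m' + 3" by blast
    then show ?thesis by (simp add: window_adj_def grid_step_def)
  qed
  have le: "window_adj Es x y \<longleftrightarrow> window_adj ?U (f x) (f y)"
    if "x \<in> window_verts Vs (Suc N)" "y \<in> window_verts Vs (Suc N)" "snd x \<le> snd y" for x y
    using cases[OF that(1)] cases[OF that(2)] that(3)
    by (elim disjE bexE exE conjE)
      (simp_all add: f0 f3 WW W1 W2 W3 C11 C12 C13 C22 C23 C33 del: window_adj_column0)
  show "window_adj Es x y \<longleftrightarrow> window_adj ?U (f x) (f y)"
    if xy: "x \<in> window_verts Vs (Suc N)" "y \<in> window_verts Vs (Suc N)" for x y
    using le[OF xy] le[OF xy(2,1)] window_adj_sym nat_le_linear by metis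
qed

lemma window_ok_fresh:
  assumes "window_ok Vs Es"
  shows "\<forall>a\<in>set Vs. 4 \<le> a \<and> a < fresh_label Vs" "4 \<le> fresh_label Vs"
proof -
  have "a \<le> foldr max Vs 3" if "a \<in> set Vs" for a using that by (induction Vs) auto
  moreover have "3 \<le> foldr max Vs (3::nat)" by (induction Vs) auto
  ultimately show "\<forall>a\<in>set Vs. 4 \<le> a \<and> a < fresh_label Vs" "4 \<le> fresh_label Vs"
    using assms by (auto simp: window_ok_def fresh_label_def less_Suc_eq_le)
qed

text \<open>The windows of the theorem have the indices 0 to 7, in the order of its statement. The windows 8
  to 10 arise in the reductions, and 11 is window 5 after one unrolling. The flag is
  \<open>False\<close> if the window without strip has an empty or disconnected complex.\<close>

definition families :: "(bool \<times> window) list" where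
  "families = [
    (False, [], []),
    (True, [4, 5, 6, 7], [(0, 4), (0, 5), (1, 4), (1, 5), (2, 6), (2, 7), (3, 6), (3, 7), (4,
      5), (5, 6), (6, 7)]),
    (True, [4, 5], [(0, 4), (1, 4), (2, 5), (3, 5)]),
    (True, [4, 5, 6, 7, 8, 9], [(0, 6), (0, 7), (1, 6), (1, 7), (2, 8), (2, 9), (3, 8), (3, 9),
      (4, 5), (4, 7), (4, 8), (5, 9), (6, 7), (7, 8), (8, 9)]),
    (True, [4], [(2, 4), (3, 4)]),
    (False, [4, 5], [(0, 4), (1, 4), (2, 5), (3, 5), (4, 5)]),
    (True, [4], [(0, 4), (1, 4), (2, 4), (3, 4)]),
    (False, [4, 5, 6], [(0, 4), (1, 4), (2, 5), (2, 6), (3, 5), (3, 6), (4, 5), (5, 6)]),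
    (True, [4, 5, 6], [(0, 5), (1, 5), (2, 6), (3, 6), (4, 5)]),
    (True, [4, 5, 6, 7], [(0, 4), (1, 4), (2, 7), (3, 7), (4, 5), (5, 6), (6, 7)]),
    (True, [4, 5, 6, 7, 8, 9], [(0, 4), (1, 4), (2, 9), (3, 9), (4, 5), (5, 6), (6, 7), (7, 8),
      (8, 9)]),
    (True, [4, 5, 6, 7, 8, 9, 10, 11, 12, 13], [(0, 10), (0, 11), (1, 10), (1, 11), (2, 12), (2,
      13), (3, 12), (3, 13), (4, 5), (4, 6), (4, 7), (5, 8), (5, 9), (6, 7), (6, 10), (7, 8),
      (7, 11), (7, 12), (8, 9), (8, 11), (8, 12), (9, 13), (10, 11), (11, 12), (12, 13)])]"

text \<open>Entry \<open>k\<close> reduces window \<open>k\<close> after one unrolling; labels from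
  \<open>fresh_label\<close> on are the absorbed columns. For window 0 two folds leave the path 8,
  4, 5, 6, 7, 11, which is window 10. The entry of window 5 merely recognises window 11, so that its
  reduction takes place after a second unrolling. Edges are toggled only for windows 10 and
  11.\<close>

definition step_certs :: "cert list" where
  "step_certs = [
    Fold 4 9 (Fold 7 10 (Leaf 10 [(4, 5), (5, 6), (6, 7), (7, 8), (8, 4), (11, 9)] False)),
    Split 8 [] 4 (Split 5 [] 4 (Fold 4 14 (Fold 4 13 (Fold 4 10 (Edge 4 9 (Split 6 [] 7 (Fold 7
      15 (Edge 7 11 (Leaf 4 [(12, 4)] True))) (Leaf 2 [(12, 4), (15, 5)] False)))))) (Split 10
      [] 7 (Fold 7 15 (Edge 7 11 (Leaf 7 [(12, 6), (13, 5), (14, 4)] True))) (Leaf 2 [(12, 4),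
      (15, 5)] False))) (Split 6 [] 7 (Split 10 [] 7 (Fold 7 15 (Edge 7 11 (Leaf 5 [(13, 4),
      (14, 5)] False))) (Leaf 4 [(15, 4)] False)) (Leaf 7 [(13, 4), (14, 5), (15, 6)] False)),
    Split 6 [] 4 (Fold 4 12 (Fold 4 11 (Fold 4 8 (Edge 4 7 (Fold 5 13 (Edge 5 9 (Leaf 4 [(10,
      4)] True))))))) (Split 8 [] 5 (Fold 5 13 (Edge 5 9 (Leaf 5 [(11, 4), (12, 5)] False)))
      (Leaf 4 [(13, 4)] False)),
    Fold 5 8 (Split 7 [(13, 5), (12, 5)] 6 (Fold 4 9 (Edge 4 5 (Fold 13 16 (Split 10 [] 6 (Fold
      6 15 (Fold 6 12 (Edge 6 11 (Leaf 8 [(13, 4), (14, 6), (17, 5)] True)))) (Leaf 9 [(12, 5),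
      (13, 6), (15, 4), (17, 7)] False))))) (Fold 5 13 (Fold 5 12 (Edge 5 9 (Leaf 1 [(14, 4),
      (15, 5), (16, 6), (17, 7)] False))))),
    Fold 5 10 (Split 7 [] 4 (Fold 4 12 (Edge 4 8 (Leaf 9 [(5, 5), (6, 6), (9, 4), (11, 7)]
      False))) (Leaf 8 [(5, 4), (9, 5), (12, 6)] False)),
    Leaf 11 [(4, 4), (5, 5), (6, 6), (7, 7), (8, 8), (9, 9), (10, 10), (11, 11), (12, 12), (13,
      13)] False,
    Split 4 [(10, 5), (10, 7), (10, 9), (11, 8)] 6 (Fold 5 10 (Fold 8 11 (Leaf 10 [(5, 5), (6,
      6), (7, 7), (8, 8), (9, 4), (12, 9)] False))) (Leaf 1 [(9, 4), (10, 5), (11, 6), (12, 7)]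
      False),
    Split 5 [(12, 7)] 6 (Split 7 [] 4 (Fold 4 13 (Fold 4 12 (Fold 4 9 (Edge 4 8 (Fold 6 14 (Edge
      6 10 (Leaf 4 [(11, 4)] True))))))) (Split 9 [] 6 (Fold 6 14 (Edge 6 10 (Leaf 5 [(12, 4),
      (13, 5)] False))) (Leaf 4 [(14, 4)] False))) (Leaf 3 [(7, 5), (8, 4), (11, 9), (12, 8),
      (13, 7), (14, 6)] True),
    Fold 4 8 (Fold 4 7 (Edge 4 5 (Split 9 [] 6 (Fold 6 14 (Edge 6 10 (Leaf 7 [(11, 6), (12, 5),
      (13, 4)] True))) (Leaf 2 [(11, 4), (14, 5)] False)))),
    Split 4 [(11, 6), (10, 6), (7, 5), (13, 8), (13, 10), (13, 12), (14, 11)] 9 (Fold 5 7 (Edge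
      5 6 (Fold 8 13 (Fold 11 14 (Leaf 10 [(8, 5), (9, 6), (10, 7), (11, 8), (12, 4), (15, 9)]
      False))))) (Fold 6 11 (Fold 6 10 (Edge 6 7 (Leaf 1 [(12, 4), (13, 5), (14, 6), (15, 7)]
      False)))),
    Split 11 [(7, 5), (13, 8), (6, 4), (8, 12), (13, 12)] 7 (Toggle 14 17 [(4, 6), (7, 9)] 12
      (Split 12 [(6, 8), (10, 5), (14, 13), (5, 10), (10, 10), (6, 6), (8, 6), (14, 15)] 9
      (Split 5 [(9, 7), (17, 10), (15, 10)] 13 (Fold 4 14 (Edge 4 10 (Fold 6 8 (Edge 6 7 (Fold 9
      17 (Edge 9 13 (Leaf 5 [(15, 4), (16, 5)] False))))))) (Fold 7 9 (Edge 7 8 (Fold 10 17 (Iso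
      13))))) (Fold 8 6 (Fold 5 10 (Edge 4 5 (Edge 7 8 (Leaf 5 [(14, 4), (17, 5)] False)))))))
      (Fold 5 7 (Edge 5 6 (Fold 8 13 (Edge 8 9 (Leaf 2 [(14, 4), (17, 5)] False))))),
    Split 11 [(5, 6), (17, 9), (16, 9), (4, 10), (9, 12), (16, 12), (17, 12)] 5 (Toggle 4 13 []
      8 (Split 8 [(4, 9), (4, 7)] 5 (Fold 5 13 (Fold 9 4 (Edge 5 9 (Split 10 [(17, 7), (16, 7),
      (12, 6), (19, 14), (19, 16), (19, 18), (20, 17)] 15 (Fold 6 12 (Edge 6 7 (Fold 14 19 (Fold
      17 20 (Leaf 10 [(14, 5), (15, 6), (16, 7), (17, 8), (18, 4), (21, 9)] False))))) (Fold 7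
      17 (Fold 7 16 (Edge 7 12 (Leaf 1 [(18, 4), (19, 5), (20, 6), (21, 7)] False)))))))) (Split
      10 [(17, 4), (16, 4), (13, 6), (19, 14), (19, 16), (19, 18), (20, 17)] 15 (Fold 6 13 (Edge
      4 6 (Fold 14 19 (Fold 17 20 (Leaf 10 [(14, 5), (15, 6), (16, 7), (17, 8), (18, 4), (21,
      9)] False))))) (Fold 4 17 (Fold 4 16 (Edge 4 13 (Leaf 1 [(18, 4), (19, 5), (20, 6), (21,
      7)] False))))))) (Fold 6 5 (Edge 4 6 (Fold 9 17 (Fold 9 16 (Edge 9 13 (Leaf 1 [(18, 4),
      (19, 5), (20, 6), (21, 7)] False))))))]"

text \<open>Reductions of the bare gadgets, with no strip attached. They are checked against an
  empty list of known windows, so none of them rests on a leaf.\<close>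

definition base_certs :: "cert list" where
  "base_certs = [
    Empty,
    Fold 4 6 (Iso 7),
    Iso 4,
    Fold 5 8 (Fold 6 4 (Edge 5 9 (Edge 6 7 Empty))),
    Iso 4,
    Edge 4 5 Empty,
    Iso 4,
    Fold 4 6 (Edge 4 5 Empty),
    Iso 6,
    Fold 4 6 (Iso 7),
    Fold 4 6 (Edge 4 5 (Fold 7 9 (Edge 7 8 Empty))),
    Fold 10 7 (Fold 13 8 (Split 4 [(12, 9), (11, 6), (9, 12), (12, 12)] 5 (Fold 5 13 (Edge 5 9
      (Fold 6 11 (Iso 12)))) (Fold 9 12 (Edge 9 13 (Edge 10 11 Empty)))))]"

text \<open>The target flag is \<open>True\<close> for all twelve windows: once two columns have
  been absorbed, the complex itself is connected and a wedge of spheres.\<close>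

definition step_ok :: "nat \<Rightarrow> bool" where
  "step_ok k \<longleftrightarrow> (case families ! k of (_, Vs, Es) \<Rightarrow>
     check families False True (unroll_verts (fresh_label Vs) Vs) (unroll_edges (fresh_label Vs) Es) (step_certs ! k))"

lemma families_window_ok: "\<forall>(_, Vs, Es)\<in>set families. window_ok Vs Es"
  by code_simp

lemma base_certs_ok: "\<forall>k\<in>set [0..<12]. case families ! k of (b, Vs, Es) \<Rightarrow> check [] True b Vs Es (base_certs ! k)"
  by code_simp

lemma step_ok_0: "step_ok 0"
  by code_simp

lemma step_ok_1: "step_ok 1"
  by code_simp

lemma step_ok_2: "step_ok 2"
  by code_simp

lemma step_ok_3: "step_ok 3"
  by code_simp

lemma step_ok_4: "step_ok 4"
  by code_simp

lemma step_ok_5: "step_ok 5"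
  by code_simp

lemma step_ok_6: "step_ok 6"
  by code_simp

lemma step_ok_7: "step_ok 7"
  by code_simp

lemma step_ok_8: "step_ok 8"
  by code_simp

lemma step_ok_9: "step_ok 9"
  by code_simp

lemma step_ok_10: "step_ok 10"
  by code_simp

lemma step_ok_11: "step_ok 11"
  by code_simp

lemma length_families: "length families = 12"
  by (simp add: families_def)

lemma step_ok: "k < 12 \<Longrightarrow> step_ok k"
  using step_ok_0 step_ok_1 step_ok_2 step_ok_3 step_ok_4 step_ok_5 step_ok_6 step_ok_7 step_ok_8 step_ok_9
    step_ok_10 step_ok_11
  by (auto simp: numeral_eq_Suc less_Suc_eq)

text \<open>The leaves of one window refer to others on the shorter strip, so the induction on
  \<open>N\<close> treats all windows together. The weaker flag survives only for
  \<open>N = 0\<close>, where window 0 is empty and windows 5 and 7 give 0-spheres up to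
  homotopy.\<close>

theorem families_bouquet:
  assumes "k < 12" "families ! k = (b, Vs, Es)"
  shows "bouquet (N \<noteq> 0 \<or> b) (window_verts Vs N) (window_adj Es)"
  using assms
proof (induction N arbitrary: k b Vs Es)
  case 0
  have "check [] True b Vs Es (base_certs ! k)" using base_certs_ok 0 by force
  moreover have "window_ok Vs Es" using families_window_ok 0 length_families by (metis (mono_tags, lifting) case_prodD nth_mem)
  ultimately show ?case
    using check_sound[of "[]" True b Vs Es "base_certs ! k" 0] by (simp add: window_ok_def)
next
  case (Suc N)
  have ok: "window_ok Vs Es" using families_window_ok Suc.prems length_families by (metis (mono_tags, lifting) case_prodD nth_mem)
  let ?k = "fresh_label Vs"
  have "check families False True (unroll_verts ?k Vs) (unroll_edges ?k Es) (step_certs ! k)"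
    using step_ok[OF Suc.prems(1)] Suc.prems(2) by (simp add: step_ok_def)
  then have c: "check families (N = 0) True (unroll_verts ?k Vs) (unroll_edges ?k Es) (step_certs ! k)"
    using check_no_ports by (cases "N = 0") auto
  have "bouquet True (window_verts (unroll_verts ?k Vs) N) (window_adj (unroll_edges ?k Es))"
  proof (rule check_sound[OF c])
    show "\<forall>a\<in>set (unroll_verts ?k Vs). 4 \<le> a"
      using window_ok_fresh[OF ok] by (auto simp: unroll_verts_def)
    fix i assume i: "i < length families"
    obtain b' Vs' Es' where f: "families ! i = (b', Vs', Es')" by (cases "families ! i")
    \<comment> \<open>Leaves may rely only on the listed flag, which is the one valid at
      \<open>N = 0\<close>; for larger \<open>N\<close> the induction hypothesis is stronger and is
      weakened.\<close>
    have "bouquet b' (window_verts Vs' N) (window_adj Es')"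
      using Suc.IH[OF _ f] i length_families bouquet_weaken by (cases b') auto
    moreover have "window_ok Vs' Es'" using families_window_ok i f by (metis (mono_tags, lifting) case_prodD nth_mem)
    ultimately show "(\<forall>a\<in>set (fst (snd (families ! i))). 4 \<le> a) \<and>
       bouquet (fst (families ! i)) (window_verts (fst (snd (families ! i))) N) (window_adj (snd (snd (families ! i))))"
      by (simp add: f window_ok_def)
  qed simp
  then have "bouquet True (window_verts Vs (Suc N)) (window_adj Es)"
    by (rule bouquet_unroll[rotated -1]) (use ok window_ok_fresh[OF ok] in \<open>auto simp: window_ok_def\<close>)
  then show ?case by simp
qed

section \<open>The graphs of the theorem\<close>

text \<open>Index \<open>i\<close> becomes \<open>3 + i\<close>, in agreement with the numbering of
  windows 1 to 7 from 4 on. The value at grid vertices is a dummy; they are located by their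
  coordinates.\<close>

primrec gadget_label :: "vertex \<Rightarrow> nat" where
  "gadget_label (vertex.g i j) = 0"
| "gadget_label (vertex.l i) = 3 + i"
| "gadget_label (vertex.a i) = 3 + i"
| "gadget_label (vertex.b i) = 3 + i"
| "gadget_label (vertex.c i) = 3 + i"
| "gadget_label (vertex.d i) = 3 + i"
| "gadget_label (vertex.e i) = 3 + i"
| "gadget_label (vertex.f i) = 3 + i"

definition grid_edges :: "nat \<Rightarrow> vertex set set" where
  "grid_edges n = snd (tilde n (Gamma5 n))"

text \<open>The edges of \<open>Gamma5\<close> together with those of the additional column form one
  uniform pattern, although the definitions list them separately.\<close>

lemma grid_edges_iff:
  assumes "i < 4" "i' < 4" "1 \<le> j" "1 \<le> j'" "j \<le> 2 * n + 2" "j' \<le> 2 * n + 2"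
  shows "{vertex.g (Suc i) j, vertex.g (Suc i') j'} \<in> grid_edges n \<longleftrightarrow>
    grid_step (i, j) (i', j') \<or> grid_step (i', j') (i, j)"
proof -
  \<comment> \<open>The edge families of \<open>Gamma5\<close> and \<open>tilde\<close>, each with
    an orientation and with rows counted from 1; the two families of diagonals are distinguished by
    which end has the larger row.\<close>
  define D where "D = (\<lambda>i j i' j'.
      i' = i + 1 \<and> j' = j \<and> i \<in> {1..3} \<and> j \<in> {1..2*n+1} \<or>
      i' = i \<and> j' = j + 1 \<and> i \<in> {1..4} \<and> j \<in> {1..2*n} \<or>
      i' = i + 1 \<and> j' = j + 1 \<and> i \<in> {1..3} \<and> j \<in> {1..2*n} \<and> odd (i + j) \<or>
      i = i' + 1 \<and> j' = j + 1 \<and> i' \<in> {1..3} \<and> j \<in> {1..2*n} \<and> odd (i' + j) \<or>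
      i' = i \<and> j = 2*n+1 \<and> j' = 2*n+2 \<and> i \<in> {1..4} \<or>
      i' = i + 1 \<and> j = 2*n+2 \<and> j' = 2*n+2 \<and> i \<in> {1..3} \<or>
      j = 2*n+1 \<and> j' = 2*n+2 \<and> (i = 2 \<and> i' = 3 \<or> i = 3 \<and> i' = (2::nat)))"
  have "{vertex.g i j, vertex.g i' j'} \<in> grid_edges n \<longleftrightarrow> D i j i' j' \<or> D i' j' i j" for i j i' j'
    unfolding grid_edges_def tilde_def Gamma5_def graph_extend_def snd_conv Un_iff insert_iff mem_Collect_eq
      doubleton_eq_iff vertex.inject D_def empty_iff odd_iff_mod_2_eq_one
    by (intro iffI; elim disjE exE conjE; simp; blast)
  moreover have i4: "i = 0 \<or> i = 1 \<or> i = 2 \<or> i = 3" if "i < 4" for i :: nat using that by auto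
  have "D (Suc i) j (Suc i') j' \<longleftrightarrow> grid_step (i, j) (i', j')"
    if "i < 4" "i' < 4" "1 \<le> j" "1 \<le> j'" "j \<le> 2 * n + 2" "j' \<le> 2 * n + 2" for i j i' j'
  proof -
    have "j \<le> 2 * n \<or> j = 2 * n + 1" if "j' = Suc j" using that \<open>j' \<le> 2 * n + 2\<close> by auto
    then consider "j' = j" | "j' = Suc j" "j \<le> 2 * n" | "j' = Suc j" "j = 2 * n + 1" | "j' \<noteq> j" "j' \<noteq> Suc j"
      by blast
    then show ?thesis
    proof cases
      case 1 then show ?thesis using that by (auto simp: D_def grid_step_def)
    next
      case 2
      show ?thesis using \<open>1 \<le> j\<close> 2(2) i4[OF \<open>i < 4\<close>] i4[OF \<open>i' < 4\<close>] unfolding 2(1)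
        by (elim disjE; simp add: D_def grid_step_def)
    next
      \<comment> \<open>The left column 2n+1 is odd, so the parity condition admits only the row
        indices 1 and 2, in both directions: the two diagonals listed in
        \<open>tilde\<close>.\<close>
      case 3
      then show ?thesis using i4[OF \<open>i < 4\<close>] i4[OF \<open>i' < 4\<close>] unfolding 3 by (elim disjE; simp add: D_def grid_step_def)
    next
      case 4 then show ?thesis by (auto simp: D_def grid_step_def)
    qed
  qed
  ultimately show ?thesis using assms by simp
qed

lemma fst_tilde_extend: "fst (tilde n (graph_extend (Gamma5 n) V F)) =
   V \<union> {vertex.g i j | i j. i \<in> {1..4} \<and> 1 \<le> j \<and> j \<le> 2 * n + 2}"
proof -
  have "j \<le> 2 * n + 1 \<or> j = 2 * n + 2" if "j \<le> 2 * n + 2" for j using that by auto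
  then show ?thesis by (auto simp: tilde_def graph_extend_def Gamma5_def)
qed

lemma snd_tilde_extend: "snd (tilde n (graph_extend (Gamma5 n) V F)) = F \<union> grid_edges n"
  by (auto simp: tilde_def graph_extend_def grid_edges_def)

lemma grid_edgesD: "e \<in> grid_edges n \<Longrightarrow> \<exists>i j i' j'. e = {vertex.g i j, vertex.g i' j'}"
  unfolding grid_edges_def tilde_def Gamma5_def graph_extend_def by auto

text \<open>This transports the result for window \<open>k\<close> to a graph of the theorem. The
  grid part is common to all of them, so the hypotheses compare only the finitely many edges at the
  gadget.\<close>

lemma tilde_extend_wedge:
  fixes V :: "vertex set"
  assumes G: "simple_graph (tilde n (graph_extend (Gamma5 n) V F))" and W: "(Vs, Es) = snd (families ! k)" and k: "k < 12"
    and V: "\<forall>x\<in>V. \<forall>i j. x \<noteq> vertex.g i j" "inj_on gadget_label V" "gadget_label ` V = set Vs" "\<forall>a\<in>set Vs. 4 \<le> a"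
    and VV: "\<forall>x\<in>V. \<forall>y\<in>V. {x, y} \<in> F \<longleftrightarrow> adj Es (gadget_label x) (gadget_label y)"
    and Vg: "\<forall>x\<in>V. \<forall>i\<in>set [0, 1, 2, 3]. {x, vertex.g (Suc i) 1} \<in> F \<longleftrightarrow> adj Es (gadget_label x) i"
    and Vj: "\<forall>x\<in>V. \<forall>i j. {x, vertex.g i j} \<in> F \<longrightarrow> j = 1"
    and gg: "\<forall>i j i' j'. {vertex.g i j, vertex.g i' j'} \<notin> F"
  shows "homotopy_equivalent_to_wedge_of_spheres (geometric_realization (Ind (tilde n (graph_extend (Gamma5 n) V F))))"
proof -
  let ?G = "tilde n (graph_extend (Gamma5 n) V F)"
  let ?E = "\<lambda>x y. {x, y} \<in> F \<union> grid_edges n"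
  let ?X = "{(i, j). i < (4::nat) \<and> 1 \<le> j \<and> j \<le> 2 * Suc n}"
  \<comment> \<open>Rows are renumbered from 0, and gadget vertices go to column 0 under their
    labels.\<close>
  define m where "m = (\<lambda>x. case x of vertex.g i j \<Rightarrow> (i - 1, j) | _ \<Rightarrow> (gadget_label x, 0))"
  have mg: "m (vertex.g (Suc i) j) = (i, j)" for i j by (simp add: m_def)
  have mV: "m x = (gadget_label x, 0)" if "x \<in> V" for x
    using that V(1) by (cases x) (auto simp: m_def)
  have S: "fst ?G = V \<union> (\<lambda>(i, j). vertex.g (Suc i) j) ` ?X"
  proof -
    have "vertex.g i j \<in> (\<lambda>(i, j). vertex.g (Suc i) j) ` ?X" if "i \<in> {1..4}" "1 \<le> j" "j \<le> 2 * n + 2" for i j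
      using that by (intro image_eqI[where x = "(i - 1, j)"]) auto
    then show ?thesis unfolding fst_tilde_extend by auto
  qed
  have finX: "finite ?X" by (rule finite_subset[of _ "{..<4} \<times> {..2 * Suc n}"]) auto
  have "finite V" using V(2,3) by (metis List.finite_set finite_imageD)
  moreover have "\<not> ?E x x" for x
    using G unfolding simple_graph_def snd_tilde_extend by fastforce
  ultimately have fin: "fin_graph (fst ?G) ?E"
    using finX unfolding S fin_graph_def by (auto simp: insert_commute)
  have "Ind ?G = indep_sets (fst ?G) ?E"
    by (simp add: Ind_def indep_sets_def snd_tilde_extend)
  moreover have "bouquet True (fst ?G) ?E"
  proof (rule bouquet_relabel[OF fin])
    have "families ! k = (fst (families ! k), Vs, Es)" using W by (metis prod.collapse)
    \<comment> \<open>The strip consists of \<open>Suc n\<close> pairs of columns. This number is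
      never 0, so the flag is \<open>True\<close> also for the windows whose bare gadget is
      exceptional.\<close>
    from families_bouquet[OF k this, of "Suc n"]
    show "bouquet True (window_verts Vs (Suc n)) (window_adj Es)" by simp
    show "bij_betw m (fst ?G) (window_verts Vs (Suc n))"
      unfolding bij_betw_def
    proof
      have "inj_on m V" using V(2) by (simp add: inj_on_def mV)
      moreover have "inj_on m ((\<lambda>(i, j). vertex.g (Suc i) j) ` ?X)"
        by (auto simp: inj_on_def mg)
      moreover have "m ` V \<inter> m ` (\<lambda>(i, j). vertex.g (Suc i) j) ` ?X = {}"
        by (auto simp: mg mV)
      ultimately show "inj_on m (fst ?G)" unfolding S inj_on_Un by blast
      have "m ` V = (\<lambda>a. (a, 0)) ` set Vs" using V(3) mV by force
      moreover have "m ` (\<lambda>(i, j). vertex.g (Suc i) j) ` ?X = ?X"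
        by (simp add: image_image case_prod_beta mg)
      ultimately show "m ` fst ?G = window_verts Vs (Suc n)"
        unfolding S image_Un window_verts_def by simp
    qed
    have VVm: "?E x y \<longleftrightarrow> window_adj Es (m x) (m y)" if "x \<in> V" "y \<in> V" for x y
    proof -
      have "{x, y} \<notin> grid_edges n" using that V(1) grid_edgesD by blast
      then show ?thesis using VV that by (simp add: mV)
    qed
    have Vgm: "?E x (vertex.g (Suc i) j) \<longleftrightarrow> window_adj Es (m x) (i, j)" if "x \<in> V" "i < 4" "1 \<le> j" for x i j
    proof -
      have "{x, vertex.g (Suc i) j} \<notin> grid_edges n" using that V(1) grid_edgesD by blast
      moreover have "i \<in> set [0, 1, 2, 3]" using that(2) by auto
      then have "{x, vertex.g (Suc i) j} \<in> F \<longleftrightarrow> j = 1 \<and> adj Es (gadget_label x) i"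
        using Vg[rule_format, OF that(1), of i] Vj[rule_format, OF that(1), of "Suc i" j] by (cases "j = 1") auto
      ultimately show ?thesis
        using that by (cases "j = 1") (simp_all add: mV window_adj_def)
    qed
    have ggm: "?E (vertex.g (Suc i) j) (vertex.g (Suc i') j') \<longleftrightarrow> window_adj Es (i, j) (i', j')"
      if "(i, j) \<in> ?X" "(i', j') \<in> ?X" for i j i' j'
      using gg grid_edges_iff[of i i' j j' n] that by (simp add: window_adj_def)
    show "?E x y \<longleftrightarrow> window_adj Es (m x) (m y)" if xy: "x \<in> fst ?G" "y \<in> fst ?G" for x y
    proof -
      have "z \<in> V \<or> (\<exists>i j. (i, j) \<in> ?X \<and> z = vertex.g (Suc i) j)" if "z \<in> fst ?G" for z
        using that unfolding S by auto
      from this[OF xy(1)] this[OF xy(2)]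
      consider "x \<in> V" "y \<in> V" | i j where "x \<in> V" "(i, j) \<in> ?X" "y = vertex.g (Suc i) j"
        | i j where "y \<in> V" "(i, j) \<in> ?X" "x = vertex.g (Suc i) j"
        | i j i' j' where "(i, j) \<in> ?X" "(i', j') \<in> ?X" "x = vertex.g (Suc i) j" "y = vertex.g (Suc i') j'"
        by blast
      then show ?thesis
      proof cases
        case 1 then show ?thesis by (rule VVm)
      next
        case 2 then show ?thesis using Vgm by (simp add: mg)
      next
        case (3 i j)
        have "?E x y \<longleftrightarrow> ?E y x" by (simp add: insert_commute)
        also have "\<dots> \<longleftrightarrow> window_adj Es (m y) (m x)" using Vgm[of y i j] 3 by (simp add: mg)
        finally show ?thesis by (simp only: window_adj_sym[of Es "m x"])
      next
        case 4 then show ?thesis using ggm by (simp add: mg)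
      qed
    qed
  qed
  ultimately show ?thesis using bouquet_imp_wedge_of_spheres[OF fin] by simp
qed

lemmas window_simps = families_def adj_def doubleton_eq_iff inj_on_def

lemma Gamma5_extend: "Gamma5 n = graph_extend (Gamma5 n) {} {}"
  by (simp add: graph_extend_def)

theorem theorem3p19:
  fixes n :: nat and G :: "vertex graph"
  assumes "G \<in> {tilde n (Gamma5 n), tilde n (Lambda5 n), tilde n (A5 n), tilde n (B5 n),
                tilde n (C5 n), tilde n (D5 n), tilde n (E5 n), tilde n (F5 n)}"
  shows "homotopy_equivalent_to_wedge_of_spheres (geometric_realization (Ind G))"
proof -
  let ?W = "\<lambda>H. homotopy_equivalent_to_wedge_of_spheres (geometric_realization (Ind (tilde n H)))"
  have Gamma: "?W (Gamma5 n)"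
    by (subst Gamma5_extend, rule tilde_extend_wedge[where k = 0 and Vs = "[]" and Es = "[]"])
      (use simple_graphs(2)[of "Gamma5 n" n] in \<open>simp_all add: window_simps flip: Gamma5_extend\<close>)
  have Lambda: "?W (Lambda5 n)"
    unfolding Lambda5_def
    by (rule tilde_extend_wedge[where k = 1, OF _ prod.collapse])
      (use simple_graphs(2)[of "Lambda5 n" n] in \<open>simp_all add: window_simps Lambda5_def\<close>)
  have A: "?W (A5 n)"
    unfolding A5_def
    by (rule tilde_extend_wedge[where k = 2, OF _ prod.collapse])
      (use simple_graphs(2)[of "A5 n" n] in \<open>simp_all add: window_simps A5_def\<close>)
  have B: "?W (B5 n)"
    unfolding B5_def
    by (rule tilde_extend_wedge[where k = 3, OF _ prod.collapse])
      (use simple_graphs(2)[of "B5 n" n] in \<open>simp_all add: window_simps B5_def\<close>)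
  have C: "?W (C5 n)"
    unfolding C5_def
    by (rule tilde_extend_wedge[where k = 4, OF _ prod.collapse])
      (use simple_graphs(2)[of "C5 n" n] in \<open>simp_all add: window_simps C5_def\<close>)
  have D: "?W (D5 n)"
    unfolding D5_def
    by (rule tilde_extend_wedge[where k = 5, OF _ prod.collapse])
      (use simple_graphs(2)[of "D5 n" n] in \<open>simp_all add: window_simps D5_def\<close>)
  have E: "?W (E5 n)"
    unfolding E5_def
    by (rule tilde_extend_wedge[where k = 6, OF _ prod.collapse])
      (use simple_graphs(2)[of "E5 n" n] in \<open>simp_all add: window_simps E5_def\<close>)
  have F: "?W (F5 n)"
    unfolding F5_def
    by (rule tilde_extend_wedge[where k = 7, OF _ prod.collapse])
      (use simple_graphs(2)[of "F5 n" n] in \<open>simp_all add: window_simps F5_def\<close>)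
  show ?thesis using assms Gamma Lambda A B C D E F by blast
qed

end
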